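(* For every $a>0$ and $m,n\in\mathbb Z$: (A) if $m>0$ then $bp_a(m,n)\ge a/m$; (B) if $m<0$ then $bp_a(m,n)=\mathrm{def}_a(m,n)=+\infty$.
   Context: Chekanov tori: let $Q\subset\mathbb C$ be the open first quadrant, $q\in Q$, and fix a foliation of $Q\setminus\{q\}$ by simple closed curves each winding once around $q$, such that for each $a>0$ exactly one leaf bounds a disk of area $a$ in $Q$. For $a>0$ let $\eta:\mathbb R/\mathbb Z\to Q$ be a counterclockwise regular parametrization of that leaf and $\Theta_a=\{\tfrac1{\sqrt2}(e^{2\pi is}\eta(t),e^{-2\pi is}\eta(t)):s,t\in\mathbb R/\mathbb Z\}\subset(\mathbb C^2,\omega_{std})$, a Lagrangian torus. Let $\Gamma,\gamma\in H_1(\Theta_a)$ be the classes of $t\mapsto\frac1{\sqrt2}(\eta(t),\eta(t))$ and $s\mapsto\frac1{\sqrt2}(e^{2\pi is}\eta(0),e^{-2\pi is}\eta(0))$, and $\hat\Gamma,\hat\gamma$ the dual basis of $H^1(\Theta_a;\mathbb Z)$. Use the parametrization class $s_0$ of $(t,s)\mapsto\frac1{\sqrt2}(e^{2\pi is}\eta(t),e^{-2\pi is}\eta(t))$, and set $bp_a(m,n):=bp^{s_0}_{\Theta_a}(m\hat\Gamma+n\hat\gamma)$, $\mathrm{def}_a(m,n):=\mathrm{def}_{\Theta_a}(m\hat\Gamma+n\hat\gamma)$. Let $(M,\omega)$ be a symplectic manifold (possibly with boundary) and $L\subset M$ a closed Lagrangian submanifold with inclusion $\iota:L\to M$. For a Lagrangian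 isotopy $\psi=\{\psi_t:L\to M\}_{0\le t\le T}$ with $\psi_0=\iota$, the Lagrangian flux $\mathrm{Flux}(\psi)_t\in H^1(L;\mathbb R)$ is the class whose value on the homology class of a closed curve $\gamma\subset L$ is the integral of $\omega$ over the surface swept out by $\gamma$ under $\{\psi_\tau\}_{0\le\tau\le t}$. The deformation invariant $\mathrm{def}_L:H^1(L;\mathbb R)\to(0,+\infty]$ is defined by $\mathrm{def}_L(\alpha)=\sup T$, the supremum over all $T\ge 0$ for which there exists a Lagrangian isotopy $\psi=\{\psi_t\}_{0\le t\le T}$ of $L$ in $M$ with $\psi_0=\iota$ and $\mathrm{Flux}(\psi)_t=-t\alpha$ for all $t\in[0,T]$. Poisson bracket convention: for $G\in C^\infty(M)$ define $\mathrm{sgrad}\,G$ by $\iota_{\mathrm{sgrad}\,G}\omega=-dG$, and $\{F,G\}=\omega(\mathrm{sgrad}\,G,\mathrm{sgrad}\,F)=dF(\mathrm{sgrad}\,G)$. Compact sets $X_0,X_1,Y_0,Y_1\subset M$ with $X_0\cap X_1=Y_0\cap Y_1=\emptyset$ form an admissible quadruple, and $pb_4^+(X_0,X_1,Y_0,Y_1)=\inf\max_M\{F,G\}$, the infimum over all pairs of compactly supported smooth functions $F,G$ on $M$ with $F|_{X_0}\le0$, $F|_{X_1}\ge1$, $G|_{Y_0}\le0$, $G|_{Y_1}\ge1$. For $L$ closed connected and a smooth fibration $f:L\to S^1=\mathbb R/\mathbb Z$, divide $S^1$ into four consecutive closed arcs $\gamma_1,\gamma_2,\gamma_3,\gamma_4$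 in counterclockwise order and set $X_0=f^{-1}(\gamma_1)$, $Y_1=f^{-1}(\gamma_2)$, $X_1=f^{-1}(\gamma_3)$, $Y_0=f^{-1}(\gamma_4)$; then $bp_L([f]):=1/pb_4^+(X_0,X_1,Y_0,Y_1)\in(0,+\infty]$ (equal to $+\infty$ if $pb_4^+=0$). This number depends only on the class $[f]$ of $f$ modulo precomposition with diffeomorphisms of $L$ isotopic to the identity, and not on the choice of arcs. If $L$ is a torus and $s$ is an isotopy class of diffeomorphisms $\mathbb T^n=\mathbb R^n/\mathbb Z^n\to L$, then for $a\in H^1(L;\mathbb Z)\setminus\{0\}$ let $(m_1,\dots,m_n)\in\mathbb Z^n$ represent $s^*a\in H^1(\mathbb T^n;\mathbb Z)$ and let $f_a=\ell_a\circ s^{-1}$ where $\ell_a(\theta)=\sum_i m_i\theta_i \bmod 1$; define $bp^s_L(a):=bp_L([f_a])$, and $bp^s_L(0):=+\infty$. *)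

theory Defs
  imports "HOL-Analysis.Analysis"
begin

fun Ck :: "nat \<Rightarrow> ('a::real_normed_vector \<Rightarrow> 'b::real_normed_vector) \<Rightarrow> bool" where
  "Ck 0 f = continuous_on UNIV f"
| "Ck (Suc k) f = ((\<forall>x. f differentiable (at x)) \<and>
                    (\<forall>v. Ck k (\<lambda>x. frechet_derivative f (at x) v)))"

definition smooth :: "('a::real_normed_vector \<Rightarrow> 'b::real_normed_vector) \<Rightarrow> bool" where
  "smooth f \<longleftrightarrow> (\<forall>k. Ck k f)"

definition omega :: "complex \<times> complex \<Rightarrow> complex \<times> complex \<Rightarrow> real" where
  "omega u v = Im (cnj (fst u) * fst v) + Im (cnj (snd u) * snd v)"

definition sgrad :: "(complex \<times> complex \<Rightarrow> real) \<Rightarrow> complex \<times> complex \<Rightarrow> complex \<times> complex" where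
  "sgrad G x = (THE X. \<forall>v. omega X v = - frechet_derivative G (at x) v)"

definition poisson :: "(complex \<times> complex \<Rightarrow> real) \<Rightarrow> (complex \<times> complex \<Rightarrow> real) \<Rightarrow> complex \<times> complex \<Rightarrow> real" where
  "poisson F G x = frechet_derivative F (at x) (sgrad G x)"

definition compactly_supported :: "(complex \<times> complex \<Rightarrow> real) \<Rightarrow> bool" where
  "compactly_supported F \<longleftrightarrow> compact (closure {x. F x \<noteq> 0})"

definition pb4plus :: "(complex \<times> complex) set \<Rightarrow> (complex \<times> complex) set \<Rightarrow>
    (complex \<times> complex) set \<Rightarrow> (complex \<times> complex) set \<Rightarrow> real" where
  "pb4plus X0 X1 Y0 Y1 = Inf {(SUP x. poisson F G x) | F G.
       smooth F \<and> smooth G \<and> compactly_supported F \<and> compactly_supported G \<and>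
       (\<forall>x\<in>X0. F x \<le> 0) \<and> (\<forall>x\<in>X1. F x \<ge> 1) \<and>
       (\<forall>x\<in>Y0. G x \<le> 0) \<and> (\<forall>x\<in>Y1. G x \<ge> 1)}"

definition inv_or_infty :: "real \<Rightarrow> ereal" where
  "inv_or_infty p = (if p = 0 then \<infinity> else ereal (1 / p))"

definition ccw_curve :: "(real \<Rightarrow> complex) \<Rightarrow> bool" where
  "ccw_curve \<eta> \<longleftrightarrow>
     integral {0..1} (\<lambda>t. Im (cnj (\<eta> t) * vector_derivative \<eta> (at t))) / 2 > 0"

definition leaf :: "(real \<Rightarrow> complex) \<Rightarrow> real \<Rightarrow> bool" where
  "leaf \<eta> a \<longleftrightarrow> smooth \<eta> \<and> (\<forall>t. \<eta> (t + 1) = \<eta> t) \<and>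
     (\<forall>t. vector_derivative \<eta> (at t) \<noteq> 0) \<and>
     (\<forall>t t'. \<eta> t = \<eta> t' \<longrightarrow> t - t' \<in> \<int>) \<and>
     (\<forall>t. Re (\<eta> t) > 0 \<and> Im (\<eta> t) > 0) \<and>
     ccw_curve \<eta> \<and>
     measure lebesgue (inside (\<eta> ` {0..1})) = a"

definition chek :: "(real \<Rightarrow> complex) \<Rightarrow> real \<Rightarrow> real \<Rightarrow> complex \<times> complex" where
  "chek \<eta> t s = (cis (2 * pi * s) * \<eta> t / complex_of_real (sqrt 2),
                  cis (- 2 * pi * s) * \<eta> t / complex_of_real (sqrt 2))"

text \<open>Closed arc [lo,hi] of R/Z (lo \<le> hi \<le> lo+1), tested on a real representative.\<close>
definition on_arc :: "real \<Rightarrow> real \<Rightarrow> real \<Rightarrow> bool" where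
  "on_arc lo hi x \<longleftrightarrow> (\<exists>k::int. lo \<le> x + of_int k \<and> x + of_int k \<le> hi)"

text \<open>Preimage under f = l_(m,n) o s0^{-1} of an arc, where l_(m,n)(t,s) = m t + n s mod 1.\<close>
definition fib_set :: "(real \<Rightarrow> complex) \<Rightarrow> int \<Rightarrow> int \<Rightarrow> real \<Rightarrow> real \<Rightarrow> (complex \<times> complex) set" where
  "fib_set \<eta> m n lo hi = (\<lambda>(t, s). chek \<eta> t s) ` {(t, s). on_arc lo hi (of_int m * t + of_int n * s)}"

text \<open>bp_a(m,n), arcs gamma1=[0,1/4], gamma2=[1/4,1/2], gamma3=[1/2,3/4], gamma4=[3/4,1];
  X0 = f^-1 gamma1, Y1 = f^-1 gamma2, X1 = f^-1 gamma3, Y0 = f^-1 gamma4.\<close>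
definition bp_chek :: "(real \<Rightarrow> complex) \<Rightarrow> int \<Rightarrow> int \<Rightarrow> ereal" where
  "bp_chek \<eta> m n =
     (if m = 0 \<and> n = 0 then \<infinity> else
      inv_or_infty (pb4plus (fib_set \<eta> m n 0 (1/4)) (fib_set \<eta> m n (1/2) (3/4))
                            (fib_set \<eta> m n (3/4) 1) (fib_set \<eta> m n (1/4) (1/2))))"

text \<open>A Lagrangian isotopy psi_tau (0 \<le> tau \<le> T) of the torus, written in the coordinates
  (t,s) of the parametrization s0: Psi tau t s = psi_tau (chek t s).\<close>
definition lag_isotopy :: "(real \<Rightarrow> complex) \<Rightarrow> (real \<Rightarrow> real \<Rightarrow> real \<Rightarrow> complex \<times> complex) \<Rightarrow> real \<Rightarrow> bool" where
  "lag_isotopy \<eta> \<Psi> T \<longleftrightarrow>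
     smooth (\<lambda>(\<tau>, t, s). \<Psi> \<tau> t s) \<and>
     (\<forall>t s. \<Psi> 0 t s = chek \<eta> t s) \<and>
     (\<forall>\<tau>\<in>{0..T}. \<forall>t s. \<Psi> \<tau> (t + 1) s = \<Psi> \<tau> t s \<and> \<Psi> \<tau> t (s + 1) = \<Psi> \<tau> t s) \<and>
     (\<forall>\<tau>\<in>{0..T}. \<forall>t s t' s'. \<Psi> \<tau> t s = \<Psi> \<tau> t' s' \<longrightarrow> t - t' \<in> \<int> \<and> s - s' \<in> \<int>) \<and>
     (\<forall>\<tau>\<in>{0..T}. \<forall>t s. \<forall>c d::real.
         c *\<^sub>R vector_derivative (\<lambda>u. \<Psi> \<tau> u s) (at t) +
         d *\<^sub>R vector_derivative (\<lambda>u. \<Psi> \<tau> t u) (at s) = 0 \<longrightarrow> c = 0 \<and> d = 0) \<and>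
     (\<forall>\<tau>\<in>{0..T}. \<forall>t s.
         omega (vector_derivative (\<lambda>u. \<Psi> \<tau> u s) (at t))
               (vector_derivative (\<lambda>u. \<Psi> \<tau> t u) (at s)) = 0)"

text \<open>Integral of omega over the surface (r,u) \<mapsto> psi_r(c(u)), 0 \<le> r \<le> tau, 0 \<le> u \<le> 1,
  swept by a loop c in the parameter plane.\<close>
definition swept_area :: "(real \<Rightarrow> real \<Rightarrow> real \<Rightarrow> complex \<times> complex) \<Rightarrow> (real \<Rightarrow> real \<times> real) \<Rightarrow> real \<Rightarrow> real" where
  "swept_area \<Psi> c \<tau> = integral {0..\<tau>} (\<lambda>r. integral {0..1} (\<lambda>u.
      omega (vector_derivative (\<lambda>r'. \<Psi> r' (fst (c u)) (snd (c u))) (at r))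
            (vector_derivative (\<lambda>u'. \<Psi> r (fst (c u')) (snd (c u'))) (at u))))"

text \<open>def_a(m,n): Flux(psi)_tau = -tau (m Gamma^ + n gamma^), tested on the basis
  Gamma (loop u \<mapsto> (u,0)) and gamma (loop u \<mapsto> (0,u)) of H_1.\<close>
definition def_chek :: "(real \<Rightarrow> complex) \<Rightarrow> int \<Rightarrow> int \<Rightarrow> ereal" where
  "def_chek \<eta> m n = Sup (ereal ` {T. T \<ge> 0 \<and> (\<exists>\<Psi>. lag_isotopy \<eta> \<Psi> T \<and>
      (\<forall>\<tau>\<in>{0..T}. swept_area \<Psi> (\<lambda>u. (u, 0)) \<tau> = - \<tau> * of_int m \<and>
                   swept_area \<Psi> (\<lambda>u. (0, u)) \<tau> = - \<tau> * of_int n))})"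

end

theory Submission
  imports Defs "HOL-Complex_Analysis.Complex_Analysis"
begin

text \<open>Bound on \<open>pb4plus\<close>: near the torus, the moment map \<open>c\<close> of the circle action and its angle \<open>s\<close>
  are conjugate, and they split off the plane of the leaf. Take \<open>F\<close>, \<open>G\<close> to be the coordinates of
  \<open>h P(m \<theta> + n s)\<close>, where \<open>P\<close> runs clockwise around a unit square, \<open>\<theta>\<close> extends the parameter of the
  leaf, and \<open>h = k \<xi>(c)\<close> is a cutoff. Their bracket is twice the areal speed of \<open>P\<close> times \<open>h {h, m \<theta> + n s}\<close>.
  The \<open>n\<close>-term is negligible when \<open>\<xi>\<close> decays slowly. For the \<open>m\<close>-term, conformal maps of the inside of
  the leaf and of the quadrant yield area-angle coordinates on both sides of the leaf; there
  \<open>k\<^sup>2\<close> rises at slope about \<open>1/a\<close> from the centre to the leaf and, as the area of the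
  quadrant is infinite, falls back to \<open>0\<close> at arbitrarily small slope. So the bracket is at most about
  \<open>m/a\<close> if \<open>m > 0\<close> and can be made arbitrarily small if \<open>m < 0\<close>. For the same reason
  the torus can be inflated forever, which makes the deformation invariant infinite for \<open>m < 0\<close>.\<close>

section \<open>Smooth functions on open sets\<close>

text \<open>Only a one-sided bound on the bracket is wanted, so the area-angle coordinates need not
  preserve area: it suffices to bound their Jacobian where the cutoff varies, sharply inside the
  leaf and crudely outside. A Riemann map with its derivative truncated to a Taylor polynomial is
  good enough for this: the area becomes a polynomial in the squared modulus, and the angle is
  corrected by a quotient that is smooth even at the centre. The boundary behaviour of the Riemann
  maps never enters. The cutoff is constant in a collar on either side of the leaf, and there the
  inner angle, the outer angle and an approximate extension of the leaf parameter are interpolated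
  freely. This is meaningful because each is the argument of \<open>z - w0\<close>, with one common
  \<open>w0\<close>, plus a single-valued function. The area \<open>a\<close> is a Lebesgue measure
  and the orientation the sign of a line integral. Both are tied to the Riemann maps by a Green
  formula for winding numbers that asks nothing of the boundary of the region. A slow cutoff in
  \<open>c\<close> needs a long range of \<open>c\<close>, but large \<open>|c|\<close> with a
  bounded plane coordinate would meet the coordinate axes; a shear of the chart removes this
  obstacle.\<close>

fun Ck_on :: "nat \<Rightarrow> 'a::real_normed_vector set \<Rightarrow> ('a \<Rightarrow> 'b::real_normed_vector) \<Rightarrow> bool" where
  "Ck_on 0 S f = continuous_on S f"
| "Ck_on (Suc k) S f = ((\<forall>x\<in>S. f differentiable (at x)) \<and>
                    (\<forall>v. Ck_on k S (\<lambda>x. frechet_derivative f (at x) v)))"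

definition smooth_on :: "'a::real_normed_vector set \<Rightarrow> ('a \<Rightarrow> 'b::real_normed_vector) \<Rightarrow> bool" where
  "smooth_on S f \<longleftrightarrow> (\<forall>k. Ck_on k S f)"

lemma Ck_eq_Ck_on_UNIV: "Ck k f = Ck_on k UNIV f"
  by (induction k f rule: Ck.induct) auto

lemma smooth_iff_smooth_on_UNIV: "smooth f \<longleftrightarrow> smooth_on UNIV f"
  by (simp add: smooth_def smooth_on_def Ck_eq_Ck_on_UNIV)

lemma Ck_on_cong:
  assumes "open S" "\<And>x. x \<in> S \<Longrightarrow> f x = g x" "Ck_on k S f"
  shows "Ck_on k S g"
  using assms(2,3)
proof (induction k arbitrary: f g)
  case 0
  then show ?case by (auto cong: continuous_on_cong)
next
  case (Suc k)
  have fd: "frechet_derivative f (at x) = frechet_derivative g (at x)" if "x \<in> S" for x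
    using Suc.prems \<open>open S\<close> that
    by (intro frechet_derivative_transform_within_open[of f x S g]) auto
  have "g differentiable (at x)" if "x \<in> S" for x
    using Suc.prems \<open>open S\<close> that
    by (meson differentiable_def has_derivative_transform_within_open Ck_on.simps(2))
  moreover have "Ck_on k S (\<lambda>x. frechet_derivative g (at x) v)" for v
    by (rule Suc.IH[of "\<lambda>x. frechet_derivative f (at x) v"]) (use fd Suc.prems in auto)
  ultimately show ?case by simp
qed

lemma Ck_on_subset: "Ck_on k S f \<Longrightarrow> T \<subseteq> S \<Longrightarrow> Ck_on k T f"
  by (induction k arbitrary: f) (auto intro: continuous_on_subset)

lemma Ck_on_local:
  assumes "\<And>x. x \<in> S \<Longrightarrow> \<exists>T. open T \<and> x \<in> T \<and> Ck_on k T f"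
  shows "Ck_on k S f"
  using assms
proof (induction k arbitrary: f)
  case 0
  then show ?case
    by (metis Ck_on.simps(1) continuous_at_imp_continuous_on continuous_on_eq_continuous_at)
next
  case (Suc k)
  have "f differentiable (at x)" if "x \<in> S" for x
    using Suc.prems[OF that] by auto
  moreover have "Ck_on k S (\<lambda>x. frechet_derivative f (at x) v)" for v
    by (rule Suc.IH) (use Suc.prems in fastforce)
  ultimately show ?case by simp
qed

lemma Ck_on_Suc_imp: "Ck_on (Suc k) S f \<Longrightarrow> Ck_on k S f"
proof (induction k arbitrary: f)
  case 0
  then show ?case
    by (auto intro!: continuous_at_imp_continuous_on differentiable_imp_continuous_within)
next
  case (Suc k)
  then show ?case by (metis Ck_on.simps(2))
qed

text \<open>Derivatives at points of an open set are unique, so any convenient formula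
  \<open>f'\<close> may replace \<open>frechet_derivative\<close>. Most closure properties below are
  proved by exhibiting such a formula.\<close>

lemma Ck_on_SucI:
  assumes "open S" "\<And>x. x \<in> S \<Longrightarrow> (f has_derivative f' x) (at x)"
    and "\<And>v. Ck_on k S (\<lambda>x. f' x v)"
  shows "Ck_on (Suc k) S f"
proof -
  have "Ck_on k S (\<lambda>x. frechet_derivative f (at x) v)" for v
    by (rule Ck_on_cong[OF assms(1) _ assms(3)[of v]])
      (use assms(2) frechet_derivative_at in metis)
  then show ?thesis using assms(2) by (auto simp: differentiable_def)
qed

lemma Ck_on_has_derivative:
  "Ck_on (Suc k) S f \<Longrightarrow> x \<in> S \<Longrightarrow> (f has_derivative frechet_derivative f (at x)) (at x)"
  by (simp add: frechet_derivative_works)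

lemma Ck_on_const: "open S \<Longrightarrow> Ck_on k S (\<lambda>x. c)"
proof (induction k arbitrary: c)
  case (Suc k)
  show ?case by (rule Ck_on_SucI[of S _ "\<lambda>x v. 0"]) (use Suc in auto)
qed auto

lemma Ck_on_bounded_linear:
  assumes "open S" "bounded_linear L" "Ck_on k S f"
  shows "Ck_on k S (\<lambda>x. L (f x))"
  using assms(3)
proof (induction k arbitrary: f)
  case 0
  then show ?case using assms(2) by (simp add: bounded_linear.continuous_on)
next
  case (Suc k)
  show ?case
  proof (rule Ck_on_SucI[OF assms(1), of _ "\<lambda>x v. L (frechet_derivative f (at x) v)"])
    show "((\<lambda>x. L (f x)) has_derivative (\<lambda>v. L (frechet_derivative f (at x) v))) (at x)"
      if "x \<in> S" for x
      using bounded_linear.has_derivative[OF assms(2) Ck_on_has_derivative[OF Suc.prems that]] .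
  qed (use Suc in auto)
qed

lemma Ck_on_add:
  assumes "open S" "Ck_on k S f" "Ck_on k S g"
  shows "Ck_on k S (\<lambda>x. f x + g x)"
  using assms(2,3)
proof (induction k arbitrary: f g)
  case 0
  then show ?case by (auto intro: continuous_intros)
next
  case (Suc k)
  show ?case
  proof (rule Ck_on_SucI[OF assms(1),
      of _ "\<lambda>x v. frechet_derivative f (at x) v + frechet_derivative g (at x) v"])
    show "((\<lambda>x. f x + g x) has_derivative
        (\<lambda>v. frechet_derivative f (at x) v + frechet_derivative g (at x) v)) (at x)"
      if "x \<in> S" for x
      using that Suc.prems by (intro has_derivative_add Ck_on_has_derivative)
  qed (use Suc in auto)
qed

lemma Ck_on_bounded_bilinear:
  assumes "open S" "bounded_bilinear B" "Ck_on k S f" "Ck_on k S g"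
  shows "Ck_on k S (\<lambda>x. B (f x) (g x))"
  using assms(3,4)
proof (induction k arbitrary: f g)
  case 0
  then show ?case using assms(2) by (auto intro: bounded_bilinear.continuous_on)
next
  case (Suc k)
  show ?case
  proof (rule Ck_on_SucI[OF assms(1),
      of _ "\<lambda>x v. B (f x) (frechet_derivative g (at x) v) + B (frechet_derivative f (at x) v) (g x)"])
    show "((\<lambda>x. B (f x) (g x)) has_derivative
        (\<lambda>v. B (f x) (frechet_derivative g (at x) v) + B (frechet_derivative f (at x) v) (g x))) (at x)"
      if "x \<in> S" for x
      using that Suc.prems by (intro bounded_bilinear.FDERIV[OF assms(2)] Ck_on_has_derivative)
    show "Ck_on k S (\<lambda>x. B (f x) (frechet_derivative g (at x) v) + B (frechet_derivative f (at x) v) (g x))" for v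
      using Suc by (intro Ck_on_add[OF assms(1)] Suc.IH Ck_on_Suc_imp[of k S f] Ck_on_Suc_imp[of k S g]) auto
  qed
qed

lemma Ck_on_sum:
  assumes "open S" "\<And>i. i \<in> I \<Longrightarrow> Ck_on k S (f i)"
  shows "Ck_on k S (\<lambda>x. \<Sum>i\<in>I. f i x)"
  using assms(2)
  by (induction I rule: infinite_finite_induct) (auto intro: Ck_on_const Ck_on_add assms(1))

text \<open>The chain rule contains the derivative of \<open>f\<close> at a moving point in a moving
  direction. Expanding the direction in \<open>Basis\<close> leaves only fixed directions
  \<open>b\<close>, to which the induction hypothesis applies; hence the Euclidean space in the
  middle.\<close>

lemma Ck_on_compose:
  fixes f :: "'b::euclidean_space \<Rightarrow> 'c::real_normed_vector" and g :: "'a::real_normed_vector \<Rightarrow> 'b"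
  assumes "open S" "open T" "\<And>x. x \<in> S \<Longrightarrow> g x \<in> T" "Ck_on k T f" "Ck_on k S g"
  shows "Ck_on k S (\<lambda>x. f (g x))"
  using assms(4,5)
proof (induction k arbitrary: f)
  case 0
  then show ?case
    using assms(3) by (auto intro: continuous_on_compose2[of T f S g])
next
  case (Suc k)
  let ?f' = "\<lambda>b y. frechet_derivative f (at y) b" and ?g' = "\<lambda>x v. frechet_derivative g (at x) v"
  show ?case
  proof (rule Ck_on_SucI[OF assms(1), of _ "\<lambda>x v. \<Sum>b\<in>Basis. (?g' x v \<bullet> b) *\<^sub>R ?f' b (g x)"])
    fix x assume x: "x \<in> S"
    have f: "(f has_derivative frechet_derivative f (at (g x))) (at (g x))"
      using Suc.prems(1) assms(3)[OF x] by (intro Ck_on_has_derivative)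
    have lin: "linear (frechet_derivative f (at (g x)))"
      using f has_derivative_linear by blast
    have "((\<lambda>x. f (g x)) has_derivative (\<lambda>v. frechet_derivative f (at (g x)) (?g' x v))) (at x)"
      using has_derivative_compose[OF Ck_on_has_derivative[OF Suc.prems(2) x] f] .
    moreover have "(\<lambda>v. frechet_derivative f (at (g x)) (?g' x v)) = (\<lambda>v. \<Sum>b\<in>Basis. (?g' x v \<bullet> b) *\<^sub>R ?f' b (g x))"
    proof
      fix v show "frechet_derivative f (at (g x)) (?g' x v) = (\<Sum>b\<in>Basis. (?g' x v \<bullet> b) *\<^sub>R ?f' b (g x))"
      using linear_sum[OF lin, of "\<lambda>b. (?g' x v \<bullet> b) *\<^sub>R b" Basis]
      unfolding linear_cmul[OF lin] euclidean_representation .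
    qed
    ultimately show "((\<lambda>x. f (g x)) has_derivative (\<lambda>v. \<Sum>b\<in>Basis. (?g' x v \<bullet> b) *\<^sub>R ?f' b (g x))) (at x)"
      by (rule subst[rotated])
  next
    fix v
    have "Ck_on k S (\<lambda>x. ?f' b (g x))" for b
      using Suc.prems Ck_on_Suc_imp by (intro Suc.IH) auto
    moreover have "Ck_on k S (\<lambda>x. ?g' x v \<bullet> b)" for b
      by (rule Ck_on_bounded_linear[OF assms(1) bounded_linear_inner_left]) (use Suc.prems in auto)
    ultimately show "Ck_on k S (\<lambda>x. \<Sum>b\<in>Basis. (?g' x v \<bullet> b) *\<^sub>R ?f' b (g x))"
      by (intro Ck_on_sum[OF assms(1)] Ck_on_bounded_bilinear[OF assms(1) bounded_bilinear_scaleR])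
  qed
qed

lemma Ck_on_id: "open S \<Longrightarrow> Ck_on k S (\<lambda>x. x)"
proof (cases k)
  case (Suc j)
  assume "open S"
  then show ?thesis unfolding Suc
    by (intro Ck_on_SucI[of S _ "\<lambda>x v. v"]) (auto intro: Ck_on_const)
qed auto

text \<open>\<open>deriv f x * v\<close> is again holomorphic in \<open>x\<close>, so the induction
  never leaves the class.\<close>

lemma Ck_on_holomorphic:
  "open S \<Longrightarrow> f holomorphic_on S \<Longrightarrow> Ck_on k S f"
proof (induction k arbitrary: f)
  case 0
  then show ?case by (simp add: holomorphic_on_imp_continuous_on)
next
  case (Suc k)
  show ?case
  proof (rule Ck_on_SucI[OF Suc.prems(1), of _ "\<lambda>x v. deriv f x * v"])
    show "(f has_derivative (*) (deriv f x)) (at x)" if "x \<in> S" for x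
      using holomorphic_derivI[OF Suc.prems(2,1) that] by (simp add: has_field_derivative_def)
    show "Ck_on k S (\<lambda>x. deriv f x * v)" for v
      using Suc by (intro Suc.IH holomorphic_intros) auto
  qed
qed

lemma Ck_on_of_real_deriv:
  fixes f :: "real \<Rightarrow> real"
  assumes "open S" "\<And>x. x \<in> S \<Longrightarrow> (f has_real_derivative f' x) (at x)" "Ck_on k S f'"
  shows "Ck_on (Suc k) S f"
proof (rule Ck_on_SucI[OF assms(1), of _ "\<lambda>x v. f' x * v"])
  show "(f has_derivative (*) (f' x)) (at x)" if "x \<in> S" for x
    using assms(2)[OF that] by (simp add: has_field_derivative_def)
  show "Ck_on k S (\<lambda>x. f' x * v)" for v
    by (rule Ck_on_bounded_linear[OF assms(1) bounded_linear_mult_left assms(3)])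
qed

named_theorems smooth_intros

lemma smooth_onD: "smooth_on S f \<Longrightarrow> Ck_on k S f"
  by (simp add: smooth_on_def)

lemma smooth_on_cong: "open S \<Longrightarrow> (\<And>x. x \<in> S \<Longrightarrow> f x = g x) \<Longrightarrow> smooth_on S f \<Longrightarrow> smooth_on S g"
  unfolding smooth_on_def using Ck_on_cong by blast

lemma smooth_on_subset: "smooth_on S f \<Longrightarrow> T \<subseteq> S \<Longrightarrow> smooth_on T f"
  unfolding smooth_on_def using Ck_on_subset by blast

lemma smooth_on_local:
  "(\<And>x. x \<in> S \<Longrightarrow> \<exists>T. open T \<and> x \<in> T \<and> smooth_on T f) \<Longrightarrow> smooth_on S f"
  unfolding smooth_on_def by (meson Ck_on_local)

lemma smooth_on_Un: "open S \<Longrightarrow> open T \<Longrightarrow> smooth_on S f \<Longrightarrow> smooth_on T f \<Longrightarrow> smooth_on (S \<union> T) f"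
  by (rule smooth_on_local) blast

lemma smooth_on_const [smooth_intros]: "open S \<Longrightarrow> smooth_on S (\<lambda>x. c)"
  by (simp add: smooth_on_def Ck_on_const)

lemma smooth_on_id [smooth_intros]: "open S \<Longrightarrow> smooth_on S (\<lambda>x. x)"
  by (simp add: smooth_on_def Ck_on_id)

lemma smooth_on_bounded_linear:
  "open S \<Longrightarrow> bounded_linear L \<Longrightarrow> smooth_on S f \<Longrightarrow> smooth_on S (\<lambda>x. L (f x))"
  by (simp add: smooth_on_def Ck_on_bounded_linear)

lemma smooth_on_bounded_bilinear:
  "open S \<Longrightarrow> bounded_bilinear B \<Longrightarrow> smooth_on S f \<Longrightarrow> smooth_on S g \<Longrightarrow> smooth_on S (\<lambda>x. B (f x) (g x))"
  by (simp add: smooth_on_def Ck_on_bounded_bilinear)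

lemma smooth_on_add [smooth_intros]:
  "open S \<Longrightarrow> smooth_on S f \<Longrightarrow> smooth_on S g \<Longrightarrow> smooth_on S (\<lambda>x. f x + g x)"
  by (simp add: smooth_on_def Ck_on_add)

lemma smooth_on_uminus [smooth_intros]:
  "open S \<Longrightarrow> smooth_on S f \<Longrightarrow> smooth_on S (\<lambda>x. - f x)"
  by (rule smooth_on_bounded_linear[OF _ bounded_linear_minus[OF bounded_linear_ident]])

lemma smooth_on_diff [smooth_intros]:
  "open S \<Longrightarrow> smooth_on S f \<Longrightarrow> smooth_on S g \<Longrightarrow> smooth_on S (\<lambda>x. f x - g x)"
  using smooth_on_add[OF _ _ smooth_on_uminus] by fastforce

lemma smooth_on_mult [smooth_intros]:
  fixes f g :: "_ \<Rightarrow> 'b::real_normed_algebra"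
  shows "open S \<Longrightarrow> smooth_on S f \<Longrightarrow> smooth_on S g \<Longrightarrow> smooth_on S (\<lambda>x. f x * g x)"
  by (rule smooth_on_bounded_bilinear[OF _ bounded_bilinear_mult])

lemma smooth_on_power [smooth_intros]:
  fixes f :: "_ \<Rightarrow> 'b::real_normed_algebra_1"
  shows "open S \<Longrightarrow> smooth_on S f \<Longrightarrow> smooth_on S (\<lambda>x. f x ^ n)"
  by (induction n) (auto intro: smooth_intros)

lemma smooth_on_sum [smooth_intros]:
  "open S \<Longrightarrow> (\<And>i. i \<in> I \<Longrightarrow> smooth_on S (f i)) \<Longrightarrow> smooth_on S (\<lambda>x. \<Sum>i\<in>I. f i x)"
  by (simp add: smooth_on_def Ck_on_sum)

lemma smooth_on_compose:
  fixes f :: "'b::euclidean_space \<Rightarrow> 'c::real_normed_vector"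
  shows "smooth_on T f \<Longrightarrow> open S \<Longrightarrow> open T \<Longrightarrow> (\<And>x. x \<in> S \<Longrightarrow> g x \<in> T) \<Longrightarrow> smooth_on S g
    \<Longrightarrow> smooth_on S (\<lambda>x. f (g x))"
  unfolding smooth_on_def using Ck_on_compose by blast

lemma smooth_on_holomorphic: "open S \<Longrightarrow> f holomorphic_on S \<Longrightarrow> smooth_on S f"
  by (simp add: smooth_on_def Ck_on_holomorphic)

lemma smooth_on_Re [smooth_intros]: "open S \<Longrightarrow> smooth_on S f \<Longrightarrow> smooth_on S (\<lambda>x. Re (f x))"
  by (rule smooth_on_bounded_linear[OF _ bounded_linear_Re])

lemma smooth_on_Im [smooth_intros]: "open S \<Longrightarrow> smooth_on S f \<Longrightarrow> smooth_on S (\<lambda>x. Im (f x))"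
  by (rule smooth_on_bounded_linear[OF _ bounded_linear_Im])

lemma smooth_on_cnj [smooth_intros]: "open S \<Longrightarrow> smooth_on S f \<Longrightarrow> smooth_on S (\<lambda>x. cnj (f x))"
  by (rule smooth_on_bounded_linear[OF _ bounded_linear_cnj])

lemma smooth_on_of_real [smooth_intros]:
  "open S \<Longrightarrow> smooth_on S f \<Longrightarrow> smooth_on S (\<lambda>x. complex_of_real (f x))"
  by (rule smooth_on_bounded_linear[OF _ bounded_linear_of_real])

lemma smooth_on_fst [smooth_intros]: "open S \<Longrightarrow> smooth_on S f \<Longrightarrow> smooth_on S (\<lambda>x. fst (f x))"
  by (rule smooth_on_bounded_linear[OF _ bounded_linear_fst])

lemma smooth_on_snd [smooth_intros]: "open S \<Longrightarrow> smooth_on S f \<Longrightarrow> smooth_on S (\<lambda>x. snd (f x))"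
  by (rule smooth_on_bounded_linear[OF _ bounded_linear_snd])

lemma smooth_on_Pair [smooth_intros]:
  assumes "open S" "smooth_on S f" "smooth_on S g"
  shows "smooth_on S (\<lambda>x. (f x, g x))"
proof -
  have "smooth_on S (\<lambda>x. (f x, 0) + (0, g x))"
    using assms by (intro smooth_on_add smooth_on_bounded_linear[of S "\<lambda>y. (y, 0)"]
        smooth_on_bounded_linear[of S "\<lambda>y. (0, y)"] bounded_linear_Pair bounded_linear_ident bounded_linear_zero)
  then show ?thesis by simp
qed

lemma smooth_on_inverse [smooth_intros]:
  fixes f :: "_ \<Rightarrow> complex"
  assumes "open S" "smooth_on S f" "\<And>x. x \<in> S \<Longrightarrow> f x \<noteq> 0"
  shows "smooth_on S (\<lambda>x. inverse (f x))"
  by (rule smooth_on_compose[of "- {0}" inverse])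
    (use assms in \<open>auto intro!: smooth_on_holomorphic holomorphic_intros\<close>)

lemma smooth_on_divide [smooth_intros]:
  fixes f g :: "_ \<Rightarrow> complex"
  assumes "open S" "smooth_on S f" "smooth_on S g" "\<And>x. x \<in> S \<Longrightarrow> g x \<noteq> 0"
  shows "smooth_on S (\<lambda>x. f x / g x)"
  unfolding divide_inverse using assms by (intro smooth_intros)

lemma smooth_on_divide_real [smooth_intros]:
  fixes f g :: "_ \<Rightarrow> real"
  assumes "open S" "smooth_on S f" "smooth_on S g" "\<And>x. x \<in> S \<Longrightarrow> g x \<noteq> 0"
  shows "smooth_on S (\<lambda>x. f x / g x)"
proof -
  have "smooth_on S (\<lambda>x. Re (complex_of_real (f x) / complex_of_real (g x)))"
    using assms by (intro smooth_intros) auto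
  then show ?thesis by (simp flip: of_real_divide)
qed

lemma smooth_on_exp [smooth_intros]:
  fixes f :: "_ \<Rightarrow> complex"
  shows "open S \<Longrightarrow> smooth_on S f \<Longrightarrow> smooth_on S (\<lambda>x. exp (f x))"
  by (rule smooth_on_compose[of UNIV exp]) (auto intro!: smooth_on_holomorphic holomorphic_intros)

lemma smooth_on_cis [smooth_intros]:
  "open S \<Longrightarrow> smooth_on S f \<Longrightarrow> smooth_on S (\<lambda>x. cis (f x))"
  unfolding cis_conv_exp by (intro smooth_intros)

lemma smooth_on_Ln [smooth_intros]:
  assumes "open S" "smooth_on S f" "\<And>x. x \<in> S \<Longrightarrow> f x \<notin> \<real>\<^sub>\<le>\<^sub>0"
  shows "smooth_on S (\<lambda>x. Ln (f x))"
  by (rule smooth_on_compose[of "- \<real>\<^sub>\<le>\<^sub>0" Ln])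
    (use assms in \<open>auto intro!: smooth_on_holomorphic holomorphic_intros\<close>)

lemma smooth_on_sqrt [smooth_intros]:
  assumes "open S" "smooth_on S f" "\<And>x. x \<in> S \<Longrightarrow> f x > 0"
  shows "smooth_on S (\<lambda>x. sqrt (f x))"
proof -
  have "smooth_on S (\<lambda>x. csqrt (complex_of_real (f x)))"
    by (rule smooth_on_compose[of "- \<real>\<^sub>\<le>\<^sub>0" csqrt])
      (use assms in \<open>auto intro!: smooth_on_holomorphic holomorphic_intros smooth_intros
        simp: complex_nonpos_Reals_iff not_le\<close>)
  then have "smooth_on S (\<lambda>x. Re (csqrt (complex_of_real (f x))))"
    using assms(1) by (intro smooth_intros)
  then show ?thesis
    by (rule smooth_on_cong[OF assms(1), rotated]) (use assms(3) in \<open>simp add: less_imp_le\<close>)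
qed

lemma smooth_on_has_derivative:
  "smooth_on S f \<Longrightarrow> x \<in> S \<Longrightarrow> (f has_derivative frechet_derivative f (at x)) (at x)"
  using Ck_on_has_derivative[of 0 S f] smooth_onD by blast

lemma smooth_on_frechet_derivative:
  "smooth_on S f \<Longrightarrow> smooth_on S (\<lambda>x. frechet_derivative f (at x) v)"
  unfolding smooth_on_def by (metis Ck_on.simps(2))

lemma smooth_on_imp_continuous_on: "smooth_on S f \<Longrightarrow> continuous_on S f"
  using smooth_onD[of S f 0] by simp

lemma smooth_on_cmod_square: "open S \<Longrightarrow> smooth_on S h \<Longrightarrow> smooth_on S (\<lambda>x. (cmod (h x))\<^sup>2)"
  unfolding cmod_power2 by (intro smooth_intros)

text \<open>\<open>U\<close> and \<open>- Z\<close> form an open cover. Cutoffs given by a formula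
  in local coordinates on \<open>U\<close> become global functions in this way.\<close>

lemma smooth_on_zero_extension:
  assumes "open U" "closed Z" "Z \<subseteq> U" "smooth_on U f" "\<And>x. x \<notin> Z \<Longrightarrow> f x = 0"
  shows "smooth_on UNIV f"
proof -
  have "smooth_on (- Z) f"
    by (rule smooth_on_cong[of _ "\<lambda>x. 0"]) (use assms in \<open>auto intro: smooth_intros\<close>)
  then have "smooth_on (U \<union> - Z) f"
    using assms by (intro smooth_on_Un) auto
  moreover have "U \<union> - Z = UNIV" using assms(3) by auto
  ultimately show ?thesis by simp
qed

section \<open>Smooth steps on the line with prescribed slope\<close>

definition flat_exp :: "nat \<Rightarrow> real \<Rightarrow> real" where
  "flat_exp n x = (if x \<le> 0 then 0 else exp (- 1 / x) / x ^ n)"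

lemma flat_exp_tendsto_0: "(flat_exp n \<longlongrightarrow> 0) (at 0)"
proof (rule filterlim_split_at_real)
  show "(flat_exp n \<longlongrightarrow> 0) (at_left 0)"
    by (rule tendsto_eventually) (auto simp: flat_exp_def eventually_at_left_field intro!: exI[of _ "-1"])
  have "((\<lambda>y::real. y ^ n / exp y) \<longlongrightarrow> 0) at_top"
    by (rule tendsto_power_div_exp_0)
  then have "((\<lambda>x::real. inverse x ^ n / exp (inverse x)) \<longlongrightarrow> 0) (at_right 0)"
    by (rule filterlim_compose[OF _ filterlim_inverse_at_top_right])
  moreover have "\<forall>\<^sub>F x in at_right 0. inverse x ^ n / exp (inverse x) = flat_exp n x"
    by (auto simp: flat_exp_def eventually_at_right_field exp_minus field_simps intro!: exI[of _ 1])
  ultimately show "(flat_exp n \<longlongrightarrow> 0) (at_right 0)"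
    by (rule Lim_transform_eventually)
qed

text \<open>The family is closed under differentiation, which is the purpose of the exponent
  \<open>n\<close>: continuity of all members gives smoothness of all members by induction on the
  order.\<close>

lemma has_real_derivative_flat_exp:
  "(flat_exp n has_real_derivative flat_exp (n + 2) x - real n * flat_exp (n + 1) x) (at x)"
proof -
  consider "x < 0" | "x > 0" | "x = 0" by linarith
  then show ?thesis
  proof cases
    case 1
    have "((\<lambda>x. 0) has_real_derivative 0) (at x)" by simp
    then have "(flat_exp n has_real_derivative 0) (at x)"
      by (rule has_field_derivative_transform_within_open[of _ _ _ "{..<0}"])
        (use 1 in \<open>auto simp: flat_exp_def\<close>)
    then show ?thesis using 1 by (simp add: flat_exp_def)
  next
    case 2
    have "((\<lambda>x. exp (- 1 / x) / x ^ n) has_real_derivative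
        exp (- 1 / x) / x ^ (n + 2) - real n * (exp (- 1 / x) / x ^ (n + 1))) (at x)"
    proof (cases n)
      case 0
      then show ?thesis using 2
        by (auto intro!: derivative_eq_intros simp: power2_eq_square)
    next
      case (Suc k)
      have "((\<lambda>x. inverse x ^ n * exp (- 1 / x)) has_real_derivative
          real n * inverse x ^ k * (- (inverse x * inverse x)) * exp (- 1 / x)
          + inverse x ^ n * (exp (- 1 / x) * (1 / x\<^sup>2))) (at x)"
        unfolding Suc using 2
        by (auto intro!: derivative_eq_intros simp: power2_eq_square divide_inverse;
            cases k; simp add: algebra_simps)
      then show ?thesis unfolding Suc
        by (simp add: field_simps power2_eq_square)
    qed
    then have "(flat_exp n has_real_derivative
        exp (- 1 / x) / x ^ (n + 2) - real n * (exp (- 1 / x) / x ^ (n + 1))) (at x)"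
      by (rule has_field_derivative_transform_within_open[of _ _ _ "{0<..}"])
        (use 2 in \<open>auto simp: flat_exp_def\<close>)
    then show ?thesis using 2 by (simp add: flat_exp_def)
  next
    case 3
    \<comment> \<open>At \<open>0\<close> the difference quotient of \<open>flat_exp n\<close> is
      \<open>flat_exp (Suc n)\<close>, whose limit is already known to be \<open>0\<close>.\<close>
    have "\<forall>\<^sub>F h in at 0. flat_exp (Suc n) h = (flat_exp n (0 + h) - flat_exp n 0) / h"
      by (auto simp: flat_exp_def eventually_at_filter)
    then have "((\<lambda>h. (flat_exp n (0 + h) - flat_exp n 0) / h) \<longlongrightarrow> 0) (at 0)"
      by (rule Lim_transform_eventually[OF flat_exp_tendsto_0])
    then show ?thesis using 3 by (simp add: DERIV_def flat_exp_def)
  qed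
qed

lemma smooth_on_flat_exp: "smooth_on UNIV (flat_exp n)"
  unfolding smooth_on_def
proof
  fix k show "Ck_on k UNIV (flat_exp n)"
  proof (induction k arbitrary: n)
    case 0
    have "continuous_on UNIV (flat_exp n)"
      using has_real_derivative_flat_exp
      by (intro continuous_at_imp_continuous_on ballI DERIV_isCont) blast
    then show ?case by simp
  next
    case (Suc k)
    have "Ck_on k UNIV (\<lambda>x. flat_exp (n + 2) x + (- real n) * flat_exp (n + 1) x)"
      by (intro Ck_on_add Ck_on_bounded_linear[OF _ bounded_linear_mult_right] Suc.IH) auto
    then have "Ck_on k UNIV (\<lambda>x. flat_exp (n + 2) x - real n * flat_exp (n + 1) x)"
      by simp
    then show ?case
      by (intro Ck_on_of_real_deriv[OF _ has_real_derivative_flat_exp]) auto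
  qed
qed

definition smooth_step :: "real \<Rightarrow> real" where
  "smooth_step x = flat_exp 0 x / (flat_exp 0 x + flat_exp 0 (1 - x))"

lemma flat_exp_denominator_pos: "flat_exp 0 x + flat_exp 0 (1 - x) > 0"
  by (auto simp: flat_exp_def add_pos_pos)

lemma smooth_on_smooth_step: "smooth_on UNIV smooth_step"
proof -
  have "smooth_on UNIV (\<lambda>x. flat_exp 0 x / (flat_exp 0 x + flat_exp 0 (1 - x)))"
    using flat_exp_denominator_pos[THEN less_imp_neq, THEN not_sym]
    by (intro smooth_intros smooth_on_flat_exp smooth_on_compose[OF smooth_on_flat_exp]) simp_all
  then show ?thesis by (simp add: smooth_step_def[abs_def])
qed

lemma smooth_step_le_0 [simp]: "x \<le> 0 \<Longrightarrow> smooth_step x = 0"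
  by (simp add: smooth_step_def flat_exp_def)

lemma smooth_step_ge_1 [simp]: "x \<ge> 1 \<Longrightarrow> smooth_step x = 1"
  by (simp add: smooth_step_def flat_exp_def)

lemma smooth_step_nonneg: "0 \<le> smooth_step x"
  using flat_exp_denominator_pos[of x] by (auto simp: smooth_step_def flat_exp_def)

lemma smooth_step_le: "smooth_step x \<le> 1"
  using flat_exp_denominator_pos[of x] by (auto simp: smooth_step_def flat_exp_def)

text \<open>The lower limit \<open>-1\<close> lies strictly inside the zero set of the integrand, so that the
  formula is differentiable everywhere although Isabelle's integral over \<open>{-1..x}\<close> vanishes for
  \<open>x < -1\<close>.\<close>

definition smooth_ramp :: "real \<Rightarrow> real" where
  "smooth_ramp x = integral {-1..x} smooth_step"

lemma continuous_on_smooth_step: "continuous_on S smooth_step"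
  using smooth_on_imp_continuous_on[OF smooth_on_smooth_step] continuous_on_subset by blast

lemma smooth_ramp_le_0 [simp]: assumes "x \<le> 0" shows "smooth_ramp x = 0"
proof -
  have "integral {-1..x} smooth_step = integral {-1..x} (\<lambda>x. 0)"
    by (rule integral_cong) (use assms in auto)
  then show ?thesis by (simp add: smooth_ramp_def)
qed

lemma has_real_derivative_smooth_ramp:
  "(smooth_ramp has_real_derivative smooth_step x) (at x)"
proof (cases "x < 0")
  case True
  have "((\<lambda>x. 0) has_real_derivative 0) (at x)" by simp
  then have "(smooth_ramp has_real_derivative 0) (at x)"
    by (rule has_field_derivative_transform_within_open[of _ _ _ "{..<0}"]) (use True in auto)
  then show ?thesis using True by simp
next
  case False
  have "((\<lambda>u. integral {-1..u} smooth_step) has_real_derivative smooth_step x) (at x within {-1..x+1})"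
    by (rule integral_has_real_derivative) (use False continuous_on_smooth_step in auto)
  moreover have "at x within {-1..x+1} = at x"
    using False by (intro at_within_interior) auto
  ultimately show ?thesis by (simp add: smooth_ramp_def[abs_def])
qed

lemma smooth_on_smooth_ramp: "smooth_on UNIV smooth_ramp"
  unfolding smooth_on_def
proof
  fix k show "Ck_on k UNIV smooth_ramp"
    by (rule Ck_on_Suc_imp, rule Ck_on_of_real_deriv[OF _ has_real_derivative_smooth_ramp])
      (use smooth_onD[OF smooth_on_smooth_step] in auto)
qed

lemma smooth_ramp_ge_1: assumes "x \<ge> 1" shows "smooth_ramp x = smooth_ramp 1 + (x - 1)"
proof -
  have "((\<lambda>x. smooth_ramp x - x) has_real_derivative 0) (at y within {1..x})" if "y \<in> {1..x}" for y
    using has_real_derivative_smooth_ramp[of y] that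
    by (auto intro!: derivative_eq_intros intro: has_field_derivative_at_within)
  then have "smooth_ramp x - x = smooth_ramp 1 - 1"
    using assms has_field_derivative_zero_constant[of "{1..x}" "\<lambda>x. smooth_ramp x - x"]
    by (metis (no_types, lifting) atLeastAtMost_iff convex_real_interval(5) order_refl)
  then show ?thesis by simp
qed

text \<open>\<open>T'\<close> is the difference of two steps of width \<open>\<kappa>\<close>, one
  starting at \<open>0\<close> and one ending at \<open>1\<close>, divided by the area
  \<open>1 - \<kappa>\<close> under this plateau. Rising by \<open>1\<close> over unit length forces
  slope at least \<open>1\<close> somewhere; a small \<open>\<kappa>\<close> keeps the excess below
  \<open>\<delta>\<close>.\<close>

lemma tight_smooth_step:
  assumes "\<delta> > 0"
  obtains T T' :: "real \<Rightarrow> real" where "smooth_on UNIV T"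
    "\<And>x. (T has_real_derivative T' x) (at x)" "\<And>x. 0 \<le> T' x" "\<And>x. T' x \<le> 1 + \<delta>"
    "\<And>x. x \<le> 0 \<Longrightarrow> T x = 0" "\<And>x. x \<ge> 1 \<Longrightarrow> T x = 1" "\<And>x. 0 \<le> T x" "\<And>x. T x \<le> 1"
proof
  define \<kappa> where "\<kappa> = min (1/2) (\<delta> / (1 + \<delta>))"
  have \<kappa>: "0 < \<kappa>" "\<kappa> \<le> 1/2" "\<kappa> \<le> \<delta> / (1 + \<delta>)"
    using assms by (auto simp: \<kappa>_def min_def)
  have \<kappa>': "1 / (1 - \<kappa>) \<le> 1 + \<delta>"
    using \<kappa> assms by (simp add: field_simps)
  define T where "T x = (smooth_ramp (x / \<kappa>) - smooth_ramp ((x - (1 - \<kappa>)) / \<kappa>)) * (\<kappa> / (1 - \<kappa>))" for x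
  define T' where "T' x = (smooth_step (x / \<kappa>) - smooth_step ((x - (1 - \<kappa>)) / \<kappa>)) / (1 - \<kappa>)" for x
  show "smooth_on UNIV T"
    unfolding T_def[abs_def]
    by (intro smooth_intros smooth_on_compose[OF smooth_on_smooth_ramp]) (use \<kappa> in auto)
  show der: "(T has_real_derivative T' x) (at x)" for x
  proof -
    have "(T has_real_derivative (smooth_step (x / \<kappa>) * (1 / \<kappa>) -
        smooth_step ((x - (1 - \<kappa>)) / \<kappa>) * (1 / \<kappa>)) * (\<kappa> / (1 - \<kappa>))) (at x)"
      unfolding T_def[abs_def]
      by (intro DERIV_cmult_right DERIV_diff DERIV_chain2[OF has_real_derivative_smooth_ramp])
        (use \<kappa> in \<open>auto intro!: derivative_eq_intros\<close>)
    also have "(smooth_step (x / \<kappa>) * (1 / \<kappa>) -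
        smooth_step ((x - (1 - \<kappa>)) / \<kappa>) * (1 / \<kappa>)) * (\<kappa> / (1 - \<kappa>)) = T' x"
      using \<kappa> unfolding T'_def left_diff_distrib[symmetric] by simp
    finally show ?thesis .
  qed
  \<comment> \<open>Since \<open>\<kappa> \<le> 1/2\<close>, the second step begins only after the
    first has ended.\<close>
  show T'0: "0 \<le> T' x" for x
  proof (cases "x \<ge> \<kappa>")
    case True
    then show ?thesis using \<kappa> smooth_step_le by (auto simp: T'_def)
  next
    case False
    then have "(x - (1 - \<kappa>)) / \<kappa> \<le> 0" using \<kappa> by (simp add: field_simps)
    then show ?thesis using \<kappa> smooth_step_nonneg by (auto simp: T'_def)
  qed
  have "T' x \<le> 1 / (1 - \<kappa>)" for x
    unfolding T'_def using \<kappa> smooth_step_le[of "x / \<kappa>"] smooth_step_nonneg[of "(x - (1 - \<kappa>)) / \<kappa>"]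
    by (intro divide_right_mono) auto
  then show "T' x \<le> 1 + \<delta>" for x using \<kappa>' order_trans by blast
  have mono: "T x \<le> T y" if "x \<le> y" for x y
    using that der T'0 by (meson DERIV_nonneg_imp_nondecreasing)
  show z: "T x = 0" if "x \<le> 0" for x
    using that \<kappa> by (auto simp: T_def divide_le_0_iff)
  show o: "T x = 1" if "x \<ge> 1" for x
  proof -
    have "x / \<kappa> \<ge> 1" "(x - (1 - \<kappa>)) / \<kappa> \<ge> 1" using that \<kappa> by (auto simp: field_simps)
    then have "T x = (x / \<kappa> - (x - (1 - \<kappa>)) / \<kappa>) * (\<kappa> / (1 - \<kappa>))"
      unfolding T_def by (subst (1 2) smooth_ramp_ge_1) auto
    also have "x / \<kappa> - (x - (1 - \<kappa>)) / \<kappa> = (1 - \<kappa>) / \<kappa>"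
      unfolding diff_divide_distrib[symmetric] by simp
    also have "\<dots> * (\<kappa> / (1 - \<kappa>)) = 1" using \<kappa> by simp
    finally show ?thesis .
  qed
  show "0 \<le> T x" for x using mono[of "min x 0" x] z[of "min x 0"] by auto
  show "T x \<le> 1" for x using mono[of x "max x 1"] o[of "max x 1"] by auto
qed

text \<open>The bracket contains \<open>k\<close> times the derivative of \<open>k\<close>, half the
  derivative of the square, so it is the square of the profile that should rise with slope close to
  \<open>1\<close>. The root is taken of \<open>T + \<sigma>\<^sup>2\<close> to avoid its
  singularity at \<open>0\<close>; subtracting \<open>\<sigma>\<close> and dividing by
  \<open>N\<close> restores the end values, and the rescaling \<open>s\<close> leaves a margin at
  both ends where \<open>p\<close> is constant.\<close>

lemma tight_smooth_sqrt_step: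
  assumes "\<delta> > 0"
  obtains \<kappa> and p p' :: "real \<Rightarrow> real" where "smooth_on UNIV p" "\<kappa> > 0" "\<kappa> < 1"
    "\<And>x. (p has_real_derivative p' x) (at x)" "\<And>x. 0 \<le> p x * p' x" "\<And>x. p x * p' x \<le> (1 + \<delta>) / 2"
    "\<And>x. x \<le> \<kappa> \<Longrightarrow> p x = 0" "\<And>x. x \<ge> 1 - \<kappa> \<Longrightarrow> p x = 1" "\<And>x. 0 \<le> p x" "\<And>x. p x \<le> 1"
proof -
  \<comment> \<open>These constants serve the closing estimate
    \<open>1 + \<sigma> \<le> (1 + 20 * \<sigma>) * (1 - 4 * \<sigma>)\<close>, in which
    \<open>20 * \<sigma>\<close> is at most \<open>\<delta>\<close>.\<close>
  define \<sigma> where "\<sigma> = min (1/10) (\<delta> / 20)"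
  have \<sigma>: "0 < \<sigma>" "\<sigma> \<le> 1/10" "20 * \<sigma> \<le> \<delta>" using assms by (auto simp: \<sigma>_def)
  obtain T T' where T: "smooth_on UNIV T"
    "\<And>x. (T has_real_derivative T' x) (at x)" "\<And>x. 0 \<le> T' x" "\<And>x. T' x \<le> 1 + \<sigma>"
    "\<And>x. x \<le> 0 \<Longrightarrow> T x = 0" "\<And>x. x \<ge> 1 \<Longrightarrow> T x = 1" "\<And>x. 0 \<le> T x" "\<And>x. T x \<le> 1"
    using tight_smooth_step[OF \<sigma>(1)] by metis
  define N where "N = sqrt (1 + \<sigma>\<^sup>2) - \<sigma>"
  have N: "N \<ge> 1 - \<sigma>" unfolding N_def by simp
  define s where "s x = (x - \<sigma>) / (1 - 2 * \<sigma>)" for x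
  define p where "p x = (sqrt (T (s x) + \<sigma>\<^sup>2) - \<sigma>) / N" for x
  define p' where "p' x = T' (s x) / (1 - 2 * \<sigma>) / (2 * sqrt (T (s x) + \<sigma>\<^sup>2)) / N" for x
  have pos: "T x + \<sigma>\<^sup>2 > 0" for x using T(7)[of x] \<sigma> by (simp add: add_nonneg_pos)
  have ge: "sqrt (T x + \<sigma>\<^sup>2) \<ge> \<sigma>" for x using T(7)[of x] by (simp add: real_le_rsqrt)
  have le: "sqrt (T x + \<sigma>\<^sup>2) \<le> sqrt (1 + \<sigma>\<^sup>2)" for x using T(8)[of x] by simp
  show ?thesis
  proof (rule that[of p \<sigma> p'])
    show "smooth_on UNIV p" unfolding p_def[abs_def] s_def
      using pos by (intro smooth_intros smooth_on_compose[OF T(1)]) (use \<sigma> N in auto)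
    show "\<sigma> > 0" "\<sigma> < 1" using \<sigma> by auto
    show "(p has_real_derivative p' x) (at x)" for x
    proof -
      have "(s has_real_derivative 1 / (1 - 2 * \<sigma>)) (at x)"
        unfolding s_def[abs_def] using \<sigma> by (auto intro!: derivative_eq_intros)
      then have "((\<lambda>x. T (s x)) has_real_derivative T' (s x) * (1 / (1 - 2 * \<sigma>))) (at x)"
        by (rule DERIV_chain2[OF T(2)])
      then have "((\<lambda>x. sqrt (T (s x) + \<sigma>\<^sup>2)) has_real_derivative
          inverse (sqrt (T (s x) + \<sigma>\<^sup>2)) / 2 * (T' (s x) * (1 / (1 - 2 * \<sigma>)) + 0)) (at x)"
        using pos[of "s x"]
        by (intro DERIV_chain2[OF DERIV_real_sqrt] DERIV_add DERIV_const)
      then have "((\<lambda>x. (sqrt (T (s x) + \<sigma>\<^sup>2) - \<sigma>) / N) has_real_derivative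
          (inverse (sqrt (T (s x) + \<sigma>\<^sup>2)) / 2 * (T' (s x) * (1 / (1 - 2 * \<sigma>)) + 0) - 0) / N) (at x)"
        by (intro DERIV_cdivide DERIV_diff DERIV_const)
      then show ?thesis unfolding p_def[abs_def] p'_def
        by (simp only: divide_inverse mult_ac inverse_mult_distrib add_0_right diff_0_right mult_1_left mult_1_right)
    qed
    show "0 \<le> p x * p' x" for x
      using ge[of "s x"] T(3)[of "s x"] \<sigma> N pos[of "s x", THEN less_imp_le]
      by (auto simp: p_def p'_def intro!: mult_nonneg_nonneg divide_nonneg_nonneg)
    show "p x * p' x \<le> (1 + \<delta>) / 2" for x
    proof -
      let ?q = "sqrt (T (s x) + \<sigma>\<^sup>2)"
      have q: "?q > 0" using pos by simp
      \<comment> \<open>The root in the denominator of \<open>p'\<close> cancels against the one in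
        \<open>p\<close> up to the factor \<open>(?q - \<sigma>) / ?q\<close>, which lies in
        \<open>[0, 1]\<close>.\<close>
      have "p x * p' x = (T' (s x) * ((?q - \<sigma>) / ?q)) / (2 * (1 - 2 * \<sigma>) * N\<^sup>2)"
        by (simp only: p_def p'_def power2_eq_square divide_inverse mult_ac inverse_mult_distrib)
      also have "\<dots> \<le> ((1 + \<sigma>) * 1) / (2 * (1 - 2 * \<sigma>) * (1 - \<sigma>)\<^sup>2)"
      proof (rule frac_le)
        have r: "0 \<le> (?q - \<sigma>) / ?q" "(?q - \<sigma>) / ?q \<le> 1"
          using q ge[of "s x"] \<sigma> by (simp_all add: divide_le_eq_1)
        show "T' (s x) * ((?q - \<sigma>) / ?q) \<le> (1 + \<sigma>) * 1"
          using r T(3,4)[of "s x"] by (intro mult_mono) auto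
        show "0 < 2 * (1 - 2 * \<sigma>) * (1 - \<sigma>)\<^sup>2"
          using \<sigma> by (intro mult_pos_pos) auto
        show "2 * (1 - 2 * \<sigma>) * (1 - \<sigma>)\<^sup>2 \<le> 2 * (1 - 2 * \<sigma>) * N\<^sup>2"
          using \<sigma> N by (intro mult_left_mono power_mono) auto
      qed (use \<sigma> in simp)
      also have "\<dots> \<le> (1 + \<delta>) / 2"
      proof -
        have "(1 - 2 * \<sigma>) * (1 - \<sigma>)\<^sup>2 \<ge> (1 - 2 * \<sigma>) * (1 - 2 * \<sigma>)"
          using \<sigma> by (intro mult_left_mono) (auto simp: power2_eq_square algebra_simps)
        moreover have "(1 - 2 * \<sigma>) * (1 - 2 * \<sigma>) \<ge> 1 - 4 * \<sigma>"
          by (auto simp: algebra_simps)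
        ultimately have d: "(1 - 2 * \<sigma>) * (1 - \<sigma>)\<^sup>2 \<ge> 1 - 4 * \<sigma>" by linarith
        have "1 + \<sigma> \<le> (1 + 20 * \<sigma>) * (1 - 4 * \<sigma>)"
        proof -
          have "\<sigma> * \<sigma> \<le> \<sigma> * (1/10)" using \<sigma> by (intro mult_left_mono) auto
          then show ?thesis using \<sigma> by (simp add: algebra_simps)
        qed
        also have "\<dots> \<le> (1 + \<delta>) * ((1 - 2 * \<sigma>) * (1 - \<sigma>)\<^sup>2)"
          using \<sigma> d by (intro mult_mono) auto
        finally have "1 + \<sigma> \<le> (1 + \<delta>) * ((1 - 2 * \<sigma>) * (1 - \<sigma>)\<^sup>2)" .
        moreover have "(1 - 2 * \<sigma>) * (1 - \<sigma>)\<^sup>2 > 0" using d \<sigma> by linarith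
        ultimately show ?thesis by (simp add: field_simps)
      qed
      finally show ?thesis .
    qed
    show "p x = 0" if "x \<le> \<sigma>" for x
    proof -
      have "s x \<le> 0" using that \<sigma> by (simp add: s_def divide_le_0_iff)
      then show ?thesis using \<sigma> by (simp add: p_def T(5))
    qed
    show "p x = 1" if "x \<ge> 1 - \<sigma>" for x
    proof -
      have "s x \<ge> 1" using that \<sigma> by (simp add: s_def)
      then show ?thesis using \<sigma> N by (simp add: p_def T(6) N_def[symmetric])
    qed
    show "0 \<le> p x" for x using ge[of "s x"] N \<sigma> by (simp add: p_def)
    show "p x \<le> 1" for x using le[of "s x"] N \<sigma> by (simp add: p_def divide_le_eq, simp add: N_def)
  qed
qed

text \<open>\<open>Arg\<close> jumps by \<open>2 * pi\<close> across the negative axis; the jump is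
  invisible when \<open>w\<close> takes one value near both ends of \<open>[-1/2, 1/2]\<close>. The
  neighbourhood is described through \<open>Ln (- u)\<close>, which is continuous there.\<close>

lemma Arg_compose_locally_const:
  assumes "\<kappa> > 0" and c: "\<forall>y\<in>{-1/2..-1/2+\<kappa>} \<union> {1/2-\<kappa>..1/2}. w y = c"
    and u: "u \<noteq> 0" "u \<in> \<real>\<^sub>\<le>\<^sub>0"
  shows "\<exists>V. open V \<and> u \<in> V \<and> (\<forall>v\<in>V. w (Arg v / (2 * pi)) = c)"
proof (intro exI conjI ballI)
  define V where "V = {u. Re u < 0 \<and> \<bar>Im (Ln (- u))\<bar> < 2 * pi * \<kappa>}"
  have eq: "V = {u. Re u < 0} \<inter> (\<lambda>u. \<bar>Im (Ln (- u))\<bar>) -` {..<2 * pi * \<kappa>}"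
    by (auto simp: V_def)
  have "continuous_on {u. Re u < 0} (\<lambda>u. \<bar>Im (Ln (- u))\<bar>)"
    by (intro continuous_intros) (auto simp: complex_nonpos_Reals_iff)
  then show "open V" unfolding eq
    by (intro continuous_open_preimage open_halfspace_Re_lt) auto
  have "Re u < 0" "Im u = 0" using u by (auto simp: complex_nonpos_Reals_iff complex_eq_iff)
  then show "u \<in> V"
    using \<open>\<kappa> > 0\<close> Im_Ln_eq_0[of "- u"] u by (auto simp: V_def)
  fix v assume that: "v \<in> V"
  show "w (Arg v / (2 * pi)) = c"
  proof (rule c[rule_format])
    have v: "v \<noteq> 0" "- v \<noteq> 0" using that by (auto simp: V_def)
    have a: "\<bar>Arg (- v)\<bar> < 2 * pi * \<kappa>" using that v by (auto simp: V_def Arg_eq_Im_Ln)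
    have "Arg v = (if Arg (- v) \<le> 0 then Arg (- v) + pi else Arg (- v) - pi)"
      using Arg_minus[OF v(2)] by simp
    then consider "Arg (- v) \<le> 0" "Arg v = Arg (- v) + pi" | "Arg (- v) \<ge> 0" "Arg v = Arg (- v) - pi"
      by (auto split: if_splits)
    then show "Arg v / (2 * pi) \<in> {-1/2..-1/2+\<kappa>} \<union> {1/2-\<kappa>..1/2}"
      using a by cases (auto simp: field_simps)
  qed
qed

lemma smooth_on_Arg_compose:
  assumes w: "smooth_on UNIV w" and "\<kappa> > 0"
    and c: "\<forall>y\<in>{-1/2..-1/2+\<kappa>} \<union> {1/2-\<kappa>..1/2}. w y = c"
  shows "smooth_on (- {0}) (\<lambda>u. w (Arg u / (2 * pi)))"
proof (rule smooth_on_local)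
  fix u :: complex assume u: "u \<in> - {0}"
  show "\<exists>T. open T \<and> u \<in> T \<and> smooth_on T (\<lambda>u. w (Arg u / (2 * pi)))"
  proof (cases "u \<in> \<real>\<^sub>\<le>\<^sub>0")
    case False
    have "smooth_on (- \<real>\<^sub>\<le>\<^sub>0) (\<lambda>u. w (Im (Ln u) / (2 * pi)))"
      by (intro smooth_on_compose[OF w] smooth_intros) auto
    then have "smooth_on (- \<real>\<^sub>\<le>\<^sub>0) (\<lambda>u. w (Arg u / (2 * pi)))"
      by (rule smooth_on_cong[rotated 2]) (auto, metis Arg_eq_Im_Ln nonpos_Reals_zero_I)
    then show ?thesis using False by (intro exI[of _ "- \<real>\<^sub>\<le>\<^sub>0"]) auto
  next
    case True
    obtain V where V: "open V" "u \<in> V" "\<And>v. v \<in> V \<Longrightarrow> w (Arg v / (2 * pi)) = c"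
      using Arg_compose_locally_const[OF assms(2) c _ True] u by auto
    have "smooth_on V (\<lambda>u. w (Arg u / (2 * pi)))"
      by (rule smooth_on_cong[OF V(1) _ smooth_on_const[OF V(1)]]) (simp add: V(3))
    then show ?thesis using V by blast
  qed
qed

text \<open>\<open>Im (v / u)\<close> is the differential of the argument, independent of any
  branch. On the negative axis the composite is locally constant, and \<open>w' (1/2) = 0\<close>
  makes the formula agree.\<close>

lemma has_derivative_Arg_compose:
  assumes w: "\<And>y. (w has_real_derivative w' y) (at y)" and "\<kappa> > 0"
    and c: "\<forall>y\<in>{-1/2..-1/2+\<kappa>} \<union> {1/2-\<kappa>..1/2}. w y = c"
    and w0: "w' (1/2) = 0" and "u \<noteq> 0"
  shows "((\<lambda>u. w (Arg u / (2 * pi))) has_derivative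
    (\<lambda>v. w' (Arg u / (2 * pi)) / (2 * pi) * Im (v / u))) (at u)"
proof (cases "u \<in> \<real>\<^sub>\<le>\<^sub>0")
  case False
  have "(Ln has_derivative (\<lambda>v. inverse u * v)) (at u)"
    using has_field_derivative_Ln[OF False] by (simp add: has_field_derivative_def)
  then have "((\<lambda>u. Im (Ln u) / (2 * pi)) has_derivative (\<lambda>v. Im (inverse u * v) / (2 * pi))) (at u)"
    by (intro bounded_linear.has_derivative[OF bounded_linear_divide] has_derivative_Im)
  then have "((\<lambda>u. w (Im (Ln u) / (2 * pi))) has_derivative
      (\<lambda>v. w' (Im (Ln u) / (2 * pi)) * (Im (inverse u * v) / (2 * pi)))) (at u)"
    using has_derivative_compose w[of "Im (Ln u) / (2 * pi)", unfolded has_field_derivative_def] by blast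
  then have "((\<lambda>u. w (Arg u / (2 * pi))) has_derivative
      (\<lambda>v. w' (Im (Ln u) / (2 * pi)) * (Im (inverse u * v) / (2 * pi)))) (at u)"
    by (rule has_derivative_transform_within_open[of _ _ _ _ "- \<real>\<^sub>\<le>\<^sub>0"])
      (use False in \<open>auto, metis Arg_eq_Im_Ln nonpos_Reals_zero_I\<close>)
  moreover have "Im (inverse u * v) = Im (v / u)" for v by (simp only: divide_inverse mult.commute)
  ultimately show ?thesis
    using \<open>u \<noteq> 0\<close> by (simp add: Arg_eq_Im_Ln)
next
  case True
  then have A: "Arg u = pi"
    using \<open>u \<noteq> 0\<close> by (auto simp: Arg_eq_pi complex_nonpos_Reals_iff complex_eq_iff)
  obtain V where V: "open V" "u \<in> V" "\<And>v. v \<in> V \<Longrightarrow> w (Arg v / (2 * pi)) = c"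
    using Arg_compose_locally_const[OF assms(2) c \<open>u \<noteq> 0\<close> True] by auto
  have "((\<lambda>u. w (Arg u / (2 * pi))) has_derivative (\<lambda>v. 0)) (at u)"
    by (rule has_derivative_transform_within_open[OF has_derivative_const V(1,2)]) (simp add: V(3))
  then show ?thesis using A w0 by simp
qed

text \<open>The pair \<open>(P1, P2)\<close> runs clockwise around the boundary of the square \<open>[-1/2, 1/2]\<^sup>2\<close>
  at almost constant speed; only one coordinate moves at a time, which keeps the areal speed
  under control.\<close>

lemma square_loop:
  assumes "\<delta> > 0"
  obtains \<kappa> and P1 P2 P1' P2' :: "complex \<Rightarrow> real" where "\<kappa> > 0"
    "smooth_on (- {0}) P1" "smooth_on (- {0}) P2"
    "\<And>u. u \<noteq> 0 \<Longrightarrow> (P1 has_derivative (\<lambda>v. P1' u * Im (v / u))) (at u)"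
    "\<And>u. u \<noteq> 0 \<Longrightarrow> (P2 has_derivative (\<lambda>v. P2' u * Im (v / u))) (at u)"
    "\<And>u. u \<noteq> 0 \<Longrightarrow> P1' u * P2 u - P1 u * P2' u \<in> {0..(1 + \<delta>) / pi}"
    "\<And>u x. u \<noteq> 0 \<Longrightarrow> \<bar>Arg (u * cis (- 2 * pi * x))\<bar> \<le> 2 * pi * \<kappa> \<Longrightarrow> on_arc 0 (1/4) x \<Longrightarrow> P1 u = -1/2"
    "\<And>u x. u \<noteq> 0 \<Longrightarrow> \<bar>Arg (u * cis (- 2 * pi * x))\<bar> \<le> 2 * pi * \<kappa> \<Longrightarrow> on_arc (1/2) (3/4) x \<Longrightarrow> P1 u = 1/2"
    "\<And>u x. u \<noteq> 0 \<Longrightarrow> \<bar>Arg (u * cis (- 2 * pi * x))\<bar> \<le> 2 * pi * \<kappa> \<Longrightarrow> on_arc (3/4) 1 x \<Longrightarrow> P2 u = -1/2"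
    "\<And>u x. u \<noteq> 0 \<Longrightarrow> \<bar>Arg (u * cis (- 2 * pi * x))\<bar> \<le> 2 * pi * \<kappa> \<Longrightarrow> on_arc (1/4) (1/2) x \<Longrightarrow> P2 u = 1/2"
proof -
  \<comment> \<open>Each side of the square is traversed in the middle of a quarter turn, leaving a
    margin \<open>\<kappa>\<close> at either end; the margin absorbs an error
    \<open>2 * pi * \<kappa>\<close> in the argument. The second bound on \<open>\<kappa>\<close>
    keeps the speed, about \<open>1 / (1/4 - 2 * \<kappa>)\<close>, below
    \<open>4 * (1 + \<delta>)\<close>.\<close>
  define \<kappa> where "\<kappa> = min (1/16) (\<delta> / (16 * (1 + \<delta>)))"
  have \<kappa>: "0 < \<kappa>" "\<kappa> \<le> 1/16" "\<kappa> \<le> \<delta> / (16 * (1 + \<delta>))" using assms by (auto simp: \<kappa>_def)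
  have k2: "1 / (1/4 - 2 * \<kappa>) * (1 + \<delta> / 4) \<le> 4 * (1 + \<delta>)"
  proof -
    have "16 * (\<kappa> * (1 + \<delta>)) \<le> \<delta>" using \<kappa> assms by (simp add: field_simps)
    then have "1 + \<delta> / 4 \<le> 4 * (1 + \<delta>) * (1/4 - 2 * \<kappa>)" using assms by (simp add: algebra_simps)
    then show ?thesis using \<kappa> by (simp add: field_simps)
  qed
  obtain T T' where T: "smooth_on UNIV T"
    "\<And>x. (T has_real_derivative T' x) (at x)" "\<And>x. 0 \<le> T' x" "\<And>x. T' x \<le> 1 + \<delta> / 4"
    "\<And>x. x \<le> 0 \<Longrightarrow> T x = 0" "\<And>x. x \<ge> 1 \<Longrightarrow> T x = 1" "\<And>x. 0 \<le> T x" "\<And>x. T x \<le> 1"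
    using tight_smooth_step[of "\<delta> / 4"] assms by (metis zero_less_divide_iff zero_less_numeral)
  define L where "L = 1/4 - 2 * \<kappa>"
  have L: "L > 0" using \<kappa> by (simp add: L_def)
  define U where "U y = T ((y - \<kappa>) / L)" for y
  define U' where "U' y = T' ((y - \<kappa>) / L) / L" for y
  have sU: "smooth_on UNIV U" unfolding U_def[abs_def]
    using L by (intro smooth_on_compose[OF T(1)] smooth_intros) auto
  have dU: "(U has_real_derivative U' y) (at y)" for y
  proof -
    have "((\<lambda>y. (y - \<kappa>) / L) has_real_derivative 1 / L) (at y)"
      using L by (auto intro!: derivative_eq_intros)
    from DERIV_chain2[OF T(2) this] show ?thesis by (simp add: U_def[abs_def] U'_def)
  qed
  have U0: "U y = 0" if "y \<le> \<kappa>" for y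
    using that L by (simp add: U_def T(5) divide_le_0_iff)
  have U1: "U y = 1" if "y \<ge> 1/4 - \<kappa>" for y
    using that L by (simp add: U_def T(6) L_def)
  have U'0: "U' y \<ge> 0" for y using T(3) L by (simp add: U'_def)
  have U'1: "U' y \<le> 4 * (1 + \<delta>)" for y
  proof -
    have "U' y \<le> 1 / L * (1 + \<delta> / 4)"
      using T(4)[of "(y - \<kappa>) / L"] L by (simp add: U'_def divide_right_mono)
    then show ?thesis using k2 L_def by simp
  qed
  have loc: "U' y = 0" if "\<forall>y'\<in>{y-\<kappa><..<y+\<kappa>}. U y' = c" for y c
  proof -
    have "(U has_real_derivative 0) (at y)"
      by (rule has_field_derivative_transform_within_open[of "\<lambda>x. c" _ _ "{y-\<kappa><..<y+\<kappa>}"])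
        (use that \<kappa> in auto)
    then show ?thesis using dU DERIV_unique by blast
  qed
  have U'z: "U' y = 0" if "y \<le> 0" for y using that \<kappa> by (intro loc[of _ 0] ballI U0) auto
  have U'o: "U' y = 0" if "y \<ge> 1/4" for y using that \<kappa> by (intro loc[of _ 1] ballI U1) auto
  \<comment> \<open>On each quarter of \<open>[-1/2, 1/2]\<close> one coordinate moves between
    \<open>-1/2\<close> and \<open>1/2\<close> while the other rests. The parameter is the argument
    divided by \<open>2 * pi\<close>, so the third and fourth arc appear as
    \<open>[-1/2, -1/4]\<close> and \<open>[-1/4, 0]\<close>.\<close>
  define w1 where "w1 y = -1/2 + U (y - 1/4) + U (- y)" for y
  define w2 where "w2 y = -1/2 + U y + U (- y - 1/4)" for y
  define w1' where "w1' y = U' (y - 1/4) - U' (- y)" for y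
  define w2' where "w2' y = U' y - U' (- y - 1/4)" for y
  have sw: "smooth_on UNIV w1" "smooth_on UNIV w2"
    unfolding w1_def[abs_def] w2_def[abs_def]
    by (intro smooth_intros smooth_on_compose[OF sU]; simp)+
  have dw: "(w1 has_real_derivative w1' y) (at y)" "(w2 has_real_derivative w2' y) (at y)" for y
    unfolding w1_def[abs_def] w2_def[abs_def] w1'_def w2'_def
    by (auto intro!: derivative_eq_intros DERIV_chain2[OF dU])
  have c1: "\<forall>y\<in>{-1/2..-1/2+\<kappa>} \<union> {1/2-\<kappa>..1/2}. w1 y = 1/2"
    using \<kappa> by (auto simp: w1_def U0 U1)
  have c2: "\<forall>y\<in>{-1/2..-1/2+\<kappa>} \<union> {1/2-\<kappa>..1/2}. w2 y = 1/2"
    using \<kappa> by (auto simp: w2_def U0 U1)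
  have h: "w1' (1/2) = 0" "w2' (1/2) = 0" by (simp_all add: w1'_def w2'_def U'z U'o)
  have cross: "w1' y * w2 y - w1 y * w2' y \<in> {0..2 * (1 + \<delta>)}" if "\<bar>y\<bar> \<le> 1/2" for y
  proof -
    consider "-1/2 \<le> y" "y \<le> -1/4" | "-1/4 \<le> y" "y \<le> 0" | "0 \<le> y" "y \<le> 1/4"
      | "1/4 \<le> y" "y \<le> 1/2"
    proof -
      have "-1/2 \<le> y" "y \<le> 1/2" using \<open>\<bar>y\<bar> \<le> 1/2\<close> by linarith+
      then show thesis
        using that linear[of y "-1/4"] linear[of y 0] linear[of y "1/4"] by blast
    qed
    then show ?thesis
      using U'0[of "y - 1/4"] U'1[of "y - 1/4"] U'0[of "-y"] U'1[of "-y"] U'0[of y] U'1[of y]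
        U'0[of "- y - 1/4"] U'1[of "- y - 1/4"] \<kappa>
      by cases (auto simp: w1_def w2_def w1'_def w2'_def U0 U1 U'z U'o)
  qed
  define P1 where "P1 u = w1 (Arg u / (2 * pi))" for u
  define P2 where "P2 u = w2 (Arg u / (2 * pi))" for u
  have arc: "\<exists>y k::int. Arg u = 2 * pi * y \<and> \<bar>y\<bar> \<le> 1/2 \<and> lo - \<kappa> \<le> y + k \<and> y + k \<le> hi + \<kappa>"
    if u: "u \<noteq> 0" and A: "\<bar>Arg (u * cis (- 2 * pi * x))\<bar> \<le> 2 * pi * \<kappa>" and x: "on_arc lo hi x" for u x lo hi
  proof -
    define \<alpha> where "\<alpha> = Arg (u * cis (- 2 * pi * x))"
    have "u * cis (- 2 * pi * x) = cmod u * cis \<alpha>"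
      using u rcis_cmod_Arg[of "u * cis (- 2 * pi * x)"] by (simp add: \<alpha>_def norm_mult rcis_def)
    then have "u * cis (- 2 * pi * x) * cis (2 * pi * x) = cmod u * cis \<alpha> * cis (2 * pi * x)" by simp
    then have "u = cmod u * cis (\<alpha> + 2 * pi * x)" by (simp add: mult.assoc cis_mult)
    moreover have "u = cmod u * cis (Arg u)" using rcis_cmod_Arg[of u] by (simp add: rcis_def)
    ultimately have "cis (Arg u) = cis (\<alpha> + 2 * pi * x)"
      using u by (metis mult_cancel_left norm_eq_zero of_real_eq_0_iff)
    then have "cos (Arg u) = cos (\<alpha> + 2 * pi * x)" "sin (Arg u) = sin (\<alpha> + 2 * pi * x)"
      by (metis cis.sel(1), metis cis.sel(2))
    then obtain j :: int where j: "Arg u = \<alpha> + 2 * pi * x + 2 * pi * j"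
      using sin_cos_eq_iff[of "Arg u" "\<alpha> + 2 * pi * x"] by auto
    obtain k :: int where k: "lo \<le> x + k" "x + k \<le> hi" using x by (auto simp: on_arc_def)
    define y where "y = Arg u / (2 * pi)"
    have "Arg u = 2 * pi * y" by (simp add: y_def)
    moreover have "\<bar>y\<bar> \<le> 1/2" using Arg_bounded[of u] by (auto simp: y_def abs_le_iff field_simps)
    moreover have "y = \<alpha> / (2 * pi) + x + j" unfolding y_def j by (simp add: field_simps)
    moreover have "\<bar>\<alpha> / (2 * pi)\<bar> \<le> \<kappa>" using A unfolding \<alpha>_def[symmetric] by (simp add: field_simps)
    moreover have "lo - \<kappa> \<le> y + of_int (k - j)" "y + of_int (k - j) \<le> hi + \<kappa>"
      using calculation k unfolding of_int_diff abs_le_iff by linarith+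
    ultimately show ?thesis by blast
  qed
  have small: "k = -1 \<or> k = 0 \<or> k = 1" if "\<bar>y\<bar> \<le> 1/2" "0 - \<kappa> \<le> y + k" "y + k \<le> 1 + \<kappa>" for y :: real and k :: int
  proof -
    have "-1 < real_of_int k" "real_of_int k < 2" using that \<kappa> by linarith+
    then show ?thesis by auto
  qed
  show ?thesis
  proof (rule that[of \<kappa> P1 P2 "\<lambda>u. w1' (Arg u / (2 * pi)) / (2 * pi)" "\<lambda>u. w2' (Arg u / (2 * pi)) / (2 * pi)"])
    show "\<kappa> > 0" by fact
    show "smooth_on (- {0}) P1" "smooth_on (- {0}) P2"
      unfolding P1_def[abs_def] P2_def[abs_def]
      using smooth_on_Arg_compose[OF sw(1) \<kappa>(1) c1] smooth_on_Arg_compose[OF sw(2) \<kappa>(1) c2] by auto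
    show "(P1 has_derivative (\<lambda>v. w1' (Arg u / (2 * pi)) / (2 * pi) * Im (v / u))) (at u)"
      "(P2 has_derivative (\<lambda>v. w2' (Arg u / (2 * pi)) / (2 * pi) * Im (v / u))) (at u)" if "u \<noteq> 0" for u
      unfolding P1_def[abs_def] P2_def[abs_def]
      using has_derivative_Arg_compose[OF dw(1) \<kappa>(1) c1 h(1) that]
        has_derivative_Arg_compose[OF dw(2) \<kappa>(1) c2 h(2) that] by auto
    show "w1' (Arg u / (2 * pi)) / (2 * pi) * P2 u - P1 u * (w2' (Arg u / (2 * pi)) / (2 * pi)) \<in> {0..(1 + \<delta>) / pi}" if "u \<noteq> 0" for u
    proof -
      let ?y = "Arg u / (2 * pi)"
      have "\<bar>?y\<bar> \<le> 1/2" using Arg_bounded[of u] by (auto simp: abs_le_iff field_simps)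
      note c = cross[OF this, unfolded atLeastAtMost_iff]
      have "(w1' ?y * w2 ?y - w1 ?y * w2' ?y) / (2 * pi) \<le> 2 * (1 + \<delta>) / (2 * pi)"
        using c by (intro divide_right_mono) auto
      moreover have "(w1' ?y * w2 ?y - w1 ?y * w2' ?y) / (2 * pi) \<ge> 0" using c by simp
      moreover have "2 * (1 + \<delta>) / (2 * pi) = (1 + \<delta>) / pi" by (rule mult_divide_mult_cancel_left) simp
      ultimately have "(w1' ?y * w2 ?y - w1 ?y * w2' ?y) / (2 * pi) \<in> {0..(1 + \<delta>) / pi}"
        unfolding atLeastAtMost_iff by metis
      then show ?thesis by (simp add: P1_def P2_def diff_divide_distrib mult.commute)
    qed
    fix u :: complex and x assume u: "u \<noteq> 0" and A: "\<bar>Arg (u * cis (- 2 * pi * x))\<bar> \<le> 2 * pi * \<kappa>"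
    show "P1 u = -1/2" if on: "on_arc 0 (1/4) x"
    proof -
      obtain y k where y: "Arg u = 2 * pi * y" "\<bar>y\<bar> \<le> 1/2" "0 - \<kappa> \<le> y + of_int k" "y + of_int k \<le> 1/4 + \<kappa>"
        using arc[OF u A on] by blast
      have "k = 0" using small[OF y(2,3)] y \<kappa> by auto
      then show ?thesis using y \<kappa> by (auto simp: P1_def w1_def U0 U1)
    qed
    show "P1 u = 1/2" if on: "on_arc (1/2) (3/4) x"
    proof -
      obtain y k where y: "Arg u = 2 * pi * y" "\<bar>y\<bar> \<le> 1/2" "1/2 - \<kappa> \<le> y + of_int k" "y + of_int k \<le> 3/4 + \<kappa>"
        using arc[OF u A on] by blast
      have "k = 0 \<or> k = 1" using small[OF y(2)] y \<kappa> by auto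
      then show ?thesis using y \<kappa> by (auto simp: P1_def w1_def U0 U1)
    qed
    show "P2 u = -1/2" if on: "on_arc (3/4) 1 x"
    proof -
      obtain y k where y: "Arg u = 2 * pi * y" "\<bar>y\<bar> \<le> 1/2" "3/4 - \<kappa> \<le> y + of_int k" "y + of_int k \<le> 1 + \<kappa>"
        using arc[OF u A on] by blast
      have "k = 1" using small[OF y(2)] y \<kappa> by auto
      then show ?thesis using y \<kappa> by (auto simp: P2_def w2_def U0 U1)
    qed
    show "P2 u = 1/2" if on: "on_arc (1/4) (1/2) x"
    proof -
      obtain y k where y: "Arg u = 2 * pi * y" "\<bar>y\<bar> \<le> 1/2" "1/4 - \<kappa> \<le> y + of_int k" "y + of_int k \<le> 1/2 + \<kappa>"
        using arc[OF u A on] by blast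
      have "k = 0 \<or> k = 1" using small[OF y(2)] y \<kappa> by auto
      then show ?thesis using y \<kappa> by (auto simp: P2_def w2_def U0 U1)
    qed
  qed
qed

section \<open>Winding numbers and enclosed area\<close>

lemma measurable_Complex [measurable]:
  "(\<lambda>p. Complex (fst p) (snd p)) \<in> borel_measurable (borel :: (real \<times> real) measure)"
proof -
  have eq: "(\<lambda>p. Complex (fst p) (snd p)) = (\<lambda>p. complex_of_real (fst p) + \<i> * complex_of_real (snd p))"
    by (auto simp: complex_eq_iff)
  show ?thesis unfolding eq by (intro borel_measurable_continuous_onI continuous_intros)
qed

lemma distr_lborel_Complex:
  "distr (lborel :: (real \<times> real) measure) borel (\<lambda>p. Complex (fst p) (snd p)) = lborel"
proof (rule lborel_eqI[symmetric])
  fix l u :: complex assume lu: "\<And>b. b \<in> Basis \<Longrightarrow> l \<bullet> b \<le> u \<bullet> b"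
  have "(\<lambda>p. Complex (fst p) (snd p)) -` box l u = box (Re l, Im l) (Re u, Im u)"
    by (auto simp: box_def Basis_complex_def Basis_prod_def)
  then have "emeasure (distr lborel borel (\<lambda>p. Complex (fst p) (snd p))) (box l u) =
      emeasure lborel (box (Re l, Im l) (Re u, Im u))"
    by (subst emeasure_distr) auto
  also have "\<dots> = (\<Prod>b\<in>Basis. ((Re u, Im u) - (Re l, Im l)) \<bullet> b)"
    using lu[of 1] lu[of \<i>] by (intro emeasure_lborel_box) (auto simp: Basis_complex_def Basis_prod_def)
  also have "\<dots> = (\<Prod>b\<in>Basis. (u - l) \<bullet> b)"
    by (simp add: Basis_complex_def Basis_prod_def prod.union_disjoint prod.reindex inj_on_def complex_eq_iff mult.commute)
  finally show "emeasure (distr lborel borel (\<lambda>p. Complex (fst p) (snd p))) (box l u) = (\<Prod>b\<in>Basis. (u - l) \<bullet> b)" .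
qed simp

text \<open>The Cauchy kernel in the plane is dominated by a product of two such factors, one per
  coordinate, so its integrability reduces to that of \<open>\<bar>x\<bar> powr (-1/2)\<close> on
  the line. The value at \<open>0\<close> keeps the domination true when one coordinate difference
  vanishes.\<close>

definition inv_sqrt_kernel :: "real \<Rightarrow> ennreal" where
  "inv_sqrt_kernel x = (if x = 0 then \<infinity> else ennreal (\<bar>x\<bar> powr (-1/2)))"

lemma measurable_inv_sqrt_kernel [measurable]: "inv_sqrt_kernel \<in> borel_measurable borel"
  unfolding inv_sqrt_kernel_def[abs_def] by measurable

lemma nn_integral_inv_sqrt_kernel_finite:
  assumes "R > 0"
  shows "(\<integral>\<^sup>+x. indicator {-2*R..2*R} x * inv_sqrt_kernel x \<partial>lborel) < \<infinity>"
proof -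
  let ?f = "\<lambda>x. indicator {0..2*R} x * x powr (-1/2)"
  have "((\<lambda>x. x powr (-1/2)) has_integral ((2*R) powr (-1/2+1) / (-1/2+1))) {0..2*R}"
    by (rule has_integral_powr_from_0) (use assms in auto)
  then have "((\<lambda>x. if x \<in> {0..2*R} then x powr (-1/2) else 0) has_integral ((2*R) powr (-1/2+1) / (-1/2+1))) UNIV"
    by (simp only: has_integral_restrict_UNIV)
  then have "(?f has_integral ((2*R) powr (-1/2+1) / (-1/2+1))) UNIV"
    by (rule has_integral_cong[THEN iffD1, rotated]) (auto simp: indicator_def)
  then have fin: "(\<integral>\<^sup>+x. ennreal (?f x) \<partial>lborel) = ennreal ((2*R) powr (-1/2+1) / (-1/2+1))"
    by (intro nn_integral_has_integral_lborel) auto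
  have refl: "(\<integral>\<^sup>+x. ennreal (?f (- x)) \<partial>lborel) = (\<integral>\<^sup>+x. ennreal (?f x) \<partial>lborel)"
    using nn_integral_real_affine[of "\<lambda>x. ennreal (?f x)" "-1" 0] by simp
  have "AE x in lborel. indicator {-2*R..2*R} x * inv_sqrt_kernel x \<le> ennreal (?f x) + ennreal (?f (- x))"
    using AE_lborel_singleton[of 0]
    by eventually_elim (auto simp: inv_sqrt_kernel_def indicator_def)
  then have "(\<integral>\<^sup>+x. indicator {-2*R..2*R} x * inv_sqrt_kernel x \<partial>lborel)
      \<le> (\<integral>\<^sup>+x. ennreal (?f x) + ennreal (?f (- x)) \<partial>lborel)"
    by (rule nn_integral_mono_AE)
  also have "\<dots> = (\<integral>\<^sup>+x. ennreal (?f x) \<partial>lborel) + (\<integral>\<^sup>+x. ennreal (?f (- x)) \<partial>lborel)"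
    by (intro nn_integral_add) auto
  also have "\<dots> < \<infinity>" unfolding refl fin by simp
  finally show ?thesis .
qed

text \<open>Reflection and translation carry \<open>[-R, R]\<close> into \<open>[-2 R, 2 R]\<close>,
  which yields a bound independent of \<open>X\<close>.\<close>

lemma nn_integral_inv_sqrt_kernel_translate:
  assumes "\<bar>X\<bar> \<le> R"
  shows "(\<integral>\<^sup>+x. indicator {-R..R} x * inv_sqrt_kernel (X - x) \<partial>lborel)
    \<le> (\<integral>\<^sup>+x. indicator {-2*R..2*R} x * inv_sqrt_kernel x \<partial>lborel)"
proof -
  have "(\<integral>\<^sup>+x. indicator {-R..R} x * inv_sqrt_kernel (X - x) \<partial>lborel)
    = (\<integral>\<^sup>+x. indicator {-R..R} (X + (-1) * x) * inv_sqrt_kernel (X - (X + (-1) * x)) \<partial>lborel)"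
    using nn_integral_real_affine[of "\<lambda>x. indicator {-R..R} x * inv_sqrt_kernel (X - x)" "-1" X] by simp
  also have "\<dots> \<le> (\<integral>\<^sup>+x. indicator {-2*R..2*R} x * inv_sqrt_kernel x \<partial>lborel)"
    using assms by (intro nn_integral_mono mult_right_mono) (auto simp: indicator_def)
  finally show ?thesis .
qed

text \<open>\<open>a\<^sup>2 + b\<^sup>2 \<ge> a * b\<close> bounds the distance from below by a
  geometric mean of the coordinate differences.\<close>

lemma norm_inverse_le_inv_sqrt_kernel:
  "ennreal (norm (1 / (z - Complex x q))) \<le> inv_sqrt_kernel (Re z - x) * inv_sqrt_kernel (Im z - q)"
proof (cases "Re z = x \<or> Im z = q")
  case True
  then show ?thesis by (auto simp: inv_sqrt_kernel_def ennreal_top_mult ennreal_mult_top)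
next
  case False
  define a b where "a = \<bar>Re z - x\<bar>" and "b = \<bar>Im z - q\<bar>"
  have ab: "a > 0" "b > 0" using False by (auto simp: a_def b_def)
  have "(cmod (z - Complex x q))\<^sup>2 = a\<^sup>2 + b\<^sup>2"
    by (simp add: cmod_power2 a_def b_def)
  moreover have "a\<^sup>2 + b\<^sup>2 \<ge> a * b"
  proof -
    have "0 \<le> (a - b)\<^sup>2" by simp
    moreover have "0 \<le> a * b" using ab by simp
    ultimately show ?thesis by (simp add: power2_diff)
  qed
  ultimately have "sqrt (a * b) \<le> cmod (z - Complex x q)"
    by (intro real_le_lsqrt) auto
  moreover have "sqrt (a * b) > 0" using ab by simp
  ultimately have "1 / cmod (z - Complex x q) \<le> 1 / sqrt (a * b)"
    by (intro divide_left_mono mult_pos_pos) auto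
  also have "\<dots> = a powr (-1/2) * b powr (-1/2)"
    using ab by (simp add: powr_minus_divide powr_half_sqrt real_sqrt_mult minus_divide_left[symmetric])
  finally have "norm (1 / (z - Complex x q)) \<le> a powr (-1/2) * b powr (-1/2)"
    by (simp add: norm_divide)
  then have "ennreal (norm (1 / (z - Complex x q))) \<le> ennreal (a powr (-1/2)) * ennreal (b powr (-1/2))"
    by (simp add: ennreal_mult[symmetric] ennreal_leI)
  then show ?thesis using ab by (simp add: inv_sqrt_kernel_def a_def b_def)
qed

lemma nn_integral_inverse_le:
  assumes "\<bar>Re z\<bar> \<le> R" "\<bar>Im z\<bar> \<le> R"
  defines "C \<equiv> (\<integral>\<^sup>+x. indicator {-2*R..2*R} x * inv_sqrt_kernel x \<partial>lborel)"
  shows "(\<integral>\<^sup>+p. ennreal (norm (indicator ({-R..R} \<times> {-R..R}) p *\<^sub>R (1 / (z - Complex (fst p) (snd p))))) \<partial>lborel) \<le> C * C"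
proof -
  let ?g = "\<lambda>X x. indicator {-R..R} x * inv_sqrt_kernel (X - x)"
  have "(\<integral>\<^sup>+p. ennreal (norm (indicator ({-R..R} \<times> {-R..R}) p *\<^sub>R (1 / (z - Complex (fst p) (snd p))))) \<partial>lborel)
    \<le> (\<integral>\<^sup>+p. ?g (Re z) (fst p) * ?g (Im z) (snd p) \<partial>lborel)"
    using norm_inverse_le_inv_sqrt_kernel[of z]
    by (intro nn_integral_mono) (auto simp: indicator_def)
  also have "\<dots> = (\<integral>\<^sup>+p. ?g (Re z) (fst p) * ?g (Im z) (snd p) \<partial>(lborel \<Otimes>\<^sub>M lborel))"
    by (simp add: lborel_prod)
  also have "\<dots> = (\<integral>\<^sup>+x. \<integral>\<^sup>+q. ?g (Re z) x * ?g (Im z) q \<partial>lborel \<partial>lborel)"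
    by (subst lborel.nn_integral_fst[symmetric]) auto
  also have "\<dots> = (\<integral>\<^sup>+x. ?g (Re z) x \<partial>lborel) * (\<integral>\<^sup>+q. ?g (Im z) q \<partial>lborel)"
    by (simp add: nn_integral_cmult nn_integral_multc)
  also have "\<dots> \<le> C * C"
    unfolding C_def using assms(1,2) by (intro mult_mono nn_integral_inv_sqrt_kernel_translate) auto
  finally show ?thesis .
qed

text \<open>The Cauchy transform of the indicator function of the square
  \<open>[-R, R] \<times> [-R, R]\<close>.\<close>

definition box_potential :: "real \<Rightarrow> complex \<Rightarrow> complex" where
  "box_potential R z = (\<integral>p. indicator ({-R..R} \<times> {-R..R}) p *\<^sub>R (1 / (z - Complex (fst p) (snd p))) \<partial>lborel)"

definition Ln_primitive :: "complex \<Rightarrow> complex" where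
  "Ln_primitive w = w * Ln w - w"

lemma has_field_derivative_Ln_primitive:
  "w \<notin> \<real>\<^sub>\<le>\<^sub>0 \<Longrightarrow> (Ln_primitive has_field_derivative Ln w) (at w)"
  unfolding Ln_primitive_def[abs_def]
  by (auto intro!: derivative_eq_intros) (metis left_inverse nonpos_Reals_zero_I)

text \<open>The potential of the uniform charge on a box differs from \<open>- 2 pi i Im z\<close> by a function that
  is holomorphic in the strip: the logarithm obtained from the inner integral jumps by \<open>2 pi i\<close>
  when the horizontal line passes through \<open>z\<close>.\<close>

lemma box_potential_eq:
  assumes "\<bar>Re z\<bar> < R" "\<bar>Im z\<bar> < R"
  shows "box_potential R z = \<i> * (Ln_primitive (z + R - \<i> * R) - Ln_primitive (z + R + \<i> * R))
    + \<i> * (Ln_primitive (R - z + \<i> * R) - Ln_primitive (R - z - \<i> * R)) - 2 * pi * \<i> * Im z"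
proof -
  have "R > 0" using assms by linarith
  define f where "f x q = indicator ({-R..R} \<times> {-R..R}) (x, q) *\<^sub>R (1 / (z - Complex x q))" for x q
  have int: "integrable (lborel \<Otimes>\<^sub>M lborel) (case_prod f)"
  proof (rule integrableI_bounded)
    show "case_prod f \<in> borel_measurable (lborel \<Otimes>\<^sub>M lborel)"
    proof -
      have [measurable]: "{-R..R} \<times> {-R..R} \<in> sets (borel :: (real \<times> real) measure)"
        by (intro borel_closed closed_Times) auto
      have "(\<lambda>p. indicator ({-R..R} \<times> {-R..R}) p *\<^sub>R (1 / (z - Complex (fst p) (snd p))))
          \<in> borel_measurable (borel :: (real \<times> real) measure)" by measurable
      then show ?thesis unfolding f_def[abs_def] lborel_prod case_prod_beta prod.collapse by simp
    qed
    have "(\<integral>\<^sup>+ x. ennreal (norm (case_prod f x)) \<partial>(lborel \<Otimes>\<^sub>M lborel)) \<le>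
      (\<integral>\<^sup>+x. indicator {-2*R..2*R} x * inv_sqrt_kernel x \<partial>lborel) *
      (\<integral>\<^sup>+x. indicator {-2*R..2*R} x * inv_sqrt_kernel x \<partial>lborel)"
      using nn_integral_inverse_le[of z R] assms
      unfolding f_def case_prod_beta lborel_prod prod.collapse by auto
    also have "\<dots> < \<infinity>"
      using nn_integral_inv_sqrt_kernel_finite[OF \<open>R > 0\<close>] by (simp add: ennreal_mult_less_top)
    finally show "(\<integral>\<^sup>+ x. ennreal (norm (case_prod f x)) \<partial>(lborel \<Otimes>\<^sub>M lborel)) < \<infinity>" .
  qed
  have inner: "(\<integral>x. f x q \<partial>lborel) = indicator {-R..R} q *\<^sub>R
      (Ln (z + R - \<i> * q) - Ln (R - z + \<i> * q) - \<i> * pi * sgn (Im z - q))" if q: "q \<noteq> Im z" for q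
  proof -
    have nz: "z - Complex x q \<notin> \<real>\<^sub>\<le>\<^sub>0" for x using q by (auto simp: complex_nonpos_Reals_iff)
    have "(\<integral>x. indicator {-R..R} x *\<^sub>R (1 / (z - Complex x q)) \<partial>lborel)
      = (- Ln (z - Complex R q)) - (- Ln (z - Complex (-R) q))"
    proof (rule integral_FTC_atLeastAtMost)
      show "-R \<le> R" using \<open>R > 0\<close> by simp
      have c: "Complex x q = of_real x + \<i> * of_real q" for x by (simp add: complex_eq_iff)
      show "((\<lambda>x. - Ln (z - Complex x q)) has_vector_derivative 1 / (z - Complex x q)) (at x within {-R..R})" for x
      proof -
        have minv: "- (inverse a * (0 - (1 + 0))) = 1 / a" for a :: complex by (simp add: divide_inverse)
        have "((\<lambda>w. - Ln (z - (w + \<i> * q))) has_field_derivative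
            - (inverse (z - (of_real x + \<i> * q)) * (0 - (1 + 0)))) (at (of_real x))"
          using nz[of x] unfolding c
          by (intro DERIV_minus DERIV_chain2[OF has_field_derivative_Ln] DERIV_diff DERIV_add DERIV_const DERIV_ident) auto
        then have "((\<lambda>w. - Ln (z - (w + \<i> * q))) has_field_derivative 1 / (z - (of_real x + \<i> * q))) (at (of_real x))"
          unfolding minv .
        then show ?thesis unfolding c by (rule has_vector_derivative_at_within[OF has_vector_derivative_real_field])
      qed
      show "continuous_on {-R..R} (\<lambda>x. 1 / (z - Complex x q))"
        using nz unfolding c by (intro continuous_intros) (metis nonpos_Reals_zero_I)
    qed
    also have "z - Complex R q = - (R - z + \<i> * q)" by (simp add: complex_eq_iff)
    \<comment> \<open>Negating the argument changes the principal logarithm by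
      \<open>\<i> * pi\<close> with a sign that depends on the side of the horizontal line. This
      sign is the sole source of the term that is not holomorphic.\<close>
    also have "Ln (- (R - z + \<i> * q)) = Ln (R - z + \<i> * q) + \<i> * pi * sgn (Im z - q)"
    proof -
      have "R - z + \<i> * q \<noteq> 0" using q by (auto simp: complex_eq_iff)
      then show ?thesis using q assms by (subst Ln_minus) (auto simp: sgn_if)
    qed
    also have "z - Complex (-R) q = z + R - \<i> * q" by (simp add: complex_eq_iff)
    finally have *: "(\<integral>x. indicator {-R..R} x *\<^sub>R (1 / (z - Complex x q)) \<partial>lborel) =
      Ln (z + R - \<i> * q) - Ln (R - z + \<i> * q) - \<i> * pi * sgn (Im z - q)" by simp
    have "f x q = indicator {-R..R} q *\<^sub>R (indicator {-R..R} x *\<^sub>R (1 / (z - Complex x q)))" for x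
      by (auto simp: f_def indicator_def)
    then have "(\<integral>x. f x q \<partial>lborel) = (\<integral>x. indicator {-R..R} q *\<^sub>R (indicator {-R..R} x *\<^sub>R (1 / (z - Complex x q))) \<partial>lborel)"
      by (simp only:)
    then show ?thesis unfolding integral_scaleR_right * .
  qed
  have I1: "(\<integral>q. indicator {-R..R} q *\<^sub>R Ln (z + R - \<i> * complex_of_real q) \<partial>lborel)
      = \<i> * Ln_primitive (z + R - \<i> * R) - \<i> * Ln_primitive (z + R - \<i> * of_real (- R))"
  proof (rule integral_FTC_atLeastAtMost)
    have nz: "z + R - \<i> * complex_of_real q \<notin> \<real>\<^sub>\<le>\<^sub>0" for q :: real
      using assms by (auto simp: complex_nonpos_Reals_iff)
    show "((\<lambda>q. \<i> * Ln_primitive (z + R - \<i> * complex_of_real q)) has_vector_derivative Ln (z + R - \<i> * q)) (at q within {-R..R})" for q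
    proof -
      have "((\<lambda>w. \<i> * Ln_primitive (z + R - \<i> * w)) has_field_derivative \<i> * (Ln (z + R - \<i> * q) * (0 + 0 - \<i> * 1))) (at (of_real q))"
        by (intro DERIV_cmult DERIV_chain2[OF has_field_derivative_Ln_primitive] nz DERIV_diff DERIV_add DERIV_const DERIV_ident)
      then have "((\<lambda>w. \<i> * Ln_primitive (z + R - \<i> * w)) has_field_derivative Ln (z + R - \<i> * q)) (at (of_real q))"
        by (simp add: algebra_simps)
      then show ?thesis by (rule has_vector_derivative_at_within[OF has_vector_derivative_real_field])
    qed
    show "continuous_on {-R..R} (\<lambda>q. Ln (z + R - \<i> * complex_of_real q))"
      using nz by (intro continuous_intros) auto
  qed (use \<open>R > 0\<close> in simp)
  have I2: "(\<integral>q. indicator {-R..R} q *\<^sub>R Ln (R - z + \<i> * complex_of_real q) \<partial>lborel)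
      = (- \<i> * Ln_primitive (R - z + \<i> * R)) - (- \<i> * Ln_primitive (R - z + \<i> * of_real (- R)))"
  proof (rule integral_FTC_atLeastAtMost)
    have nz: "R - z + \<i> * complex_of_real q \<notin> \<real>\<^sub>\<le>\<^sub>0" for q :: real
      using assms by (auto simp: complex_nonpos_Reals_iff)
    show "((\<lambda>q. - \<i> * Ln_primitive (R - z + \<i> * complex_of_real q)) has_vector_derivative Ln (R - z + \<i> * q)) (at q within {-R..R})" for q
    proof -
      have "((\<lambda>w. - \<i> * Ln_primitive (R - z + \<i> * w)) has_field_derivative - \<i> * (Ln (R - z + \<i> * q) * (0 - 0 + \<i> * 1))) (at (of_real q))"
        by (intro DERIV_cmult DERIV_chain2[OF has_field_derivative_Ln_primitive] nz DERIV_diff DERIV_add DERIV_const DERIV_ident)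
      then have "((\<lambda>w. - \<i> * Ln_primitive (R - z + \<i> * w)) has_field_derivative Ln (R - z + \<i> * q)) (at (of_real q))"
        by (simp add: algebra_simps)
      then show ?thesis by (rule has_vector_derivative_at_within[OF has_vector_derivative_real_field])
    qed
    show "continuous_on {-R..R} (\<lambda>q. Ln (R - z + \<i> * complex_of_real q))"
      using nz by (intro continuous_intros) auto
  qed (use \<open>R > 0\<close> in simp)
  have int1: "integrable lborel (\<lambda>q. indicator {-R..R} q *\<^sub>R Ln (z + R - \<i> * complex_of_real q))"
    "integrable lborel (\<lambda>q. indicator {-R..R} q *\<^sub>R Ln (R - z + \<i> * complex_of_real q))"
    using assms by (auto intro!: borel_integrable_compact continuous_intros simp: complex_nonpos_Reals_iff)
  \<comment> \<open>The integral of the sign is the difference of the lengths of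
    \<open>[-R, Im z]\<close> and \<open>[Im z, R]\<close>, that is \<open>2 * Im z\<close>.\<close>
  have sgn_eq: "indicator {-R..R} q *\<^sub>R (\<i> * pi * complex_of_real (sgn (Im z - q))) =
      indicator {-R..<Im z} q *\<^sub>R (\<i> * pi) - indicator {Im z<..R} q *\<^sub>R (\<i> * pi)" for q
    using assms by (auto simp: indicator_def sgn_if)
  have I3: "(\<integral>q. indicator {-R..R} q *\<^sub>R (\<i> * pi * complex_of_real (sgn (Im z - q))) \<partial>lborel) = 2 * pi * \<i> * Im z"
    unfolding sgn_eq using assms by (subst Bochner_Integration.integral_diff) (auto simp: scaleR_conv_of_real algebra_simps)
  have int3: "integrable lborel (\<lambda>q. indicator {-R..R} q *\<^sub>R (\<i> * pi * complex_of_real (sgn (Im z - q))))"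
    unfolding sgn_eq using assms
    by (intro Bochner_Integration.integrable_diff integrable_scaleR_left integrable_real_indicator) auto
  have "box_potential R z = integral\<^sup>L (lborel \<Otimes>\<^sub>M lborel) (case_prod f)"
    unfolding box_potential_def f_def[abs_def] lborel_prod case_prod_beta prod.collapse by simp
  also have "\<dots> = (\<integral>q. (\<integral>x. f x q \<partial>lborel) \<partial>lborel)"
    by (rule lborel_pair.integral_snd[OF int, symmetric])
  also have "\<dots> = (\<integral>q. indicator {-R..R} q *\<^sub>R Ln (z + R - \<i> * q) - indicator {-R..R} q *\<^sub>R Ln (R - z + \<i> * q)
      - indicator {-R..R} q *\<^sub>R (\<i> * pi * complex_of_real (sgn (Im z - q))) \<partial>lborel)"
  proof (rule integral_cong_AE)
    show "(\<lambda>q. \<integral>x. f x q \<partial>lborel) \<in> borel_measurable lborel"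
      using lborel_pair.integrable_snd[OF int] by (rule borel_measurable_integrable)
    show "(\<lambda>q. indicator {-R..R} q *\<^sub>R Ln (z + R - \<i> * q) - indicator {-R..R} q *\<^sub>R Ln (R - z + \<i> * q)
      - indicator {-R..R} q *\<^sub>R (\<i> * pi * complex_of_real (sgn (Im z - q)))) \<in> borel_measurable lborel"
      using int1 int3 by (intro borel_measurable_diff borel_measurable_integrable) auto
    show "AE q in lborel. (\<integral>x. f x q \<partial>lborel) = indicator {-R..R} q *\<^sub>R Ln (z + R - \<i> * q)
      - indicator {-R..R} q *\<^sub>R Ln (R - z + \<i> * q) - indicator {-R..R} q *\<^sub>R (\<i> * pi * complex_of_real (sgn (Im z - q)))"
      using AE_lborel_singleton[of "Im z"]
      by eventually_elim (subst inner, auto simp: scaleR_diff_right)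
  qed
  also have "\<dots> = (\<i> * Ln_primitive (z + R - \<i> * R) - \<i> * Ln_primitive (z + R - \<i> * of_real (- R)))
    - ((- \<i> * Ln_primitive (R - z + \<i> * R)) - (- \<i> * Ln_primitive (R - z + \<i> * of_real (- R)))) - 2 * pi * \<i> * Im z"
    using int1 int3 I1 I2 I3 by (simp add: Bochner_Integration.integral_diff Bochner_Integration.integrable_diff)
  finally show ?thesis by (simp add: algebra_simps)
qed

text \<open>Green's formula for a region known only through winding numbers. The winding number
  about \<open>p\<close> is a Cauchy integral; integrating it over all \<open>p\<close> in a square
  and exchanging the integrals leaves the potential of the square along the curve. The holomorphic
  part of the potential contributes nothing, and the rest is a multiple of the line integral of
  \<open>Im z dz\<close>, whose real part is minus the signed area.\<close>

theorem winding_number_area: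
  fixes \<gamma> \<gamma>' :: "real \<Rightarrow> complex" and \<sigma> R :: real
  assumes der: "\<And>t. (\<gamma> has_vector_derivative \<gamma>' t) (at t)" and cont: "continuous_on UNIV \<gamma>'"
    and loop: "\<gamma> 1 = \<gamma> 0"
    and box: "\<And>t. t \<in> {0..1} \<Longrightarrow> \<bar>Re (\<gamma> t)\<bar> < R \<and> \<bar>Im (\<gamma> t)\<bar> < R"
    and S: "open S" "\<And>p. p \<in> S \<Longrightarrow> \<bar>Re p\<bar> \<le> R \<and> \<bar>Im p\<bar> \<le> R"
    and wn: "\<And>p. p \<notin> \<gamma> ` {0..1} \<Longrightarrow> winding_number \<gamma> p = of_real (\<sigma> * indicator S p)"
  shows "\<sigma> * measure lebesgue S = integral {0..1} (\<lambda>t. Im (cnj (\<gamma> t) * \<gamma>' t)) / 2"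
proof -
  have "R > 0" using box[of 0] by auto
  have cont\<gamma>: "continuous_on UNIV \<gamma>"
    using der by (intro continuous_at_imp_continuous_on ballI has_vector_derivative_continuous)
  have [measurable]: "\<gamma> \<in> borel_measurable borel" "\<gamma>' \<in> borel_measurable borel"
    using cont cont\<gamma> by (auto intro: borel_measurable_continuous_onI)
  have vd: "vector_derivative \<gamma> (at t) = \<gamma>' t" for t
    using der by (rule vector_derivative_at)
  have vdw: "vector_derivative \<gamma> (at t within {0..1}) = \<gamma>' t" if "t \<in> {0..1}" for t
    using der that by (intro vector_derivative_at_within_ivl) auto
  have valid: "valid_path \<gamma>"
    unfolding valid_path_def
  proof (rule C1_differentiable_imp_piecewise)
    show "\<gamma> C1_differentiable_on {0..1}"
      unfolding C1_differentiable_on_def using der cont continuous_on_subset by blast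
  qed
  have closed: "pathfinish \<gamma> = pathstart \<gamma>" using loop by (simp add: pathfinish_def pathstart_def)

  let ?B = "{-R..R} \<times> {-R..R} :: (real \<times> real) set"
  let ?C = "\<lambda>p :: real \<times> real. Complex (fst p) (snd p)"
  have [measurable]: "?B \<in> sets borel" by (intro borel_closed closed_Times) auto
  define f where "f t p = indicator {0..1} t *\<^sub>R (indicator ?B p *\<^sub>R (\<gamma>' t / (\<gamma> t - ?C p)))" for t p
  define C where "C = (\<integral>\<^sup>+x. indicator {-2*R..2*R} x * inv_sqrt_kernel x \<partial>lborel)"
  have "C < \<infinity>" unfolding C_def by (rule nn_integral_inv_sqrt_kernel_finite[OF \<open>R > 0\<close>])
  have f_meas: "case_prod f \<in> borel_measurable (lborel \<Otimes>\<^sub>M lborel)"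
  proof -
    have "(\<lambda>x. indicator {0..1} (fst x) *\<^sub>R (indicator ?B (snd x) *\<^sub>R (\<gamma>' (fst x) / (\<gamma> (fst x) - ?C (snd x)))))
      \<in> borel_measurable (borel \<Otimes>\<^sub>M borel)"
      by measurable
    then show ?thesis unfolding f_def[abs_def] case_prod_beta by simp
  qed
  obtain M where M: "\<And>t. t \<in> {0..1} \<Longrightarrow> norm (\<gamma>' t) \<le> M"
  proof -
    have "bounded (\<gamma>' ` {0..1})"
      using cont by (intro compact_imp_bounded compact_continuous_image continuous_on_subset[OF cont]) auto
    then obtain M where "\<forall>x\<in>\<gamma>' ` {0..1}. norm x \<le> M" unfolding bounded_iff by blast
    then show ?thesis by (intro that[of M]) blast
  qed
  have int: "integrable (lborel \<Otimes>\<^sub>M lborel) (case_prod f)"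
  proof (rule integrableI_bounded[OF f_meas])
    have "(\<integral>\<^sup>+x. ennreal (norm (case_prod f x)) \<partial>(lborel \<Otimes>\<^sub>M lborel)) =
      (\<integral>\<^sup>+t. \<integral>\<^sup>+p. ennreal (norm (f t p)) \<partial>lborel \<partial>lborel)"
      using f_meas by (subst lborel.nn_integral_fst[symmetric]) auto
    also have "\<dots> \<le> (\<integral>\<^sup>+t. indicator {0..1} (t::real) * (ennreal M * (C * C)) \<partial>lborel)"
    proof (rule nn_integral_mono)
      fix t :: real
      show "(\<integral>\<^sup>+p. ennreal (norm (f t p)) \<partial>lborel) \<le> indicator {0..1} t * (ennreal M * (C * C))"
      proof (cases "t \<in> {0..1}")
        case True
        have "(\<integral>\<^sup>+p. ennreal (norm (f t p)) \<partial>lborel) \<le>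
          (\<integral>\<^sup>+p. ennreal M * ennreal (norm (indicator ?B p *\<^sub>R (1 / (\<gamma> t - ?C p)))) \<partial>lborel)"
        proof (rule nn_integral_mono)
          fix p
          have "norm (f t p) \<le> M * norm (indicator ?B p *\<^sub>R (1 / (\<gamma> t - ?C p)))"
            using True M[OF True] by (auto simp: f_def norm_divide indicator_def divide_right_mono)
          then show "ennreal (norm (f t p)) \<le> ennreal M * ennreal (norm (indicator ?B p *\<^sub>R (1 / (\<gamma> t - ?C p))))"
            using M[OF True] order_trans[OF norm_ge_zero] by (subst ennreal_mult[symmetric]) (auto intro!: ennreal_leI)
        qed
        also have "\<dots> = ennreal M * (\<integral>\<^sup>+p. ennreal (norm (indicator ?B p *\<^sub>R (1 / (\<gamma> t - ?C p)))) \<partial>lborel)"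
        proof (rule nn_integral_cmult)
          have "(\<lambda>p. ennreal (norm (indicator ?B p *\<^sub>R (1 / (\<gamma> t - ?C p))))) \<in> borel_measurable borel"
            by measurable
          then show "(\<lambda>p. ennreal (norm (indicator ?B p *\<^sub>R (1 / (\<gamma> t - ?C p))))) \<in> borel_measurable lborel"
            by simp
        qed
        also have "\<dots> \<le> ennreal M * (C * C)"
          unfolding C_def using box[OF True] by (intro mult_left_mono nn_integral_inverse_le) auto
        finally show ?thesis using True by simp
      qed (simp add: f_def)
    qed
    also have "\<dots> = ennreal M * (C * C)"
      by (subst nn_integral_multc) auto
    also have "\<dots> < \<infinity>" using \<open>C < \<infinity>\<close> by (simp add: ennreal_mult_less_top)
    finally show "(\<integral>\<^sup>+x. ennreal (norm (case_prod f x)) \<partial>(lborel \<Otimes>\<^sub>M lborel)) < \<infinity>" .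
  qed

  define H where "H z = \<i> * (Ln_primitive (z + R - \<i> * R) - Ln_primitive (z + R + \<i> * R))
    + \<i> * (Ln_primitive (R - z + \<i> * R) - Ln_primitive (R - z - \<i> * R))" for z :: complex
  let ?strip = "{z. \<bar>Re z\<bar> < R}"
  have strip: "?strip = {z. Re z < R} \<inter> {z. - R < Re z}" by auto
  have holH: "H holomorphic_on ?strip"
    unfolding H_def[abs_def] Ln_primitive_def
    by (intro holomorphic_intros) (auto simp: complex_nonpos_Reals_iff)
  \<comment> \<open>In the strip \<open>z + R\<close> and \<open>R - z\<close> have positive real
    part, so \<open>H\<close> is holomorphic there. The strip is convex, so Cauchy's theorem applies
    whatever the shape of the curve.\<close>
  have "(H has_contour_integral 0) \<gamma>"
  proof (rule Cauchy_theorem_convex_simple[OF holH _ valid _ closed])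
    show "convex ?strip" unfolding strip
      by (intro convex_Int convex_halfspace_Re_lt convex_halfspace_Re_gt)
    show "path_image \<gamma> \<subseteq> ?strip" using box by (auto simp: path_image_def)
  qed
  then have "((\<lambda>t. H (\<gamma> t) * vector_derivative \<gamma> (at t within {0..1})) has_integral 0) {0..1}"
    unfolding has_contour_integral_def by simp
  then have H0: "((\<lambda>t. H (\<gamma> t) * \<gamma>' t) has_integral 0) {0..1}"
    by (rule has_integral_eq[rotated]) (simp add: vdw)
  have contI: "continuous_on {0..1} (\<lambda>t. complex_of_real (Im (\<gamma> t)) * \<gamma>' t)"
    by (intro continuous_intros continuous_on_subset[OF cont] continuous_on_subset[OF cont\<gamma>]) auto
  then have intI: "(\<lambda>t. complex_of_real (Im (\<gamma> t)) * \<gamma>' t) integrable_on {0..1}"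
    by (rule integrable_continuous_interval)

  define N where "N p = (\<integral>t. indicator {0..1} t *\<^sub>R (\<gamma>' t / (\<gamma> t - ?C p)) \<partial>lborel)" for p
  have "(\<integral>p. (\<integral>t. f t p \<partial>lborel) \<partial>lborel) = (\<integral>t. (\<integral>p. f t p \<partial>lborel) \<partial>lborel)"
    by (rule lborel_pair.Fubini_integral[OF int])
  also have "(\<lambda>t. \<integral>p. f t p \<partial>lborel) = (\<lambda>t. indicator {0..1} t *\<^sub>R (H (\<gamma> t) * \<gamma>' t - 2 * pi * \<i> * (Im (\<gamma> t) * \<gamma>' t)))"
  proof
    fix t :: real
    show "(\<integral>p. f t p \<partial>lborel) = indicator {0..1} t *\<^sub>R (H (\<gamma> t) * \<gamma>' t - 2 * pi * \<i> * (Im (\<gamma> t) * \<gamma>' t))"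
    proof (cases "t \<in> {0..1}")
      case True
      have "f t p = \<gamma>' t * (indicator ?B p *\<^sub>R (1 / (\<gamma> t - ?C p)))" for p
        using True by (simp add: f_def)
      then have "(\<integral>p. f t p \<partial>lborel) = \<gamma>' t * box_potential R (\<gamma> t)"
        unfolding box_potential_def integral_mult_right_zero[symmetric] by (simp only:)
      then show ?thesis
        using True box[OF True] by (simp add: box_potential_eq H_def algebra_simps)
    qed (simp add: f_def)
  qed
  also have "(\<integral>t. indicator {0..1} t *\<^sub>R (H (\<gamma> t) * \<gamma>' t - 2 * pi * \<i> * (Im (\<gamma> t) * \<gamma>' t)) \<partial>lborel)
    = integral {0..1} (\<lambda>t. H (\<gamma> t) * \<gamma>' t - 2 * pi * \<i> * (Im (\<gamma> t) * \<gamma>' t))"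
  proof -
    have "continuous_on ?strip H" by (rule holomorphic_on_imp_continuous_on[OF holH])
    then have "continuous_on {0..1} (\<lambda>t. H (\<gamma> t))"
      by (rule continuous_on_compose2) (use box in \<open>auto intro: continuous_on_subset[OF cont\<gamma>]\<close>)
    then have "set_integrable lborel {0..1} (\<lambda>t. H (\<gamma> t) * \<gamma>' t - 2 * pi * \<i> * (Im (\<gamma> t) * \<gamma>' t))"
      unfolding set_integrable_def
      by (intro borel_integrable_compact continuous_intros contI continuous_on_subset[OF cont]) auto
    from set_borel_integral_eq_integral(2)[OF this] show ?thesis
      by (simp add: set_lebesgue_integral_def)
  qed
  also have "\<dots> = - 2 * pi * \<i> * integral {0..1} (\<lambda>t. Im (\<gamma> t) * \<gamma>' t)"
    using H0 intI by (subst Henstock_Kurzweil_Integration.integral_diff) (auto simp: has_integral_iff)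
  finally have main: "(\<integral>p. (\<integral>t. f t p \<partial>lborel) \<partial>lborel) = - 2 * pi * \<i> * integral {0..1} (\<lambda>t. Im (\<gamma> t) * \<gamma>' t)" .

  have inner: "(\<integral>t. f t p \<partial>lborel) = 2 * pi * \<i> * of_real (\<sigma> * indicator S (?C p))"
    if p: "p \<notin> (\<lambda>t. (Re (\<gamma> t), Im (\<gamma> t))) ` {0..1}" for p
  proof (cases "p \<in> ?B")
    case False
    then have "?C p \<notin> S" using S(2)[of "?C p"] by (cases p) (auto simp: abs_le_iff)
    then show ?thesis using False by (simp add: f_def)
  next
    case True
    have np: "?C p \<notin> \<gamma> ` {0..1}"
      using p by (cases p) (auto simp: complex_eq_iff image_iff)
    have ne: "\<gamma> t - ?C p \<noteq> 0" if "t \<in> {0..1}" for t using np imageI[OF that, of \<gamma>] by auto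
    have c: "continuous_on {0..1} (\<lambda>t. \<gamma>' t / (\<gamma> t - ?C p))"
      using ne by (intro continuous_intros continuous_on_subset[OF cont] continuous_on_subset[OF cont\<gamma>]) auto
    have "set_integrable lborel {0..1} (\<lambda>t. \<gamma>' t / (\<gamma> t - ?C p))"
      unfolding set_integrable_def by (intro borel_integrable_compact c) auto
    from set_borel_integral_eq_integral(2)[OF this]
    have "(\<integral>t. f t p \<partial>lborel) = integral {0..1} (\<lambda>t. \<gamma>' t / (\<gamma> t - ?C p))"
      using True by (simp add: set_lebesgue_integral_def f_def)
    also have "\<dots> = contour_integral \<gamma> (\<lambda>w. 1 / (w - ?C p))"
      unfolding contour_integral_integral by (intro integral_cong) (simp add: vd)
    also have "\<dots> = 2 * pi * \<i> * winding_number \<gamma> (?C p)"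
      using winding_number_valid_path[OF valid, of "?C p"] np by (simp add: path_image_def)
    also have "\<dots> = 2 * pi * \<i> * of_real (\<sigma> * indicator S (?C p))"
      using wn[OF np] by simp
    finally show ?thesis .
  qed
  \<comment> \<open>A differentiable image of an interval is null in the plane, and off it the
    hypothesis on winding numbers is available.\<close>
  have AE: "AE p in lborel. p \<notin> (\<lambda>t. (Re (\<gamma> t), Im (\<gamma> t))) ` {0..1}"
  proof (rule AE_not_in)
    have "negligible ((\<lambda>t. (Re (\<gamma> t), Im (\<gamma> t))) ` {0..1})"
    proof (rule negligible_differentiable_image_lowdim)
      show "DIM(real) < DIM(real \<times> real)" by simp
      have "(\<lambda>t. (Re (\<gamma> t), Im (\<gamma> t))) differentiable (at t within {0..1})" for t
      proof -
        have "(\<gamma> has_derivative (\<lambda>h. h *\<^sub>R \<gamma>' t)) (at t within {0..1})"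
          using der[of t] by (simp add: has_vector_derivative_def has_derivative_at_withinI)
        then have "((\<lambda>t. (Re (\<gamma> t), Im (\<gamma> t))) has_derivative (\<lambda>h. (Re (h *\<^sub>R \<gamma>' t), Im (h *\<^sub>R \<gamma>' t)))) (at t within {0..1})"
          by (intro has_derivative_Pair has_derivative_Re has_derivative_Im)
        then show ?thesis by (auto simp: differentiable_def)
      qed
      then show "(\<lambda>t. (Re (\<gamma> t), Im (\<gamma> t))) differentiable_on {0..1}"
        by (simp add: differentiable_on_def)
    qed
    moreover
    have "closed ((\<lambda>t. (Re (\<gamma> t), Im (\<gamma> t))) ` {0..1})"
      by (intro compact_imp_closed compact_continuous_image continuous_intros continuous_on_subset[OF cont\<gamma>]) auto
    then have "(\<lambda>t. (Re (\<gamma> t), Im (\<gamma> t))) ` {0..1} \<in> sets lborel" by simp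
    note null_sets_completion_iff[OF this]
    ultimately show "(\<lambda>t. (Re (\<gamma> t), Im (\<gamma> t))) ` {0..1} \<in> null_sets lborel"
      by (simp only: negligible_iff_null_sets)
  qed
  have SC: "S \<in> sets borel" using S(1) by simp
  have emS: "emeasure lborel S < \<infinity>"
  proof -
    have "S \<subseteq> cbox (Complex (-R) (-R)) (Complex R R)"
      using S(2)[unfolded abs_le_iff] by (fastforce simp: cbox_def Basis_complex_def)
    then have "emeasure lborel S \<le> emeasure lborel (cbox (Complex (-R) (-R)) (Complex R R))"
      by (intro emeasure_mono) auto
    also have "\<dots> < \<infinity>" by (rule emeasure_lborel_cbox_finite)
    finally show ?thesis .
  qed
  have "(\<integral>p. (\<integral>t. f t p \<partial>lborel) \<partial>lborel) = (\<integral>p. 2 * pi * \<i> * of_real (\<sigma> * indicator S (?C p)) \<partial>lborel)"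
  proof (rule integral_cong_AE)
    show "(\<lambda>p. \<integral>t. f t p \<partial>lborel) \<in> borel_measurable lborel"
      using lborel_pair.integrable_snd[OF int] by (rule borel_measurable_integrable)
    have "(\<lambda>p. indicat_real S (?C p)) \<in> borel_measurable borel"
      using SC by measurable
    then show "(\<lambda>p. 2 * pi * \<i> * of_real (\<sigma> * indicator S (?C p))) \<in> borel_measurable lborel"
      by (intro borel_measurable_times borel_measurable_of_real borel_measurable_const) simp_all
    show "AE p in lborel. (\<integral>t. f t p \<partial>lborel) = 2 * pi * \<i> * of_real (\<sigma> * indicator S (?C p))"
      using AE by eventually_elim (rule inner)
  qed
  also have "\<dots> = (\<integral>z. 2 * pi * \<i> * of_real (\<sigma> * indicator S z) \<partial>(distr lborel borel ?C))"
    using SC by (subst integral_distr) auto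
  also have "\<dots> = (\<integral>z. (2 * pi * \<i> * \<sigma>) * of_real (indicator S z) \<partial>lborel)"
    unfolding distr_lborel_Complex by (simp add: mult.assoc)
  also have "\<dots> = 2 * pi * \<i> * \<sigma> * of_real (measure lborel S)"
  proof -
    have "(\<integral>z. complex_of_real (indicator S z) \<partial>lborel) = of_real (\<integral>z. indicator S z \<partial>lborel)"
      using SC emS by (intro integral_of_real integrable_real_indicator) auto
    also have "\<dots> = of_real (measure lborel S)" using SC emS by simp
    finally show ?thesis by simp
  qed
  finally have e: "(\<integral>p. (\<integral>t. f t p \<partial>lborel) \<partial>lborel) = 2 * pi * \<i> * \<sigma> * of_real (measure lborel S)" .
  have "2 * pi * \<i> * (complex_of_real \<sigma> * of_real (measure lborel S)) = 2 * pi * \<i> * (- integral {0..1} (\<lambda>t. Im (\<gamma> t) * \<gamma>' t))"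
    using trans[OF sym[OF e] main] by (simp only: mult.assoc mult_minus_left mult_minus_right of_real_minus)
  then have "complex_of_real \<sigma> * of_real (measure lborel S) = - integral {0..1} (\<lambda>t. Im (\<gamma> t) * \<gamma>' t)"
    by (subst (asm) mult_cancel_left) auto
  then have "\<sigma> * measure lborel S = - Re (integral {0..1} (\<lambda>t. Im (\<gamma> t) * \<gamma>' t))"
    by (metis Re_complex_of_real of_real_mult uminus_complex.sel(1))
  also have "Re (integral {0..1} (\<lambda>t. Im (\<gamma> t) * \<gamma>' t)) = integral {0..1} (\<lambda>t. Im (\<gamma> t) * Re (\<gamma>' t))"
    using integral_linear[OF intI bounded_linear_Re] by (simp add: o_def)
  finally have m1: "\<sigma> * measure lborel S = - integral {0..1} (\<lambda>t. Im (\<gamma> t) * Re (\<gamma>' t))" .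
  \<comment> \<open>The derivative of \<open>Re * Im\<close> integrates to \<open>0\<close> around
    the loop, which turns minus the integral of \<open>y dx\<close> into the symmetric form with
    \<open>x dy - y dx\<close>.\<close>
  have "((\<lambda>t. Re (\<gamma> t) * Im (\<gamma>' t) + Re (\<gamma>' t) * Im (\<gamma> t)) has_integral (Re (\<gamma> 1) * Im (\<gamma> 1) - Re (\<gamma> 0) * Im (\<gamma> 0))) {0..1}"
  proof (rule fundamental_theorem_of_calculus)
    fix t :: real
    have "((\<lambda>t. Re (\<gamma> t)) has_vector_derivative Re (\<gamma>' t)) (at t within {0..1})"
      "((\<lambda>t. Im (\<gamma> t)) has_vector_derivative Im (\<gamma>' t)) (at t within {0..1})"
      using has_vector_derivative_at_within[OF der[of t]]
      by (auto intro: bounded_linear.has_vector_derivative[OF bounded_linear_Re] bounded_linear.has_vector_derivative[OF bounded_linear_Im])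
    then show "((\<lambda>t. Re (\<gamma> t) * Im (\<gamma> t)) has_vector_derivative Re (\<gamma> t) * Im (\<gamma>' t) + Re (\<gamma>' t) * Im (\<gamma> t)) (at t within {0..1})"
      by (rule has_vector_derivative_mult)
  qed simp
  then have z: "integral {0..1} (\<lambda>t. Re (\<gamma> t) * Im (\<gamma>' t) + Re (\<gamma>' t) * Im (\<gamma> t)) = 0"
    using loop by (simp add: integral_unique)
  have i: "(\<lambda>t. Re (\<gamma> t) * Im (\<gamma>' t)) integrable_on {0..1}" "(\<lambda>t. Re (\<gamma>' t) * Im (\<gamma> t)) integrable_on {0..1}"
    by (intro integrable_continuous_interval continuous_intros continuous_on_subset[OF cont] continuous_on_subset[OF cont\<gamma>]; simp)+
  have "integral {0..1} (\<lambda>t. Im (cnj (\<gamma> t) * \<gamma>' t)) = integral {0..1} (\<lambda>t. Re (\<gamma> t) * Im (\<gamma>' t) - Re (\<gamma>' t) * Im (\<gamma> t))"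
    by (intro integral_cong) (simp add: algebra_simps)
  also have "\<dots> = - 2 * integral {0..1} (\<lambda>t. Re (\<gamma>' t) * Im (\<gamma> t))"
    using z i by (simp add: Henstock_Kurzweil_Integration.integral_add Henstock_Kurzweil_Integration.integral_diff)
  finally show ?thesis using m1 SC by (simp add: mult.commute measure_completion)
qed

section \<open>Area and angle under Riemann maps\<close>

lemma uniform_limit_Taylor_unit_ball:
  fixes h :: "complex \<Rightarrow> complex"
  assumes "h holomorphic_on ball 0 1" "0 \<le> \<rho>" "\<rho> < 1"
  shows "uniform_limit (cball 0 \<rho>) (\<lambda>N w. \<Sum>k<N. (deriv ^^ k) h 0 / fact k * w ^ k) h sequentially"
proof -
  define c where "c k = (deriv ^^ k) h 0 / fact k" for k
  have sums: "(\<lambda>k. c k * w ^ k) sums h w" if "w \<in> ball 0 1" for w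
    using holomorphic_power_series[OF assms(1) that] by (simp add: c_def)
  have "summable (\<lambda>k. c k * of_real ((1 + \<rho>) / 2) ^ k)"
    using assms by (intro sums_summable[OF sums]) (auto simp: norm_of_real simp del: of_real_add of_real_divide)
  then have "conv_radius c \<ge> ereal (norm (complex_of_real ((1 + \<rho>) / 2)))"
    by (rule conv_radius_geI)
  moreover have "norm (complex_of_real ((1 + \<rho>) / 2)) = (1 + \<rho>) / 2"
    using assms unfolding norm_of_real by simp
  ultimately have "ereal \<rho> < conv_radius c"
    using assms by (metis add_strict_right_mono ereal_less_eq(3) field_less_half_sum less_ereal.simps(1) less_le_trans add.commute)
  then have "uniform_limit (cball 0 \<rho>) (\<lambda>N w. \<Sum>k<N. c k * (w - 0) ^ k) (\<lambda>w. suminf (\<lambda>k. c k * (w - 0) ^ k)) sequentially"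
    by (rule powser_uniform_limit)
  then show ?thesis unfolding c_def[symmetric]
    by (rule uniform_limit_cong'[THEN iffD1, rotated 2])
      (use assms sums in \<open>auto simp: sums_iff\<close>)
qed

text \<open>Orthogonality of the characters of the circle: only diagonal terms of a double Taylor
  series survive.\<close>

lemma has_integral_circle_monomial:
  "((\<lambda>t. cnj (of_real \<rho> * cis (2 * pi * t)) ^ j * (of_real \<rho> * cis (2 * pi * t)) ^ k)
    has_integral (if j = k then of_real (\<rho> ^ (2 * k)) else 0)) {0..1}"
proof -
  have eq: "cnj (of_real \<rho> * cis (2 * pi * t)) ^ j * (of_real \<rho> * cis (2 * pi * t)) ^ k
    = of_real (\<rho> ^ (j + k)) * cis (2 * pi * (real k - real j) * t)" for t
  proof -
    have "cnj (cis (2 * pi * t)) ^ j * cis (2 * pi * t) ^ k = cis (2 * pi * (real k - real j) * t)"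
      unfolding cis_cnj Complex.DeMoivre cis_mult by (rule arg_cong[where f = cis]) (simp add: algebra_simps)
    moreover have "cnj (of_real \<rho> * cis (2 * pi * t)) ^ j * (of_real \<rho> * cis (2 * pi * t)) ^ k
      = of_real \<rho> ^ j * of_real \<rho> ^ k * (cnj (cis (2 * pi * t)) ^ j * cis (2 * pi * t) ^ k)"
      unfolding complex_cnj_mult complex_cnj_complex_of_real power_mult_distrib by (simp only: mult_ac)
    ultimately show ?thesis by (simp add: power_add)
  qed
  show ?thesis
  proof (cases "j = k")
    case True
    have "((\<lambda>t::real. complex_of_real (\<rho> ^ (j + k))) has_integral of_real (\<rho> ^ (j + k))) {0..1}"
      using has_integral_const_real[of "complex_of_real (\<rho> ^ (j + k))" 0 1] by simp
    then show ?thesis unfolding eq using True by (simp add: mult_2[symmetric, of k])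
  next
    case False
    define n where "n = 2 * pi * (real k - real j)"
    have n: "n \<noteq> 0" using False by (simp add: n_def)
    have "((\<lambda>t. of_real (\<rho> ^ (j + k)) * cis (n * t)) has_integral
      of_real (\<rho> ^ (j + k)) * (cis (n * 1) / (\<i> * n)) - of_real (\<rho> ^ (j + k)) * (cis (n * 0) / (\<i> * n))) {0..1}"
    proof (rule fundamental_theorem_of_calculus)
      fix t :: real
      have "((\<lambda>w. of_real (\<rho> ^ (j + k)) * (exp (\<i> * n * w) / (\<i> * n))) has_field_derivative
          of_real (\<rho> ^ (j + k)) * (exp (\<i> * n * of_real t) * (\<i> * n) / (\<i> * n))) (at (of_real t))"
        by (intro DERIV_cmult DERIV_cdivide DERIV_chain2[OF DERIV_exp]) (auto intro!: derivative_eq_intros)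
      then have "((\<lambda>w. of_real (\<rho> ^ (j + k)) * (exp (\<i> * n * w) / (\<i> * n))) has_field_derivative
          of_real (\<rho> ^ (j + k)) * cis (n * t)) (at (of_real t))"
        using n by (simp add: cis_conv_exp mult.assoc)
      from has_vector_derivative_at_within[OF has_vector_derivative_real_field[OF this]]
      show "((\<lambda>t. of_real (\<rho> ^ (j + k)) * (cis (n * t) / (\<i> * n))) has_vector_derivative
          of_real (\<rho> ^ (j + k)) * cis (n * t)) (at t within {0..1})"
        by (simp add: cis_conv_exp mult.assoc)
    qed simp
    moreover have "cis (n * 1) = 1"
    proof -
      have "n = 2 * pi * of_int (int k - int j)" by (simp add: n_def)
      then show ?thesis by (metis cis_multiple_2pi Ints_of_int mult.right_neutral)
    qed
    ultimately show ?thesis unfolding eq using False by (simp add: n_def)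
  qed
qed

text \<open>Multiplication by \<open>z\<close> is a real linear map of determinant
  \<open>(cmod z)\<^sup>2\<close>.\<close>

lemma linear_complex_det:
  fixes \<alpha> \<beta> :: "complex \<Rightarrow> real"
  assumes "linear \<alpha>" "linear \<beta>"
  shows "\<alpha> z * \<beta> (\<i> * z) - \<alpha> (\<i> * z) * \<beta> z = (cmod z)\<^sup>2 * (\<alpha> 1 * \<beta> \<i> - \<alpha> \<i> * \<beta> 1)"
proof -
  have *: "\<gamma> w = Re w * \<gamma> 1 + Im w * \<gamma> \<i>" if "linear \<gamma>" for \<gamma> :: "complex \<Rightarrow> real" and w
  proof -
    have "\<gamma> (Re w *\<^sub>R 1 + Im w *\<^sub>R \<i>) = Re w * \<gamma> 1 + Im w * \<gamma> \<i>"
      by (simp only: linear_add[OF that] linear_scale[OF that] real_scaleR_def)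
    moreover have "Re w *\<^sub>R 1 + Im w *\<^sub>R \<i> = w" by (simp add: complex_eq_iff)
    ultimately show ?thesis by simp
  qed
  show ?thesis
    unfolding *[OF assms(1), of z] *[OF assms(2), of z] *[OF assms(1), of "\<i> * z"] *[OF assms(2), of "\<i> * z"]
    unfolding cmod_power2 by (simp add: power2_eq_square algebra_simps)
qed

locale riemann_map =
  fixes \<Omega> :: "complex set" and f g :: "complex \<Rightarrow> complex" and w0 :: complex
  assumes open_domain: "open \<Omega>" and simply_connected_domain: "simply_connected \<Omega>"
    and holf: "f holomorphic_on \<Omega>" and holg: "g holomorphic_on ball 0 1"
    and f_in: "z \<in> \<Omega> \<Longrightarrow> f z \<in> ball 0 1" and gf: "z \<in> \<Omega> \<Longrightarrow> g (f z) = z"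
    and g_in: "w \<in> ball 0 1 \<Longrightarrow> g w \<in> \<Omega>" and fg: "w \<in> ball 0 1 \<Longrightarrow> f (g w) = w"
    and w0: "w0 \<in> \<Omega>" and f_w0: "f w0 = 0"
begin

lemma g_0: "g 0 = w0"
  using gf[OF w0] f_w0 by simp

lemma holg': "deriv g holomorphic_on ball 0 1"
  by (intro holomorphic_deriv holg) auto

lemma deriv_f_mult_deriv_g:
  assumes "z \<in> \<Omega>" shows "deriv f z * deriv g (f z) = 1"
proof -
  have "(g has_field_derivative deriv g (f z)) (at (f z))"
    using holomorphic_derivI[OF holg _ f_in[OF assms]] by simp
  moreover have "(f has_field_derivative deriv f z) (at z)"
    using holomorphic_derivI[OF holf open_domain assms] .
  ultimately have "((\<lambda>z. g (f z)) has_field_derivative deriv g (f z) * deriv f z) (at z)"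
    by (rule DERIV_chain2)
  then have "((\<lambda>z. z) has_field_derivative deriv g (f z) * deriv f z) (at z)"
    by (rule has_field_derivative_transform_within_open[OF _ open_domain assms]) (simp add: gf)
  then have "deriv g (f z) * deriv f z = 1"
    using DERIV_ident DERIV_unique by blast
  then show ?thesis by (simp add: mult.commute)
qed

lemma deriv_g_nonzero: "w \<in> ball 0 1 \<Longrightarrow> deriv g w \<noteq> 0"
  using deriv_f_mult_deriv_g[OF g_in, of w] fg[of w] by auto

lemma f_eq_0_iff: "z \<in> \<Omega> \<Longrightarrow> f z = 0 \<longleftrightarrow> z = w0"
  using gf f_w0 g_0 by metis

text \<open>The argument principle. After substitution the integrand is the logarithmic derivative
  of \<open>g - p\<close>. As \<open>g\<close> is injective with nonvanishing derivative, it has one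
  simple pole of residue \<open>1\<close> if \<open>p\<close> is attained in the unit disk and none
  otherwise; the pole counts only if it lies inside the circle.\<close>

lemma winding_number_image_circle:
  assumes \<rho>: "0 < \<rho>" "\<rho> < 1" and p: "p \<notin> (g \<circ> circlepath 0 \<rho>) ` {0..1}"
  shows "winding_number (g \<circ> circlepath 0 \<rho>) p = of_real (1 * indicator (g ` ball 0 \<rho>) p)"
proof -
  let ?c = "circlepath 0 \<rho>"
  have sub: "path_image ?c \<subseteq> ball 0 1" using \<rho> by (auto simp: sphere_def)
  have valid: "valid_path (g \<circ> ?c)"
    by (rule valid_path_compose_holomorphic[OF _ holg _ sub]) auto
  define h where "h w = deriv g w / (g w - p)" for w
  have img: "path_image (g \<circ> ?c) = (g \<circ> ?c) ` {0..1}" by (simp add: path_image_def)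
  have "winding_number (g \<circ> ?c) p = 1 / (2 * pi * \<i>) * contour_integral (g \<circ> ?c) (\<lambda>w. 1 / (w - p))"
    by (rule winding_number_valid_path[OF valid]) (use p img in simp)
  also have "contour_integral (g \<circ> ?c) (\<lambda>w. 1 / (w - p)) = contour_integral ?c h"
    unfolding contour_integral_integral
  proof (rule integral_cong)
    fix t :: real assume t: "t \<in> {0..1}"
    have ct: "?c t \<in> ball 0 1" using sub imageI[OF t, of ?c] unfolding path_image_def by blast
    have "vector_derivative (g \<circ> ?c) (at t) = vector_derivative ?c (at t) * deriv g (?c t)"
      by (rule vector_derivative_chain_at_general)
        (use ct in \<open>auto intro!: holomorphic_on_imp_differentiable_at[OF holg] simp: vector_derivative_circlepath
          has_vector_derivative_circlepath[THEN differentiableI_vector]\<close>)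
    then show "1 / ((g \<circ> ?c) t - p) * vector_derivative (g \<circ> ?c) (at t) = h (?c t) * vector_derivative ?c (at t)"
      by (simp add: h_def)
  qed
  also have "1 / (2 * pi * \<i>) * contour_integral ?c h = of_real (1 * indicator (g ` ball 0 \<rho>) p)"
  proof (cases "\<exists>w1\<in>ball 0 1. g w1 = p")
    case False
    have "h holomorphic_on ball 0 1"
      unfolding h_def[abs_def] using False by (intro holomorphic_intros holg holg') auto
    then have "(h has_contour_integral 0) ?c"
      by (rule Cauchy_theorem_convex_simple) (use sub in auto)
    moreover have "p \<notin> g ` ball 0 \<rho>"
    proof
      assume "p \<in> g ` ball 0 \<rho>"
      then obtain w where "w \<in> ball 0 \<rho>" "p = g w" by auto
      then show False using False \<rho> by (auto dest!: bspec[of _ _ w])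
    qed
    ultimately show ?thesis by (simp add: contour_integral_unique)
  next
    case True
    then obtain w1 where w1: "w1 \<in> ball 0 1" "g w1 = p" by auto
    have inj: "g w = p \<longleftrightarrow> w = w1" if "w \<in> ball 0 1" for w using fg that w1 by metis
    have w1c: "w1 \<notin> path_image ?c" using p w1 by (auto simp: path_image_def)
    have holo: "h holomorphic_on ball 0 1 - {w1}"
      unfolding h_def[abs_def]
      by (intro holomorphic_intros holomorphic_on_subset[OF holg] holomorphic_on_subset[OF holg'])
        (use inj in auto)
    have "contour_integral ?c h = 2 * pi * \<i> * (\<Sum>q\<in>{w1}. winding_number ?c q * residue h q)"
      by (rule Residue_theorem[OF _ _ _ holo])
        (use sub w1c \<rho> in \<open>auto intro!: winding_number_zero_outside[of _ "ball 0 1"]\<close>)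
    moreover have "residue h w1 = 1"
    proof -
      have "residue (\<lambda>w. deriv g w / (g w - p)) w1 = deriv g w1 / deriv g w1"
      proof (rule residue_simple_pole_deriv[where s = "ball 0 1"])
        show "((\<lambda>w. g w - p) has_field_derivative deriv g w1) (at w1)"
          using holomorphic_derivI[OF holg _ w1(1)] by (auto intro!: derivative_eq_intros)
      qed (use w1 holg holg' deriv_g_nonzero in \<open>auto intro!: holomorphic_intros\<close>)
      then show ?thesis using deriv_g_nonzero[OF w1(1)] by (simp add: h_def[abs_def])
    qed
    moreover have "winding_number ?c w1 = of_real (indicator (g ` ball 0 \<rho>) p)"
    proof (cases "w1 \<in> ball 0 \<rho>")
      case True
      then show ?thesis using w1 winding_number_circlepath[of w1 0 \<rho>] by (auto simp: dist_norm)
    next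
      case False
      have "winding_number ?c w1 = 0"
        by (rule winding_number_zero_outside[of _ "cball 0 \<rho>"])
          (use False w1c \<rho> in \<open>auto simp: sphere_def\<close>)
      moreover have "p \<notin> g ` ball 0 \<rho>"
      proof
        assume "p \<in> g ` ball 0 \<rho>"
        then obtain w where "w \<in> ball 0 \<rho>" "p = g w" by auto
        then show False using inj[of w] False \<rho> by auto
      qed
      ultimately show ?thesis by simp
    qed
    ultimately show ?thesis by simp
  qed
  finally show ?thesis .
qed

definition coeff :: "nat \<Rightarrow> complex" where
  "coeff k = (deriv ^^ k) (deriv g) 0 / fact k"

text \<open>The area, counted with multiplicity, of the image of the disk of radius
  \<open>sqrt x\<close> under the polynomial whose derivative is the truncated series of
  \<open>deriv g\<close>. The squared radius as argument makes the composite with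
  \<open>(cmod w)\<^sup>2\<close> smooth at the centre.\<close>

definition Taylor_area :: "nat \<Rightarrow> real \<Rightarrow> real" where
  "Taylor_area N x = pi * (\<Sum>k<N. (cmod (coeff k))\<^sup>2 * x ^ (k + 1) / (k + 1))"

text \<open>The Green formula is applied to the image of the circle of radius \<open>\<rho>\<close>.
  In the product of the Taylor series of \<open>cnj (g - w0)\<close> and \<open>deriv g\<close> only
  equal powers survive integration, and uniform convergence on the circle justifies working with
  partial sums.\<close>

lemma measure_image_ball:
  assumes \<rho>: "0 < \<rho>" "\<rho> < 1"
  shows "(\<lambda>N. Taylor_area N (\<rho>\<^sup>2)) \<longlonglongrightarrow> measure lebesgue (g ` ball 0 \<rho>)"
proof -
  define c where "c t = of_real \<rho> * cis (2 * pi * t)" for t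
  have c_eq: "circlepath 0 \<rho> = c"
    by (auto simp: circlepath_def part_circlepath_def c_def cis_conv_exp linepath_def algebra_simps)
  have cb: "c t \<in> cball 0 \<rho>" "c t \<in> ball 0 1" for t using \<rho> by (auto simp: c_def norm_mult)
  have cc: "continuous_on S c" for S unfolding c_def[abs_def] by (intro continuous_intros)
  have dc: "(c has_vector_derivative 2 * pi * \<i> * c t) (at t)" for t
  proof -
    have "((\<lambda>w. of_real \<rho> * exp (\<i> * (2 * pi * w))) has_field_derivative of_real \<rho> * (exp (\<i> * (2 * pi * of_real t)) * (\<i> * (2 * pi)))) (at (of_real t))"
      by (intro DERIV_cmult DERIV_chain2[OF DERIV_exp]) (auto intro!: derivative_eq_intros)
    from has_vector_derivative_real_field[OF this]
    show ?thesis by (simp add: c_def[abs_def] cis_conv_exp mult_ac)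
  qed
  have cg: "continuous_on UNIV (\<lambda>t. g (c t))" "continuous_on UNIV (\<lambda>t. deriv g (c t))"
    using holomorphic_on_imp_continuous_on[OF holg] holomorphic_on_imp_continuous_on[OF holg'] cc cb
    by (auto intro: continuous_on_compose2)
  let ?\<gamma>' = "\<lambda>t. 2 * pi * \<i> * c t * deriv g (c t)"
  have d\<gamma>: "((g \<circ> c) has_vector_derivative ?\<gamma>' t) (at t)" for t
    by (rule field_vector_diff_chain_at[OF dc holomorphic_derivI[OF holg open_ball cb(2)]])
  have "compact (g ` cball 0 \<rho>)"
    using \<rho> by (intro compact_continuous_image continuous_on_subset[OF holomorphic_on_imp_continuous_on[OF holg]]) auto
  then obtain R where R: "\<And>z. z \<in> g ` cball 0 \<rho> \<Longrightarrow> norm z < R"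
    using bounded_pos_less compact_imp_bounded by metis
  have Rb: "\<bar>Re z\<bar> < R \<and> \<bar>Im z\<bar> < R" if "z \<in> g ` cball 0 \<rho>" for z
    using R[OF that] abs_Re_le_cmod[of z] abs_Im_le_cmod[of z] by linarith
  have open_im: "open (g ` ball 0 \<rho>)"
  proof -
    have "inj_on g (ball 0 \<rho>)"
      using fg \<rho> by (intro inj_on_inverseI[of _ f]) auto
    then show ?thesis
      using \<rho> by (intro open_mapping_thm3 holomorphic_on_subset[OF holg]) auto
  qed
  have "1 * measure lebesgue (g ` ball 0 \<rho>) = integral {0..1} (\<lambda>t. Im (cnj ((g \<circ> c) t) * ?\<gamma>' t)) / 2"
  proof (rule winding_number_area[OF d\<gamma>, of R])
    show "continuous_on UNIV ?\<gamma>'" by (intro continuous_intros cc cg)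
    show "(g \<circ> c) 1 = (g \<circ> c) 0" by (simp add: c_def)
    show "\<bar>Re ((g \<circ> c) t)\<bar> < R \<and> \<bar>Im ((g \<circ> c) t)\<bar> < R" for t
      unfolding o_def by (rule Rb) (use cb in blast)
    show "open (g ` ball 0 \<rho>)" by fact
    show "\<bar>Re p\<bar> \<le> R \<and> \<bar>Im p\<bar> \<le> R" if "p \<in> g ` ball 0 \<rho>" for p
    proof -
      have "p \<in> g ` cball 0 \<rho>" using that by auto
      from Rb[OF this] show ?thesis by linarith
    qed
    show "winding_number (g \<circ> c) p = of_real (1 * indicator (g ` ball 0 \<rho>) p)" if "p \<notin> (g \<circ> c) ` {0..1}" for p
      using winding_number_image_circle[OF \<rho>] that unfolding c_eq by blast
  qed
  \<comment> \<open>Splitting off \<open>w0\<close> leaves a series without constant term in the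
    conjugated factor. The term with \<open>cnj w0\<close> is the integral of a derivative around a
    loop and vanishes.\<close>
  also have "integral {0..1} (\<lambda>t. Im (cnj ((g \<circ> c) t) * ?\<gamma>' t)) =
      integral {0..1} (\<lambda>t. 2 * pi * Re (cnj (g (c t) - w0) * (c t * deriv g (c t))) + Im (cnj w0 * ?\<gamma>' t))"
    by (intro integral_cong) (simp add: algebra_simps)
  also have "\<dots> = integral {0..1} (\<lambda>t. 2 * pi * Re (cnj (g (c t) - w0) * (c t * deriv g (c t)))) + integral {0..1} (\<lambda>t. Im (cnj w0 * ?\<gamma>' t))"
    by (intro Henstock_Kurzweil_Integration.integral_add integrable_continuous_interval continuous_intros cc
        continuous_on_subset[OF cg(1)] continuous_on_subset[OF cg(2)]) auto
  also have "integral {0..1} (\<lambda>t. Im (cnj w0 * ?\<gamma>' t)) = 0"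
  proof -
    have "((\<lambda>t. ?\<gamma>' t) has_integral (g \<circ> c) 1 - (g \<circ> c) 0) {0..1}"
      by (intro fundamental_theorem_of_calculus has_vector_derivative_at_within[OF d\<gamma>]) simp
    then have "(?\<gamma>' has_integral 0) {0..1}" by (simp add: c_def)
    then have "((\<lambda>t. cnj w0 * ?\<gamma>' t) has_integral cnj w0 * 0) {0..1}"
      by (rule has_integral_mult_right)
    from has_integral_linear[OF this bounded_linear_Im] show ?thesis
      by (intro integral_unique) (simp add: o_def)
  qed
  finally have meas: "measure lebesgue (g ` ball 0 \<rho>) =
      pi * integral {0..1} (\<lambda>t. Re (cnj (g (c t) - w0) * (c t * deriv g (c t))))" by simp

  define p where "p N w = (\<Sum>k<N. coeff k * w ^ k)" for N w
  define q where "q N w = (\<Sum>k<N. coeff k / (k + 1) * w ^ (k + 1))" for N w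
  have up: "uniform_limit (cball 0 \<rho>) p (deriv g) sequentially"
    using uniform_limit_Taylor_unit_ball[OF holg', of \<rho>] \<rho> by (simp add: p_def[abs_def] coeff_def)
  have coeff': "(deriv ^^ Suc k) g 0 / fact (Suc k) = coeff k / (k + 1)" for k
    by (simp add: coeff_def funpow_swap1 del: funpow.simps) (simp add: funpow_Suc_right del: funpow.simps)
  have q_eq: "(\<Sum>k<Suc N. (deriv ^^ k) g 0 / fact k * w ^ k) = w0 + q N w" for N w
    by (subst sum.lessThan_Suc_shift) (simp add: coeff' q_def g_0 del: power_Suc fact_Suc funpow.simps)
  have "uniform_limit (cball 0 \<rho>) (\<lambda>N w. \<Sum>k<Suc N. (deriv ^^ k) g 0 / fact k * w ^ k) g sequentially"
    using filterlim_compose[OF uniform_limit_Taylor_unit_ball[OF holg, of \<rho>] filterlim_Suc] \<rho> by simp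
  then have uq: "uniform_limit (cball 0 \<rho>) (\<lambda>N w. w0 + q N w) g sequentially"
    unfolding q_eq .
  have bdd: "bounded (h ` S)" if "continuous_on (cball 0 \<rho>) h" "S \<subseteq> cball 0 \<rho>" for h :: "complex \<Rightarrow> complex" and S
    using that by (meson bounded_subset compact_cball compact_continuous_image compact_imp_bounded image_mono)
  have uq': "uniform_limit {0..1} (\<lambda>N t. cnj (q N (c t))) (\<lambda>t. cnj (g (c t) - w0)) sequentially"
    unfolding uniform_limit_iff
  proof (intro allI impI)
    fix e :: real assume "e > 0"
    with uq have "\<forall>\<^sub>F N in sequentially. \<forall>w\<in>cball 0 \<rho>. dist (w0 + q N w) (g w) < e"
      unfolding uniform_limit_iff by blast
    then show "\<forall>\<^sub>F N in sequentially. \<forall>t\<in>{0..1}. dist (cnj (q N (c t))) (cnj (g (c t) - w0)) < e"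
    proof eventually_elim
      case (elim N)
      have "dist (cnj (q N (c t))) (cnj (g (c t) - w0)) = dist (w0 + q N (c t)) (g (c t))" for t
        unfolding dist_norm complex_cnj_diff[symmetric] complex_mod_cnj by (simp add: algebra_simps)
      then show ?case using elim cb by metis
    qed
  qed
  have up': "uniform_limit {0..1} (\<lambda>N t. c t * p N (c t)) (\<lambda>t. c t * deriv g (c t)) sequentially"
  proof (rule uniform_lim_mult)
    show "uniform_limit {0..1} (\<lambda>N. c) c sequentially" by (rule uniform_limit_const)
    show "uniform_limit {0..1} (\<lambda>N t. p N (c t)) (\<lambda>t. deriv g (c t)) sequentially"
      unfolding uniform_limit_iff
    proof (intro allI impI)
      fix e :: real assume "e > 0"
      with up have "\<forall>\<^sub>F N in sequentially. \<forall>w\<in>cball 0 \<rho>. dist (p N w) (deriv g w) < e"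
        unfolding uniform_limit_iff by blast
      then show "\<forall>\<^sub>F N in sequentially. \<forall>t\<in>{0..1}. dist (p N (c t)) (deriv g (c t)) < e"
        by eventually_elim (use cb in blast)
    qed
    show "bounded (c ` {0..1})" by (intro compact_imp_bounded compact_continuous_image cc) auto
    show "bounded ((\<lambda>t. deriv g (c t)) ` {0..1})"
      by (intro compact_imp_bounded compact_continuous_image continuous_on_subset[OF cg(2)]) auto
  qed
  have u: "uniform_limit (cbox 0 1) (\<lambda>N t. cnj (q N (c t)) * (c t * p N (c t))) (\<lambda>t. cnj (g (c t) - w0) * (c t * deriv g (c t))) sequentially"
    unfolding cbox_interval
  proof (rule uniform_lim_mult[OF uq' up'])
    show "bounded ((\<lambda>t. cnj (g (c t) - w0)) ` {0..1})"
      by (intro compact_imp_bounded compact_continuous_image continuous_intros continuous_on_subset[OF cg(1)]) auto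
    show "bounded ((\<lambda>t. c t * deriv g (c t)) ` {0..1})"
      by (intro compact_imp_bounded compact_continuous_image continuous_intros cc continuous_on_subset[OF cg(2)]) auto
  qed
  have contN: "continuous_on (cbox 0 1) (\<lambda>t. cnj (q N (c t)) * (c t * p N (c t)))" for N
    unfolding p_def q_def by (intro continuous_intros cc)
  obtain I J where IJ: "\<And>N. ((\<lambda>t. cnj (q N (c t)) * (c t * p N (c t))) has_integral I N) (cbox 0 1)"
    "((\<lambda>t. cnj (g (c t) - w0) * (c t * deriv g (c t))) has_integral J) (cbox 0 1)" "I \<longlonglongrightarrow> J"
  proof (rule uniform_limit_integral_cbox[OF u contN sequentially_bot])
    fix I J
    assume "\<And>N. ((\<lambda>t. cnj (q N (c t)) * (c t * p N (c t))) has_integral I N) (cbox 0 1)"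
      "((\<lambda>t. cnj (g (c t) - w0) * (c t * deriv g (c t))) has_integral J) (cbox 0 1)" "I \<longlonglongrightarrow> J"
    then show thesis by (rule that)
  qed
  have hI: "((\<lambda>t. cnj (q N (c t)) * (c t * p N (c t))) has_integral
      (\<Sum>j<N. \<Sum>k<N. cnj (coeff j) / (j + 1) * coeff k * (if j + 1 = k + 1 then of_real (\<rho> ^ (2 * (k + 1))) else 0))) {0..1}" for N
  proof -
    have "cnj (q N (c t)) * (c t * p N (c t)) =
      (\<Sum>j<N. \<Sum>k<N. cnj (coeff j) / (j + 1) * coeff k * (cnj (c t) ^ (j + 1) * c t ^ (k + 1)))" for t
    proof -
      have a: "cnj (q N (c t)) = (\<Sum>j<N. cnj (coeff j) / (j + 1) * cnj (c t) ^ (j + 1))"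
        unfolding q_def cnj_sum by (intro sum.cong refl) (simp del: power_Suc)
      have b: "c t * p N (c t) = (\<Sum>k<N. coeff k * c t ^ (k + 1))"
        unfolding p_def sum_distrib_left by (intro sum.cong refl) (simp add: mult_ac)
      show ?thesis unfolding a b sum_product by (intro sum.cong refl) (simp only: mult_ac)
    qed
    then show ?thesis unfolding c_def
      by (simp only:) (intro has_integral_sum has_integral_mult_right has_integral_circle_monomial finite_lessThan)
  qed
  have "I N = (\<Sum>j<N. \<Sum>k<N. cnj (coeff j) / (j + 1) * coeff k * (if j + 1 = k + 1 then of_real (\<rho> ^ (2 * (k + 1))) else 0))" for N
    by (rule has_integral_unique[OF IJ(1)[unfolded cbox_interval] hI])
  also have "(\<Sum>j<N. \<Sum>k<N. cnj (coeff j) / (j + 1) * coeff k * (if j + 1 = k + 1 then of_real (\<rho> ^ (2 * (k + 1))) else 0))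
     = of_real (\<Sum>k<N. (cmod (coeff k))\<^sup>2 * (\<rho>\<^sup>2) ^ (k + 1) / (k + 1))" for N
  proof -
    have "(\<Sum>k<N. cnj (coeff j) / (j + 1) * coeff k * (if j + 1 = k + 1 then complex_of_real (\<rho> ^ (2 * (k + 1))) else 0))
      = of_real ((cmod (coeff j))\<^sup>2 * (\<rho>\<^sup>2) ^ (j + 1) / (j + 1))" if "j < N" for j
    proof -
      have "(\<Sum>k<N. cnj (coeff j) / (j + 1) * coeff k * (if j + 1 = k + 1 then complex_of_real (\<rho> ^ (2 * (k + 1))) else 0))
        = (\<Sum>k<N. if k = j then cnj (coeff j) / (j + 1) * coeff j * complex_of_real (\<rho> ^ (2 * (j + 1))) else 0)"
        by (intro sum.cong) auto
      also have "\<dots> = cnj (coeff j) * coeff j * of_real ((\<rho>\<^sup>2) ^ (j + 1)) / (j + 1)"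
        using that unfolding power_mult by simp
      also have "cnj (coeff j) * coeff j = of_real ((cmod (coeff j))\<^sup>2)"
        by (metis complex_norm_square mult.commute)
      finally show ?thesis by simp
    qed
    then show ?thesis unfolding of_real_sum by (intro sum.cong refl) (simp only: lessThan_iff)
  qed
  finally have IN: "pi * Re (I N) = Taylor_area N (\<rho>\<^sup>2)" for N by (simp add: Taylor_area_def)
  have "(\<lambda>N. pi * Re (I N)) \<longlonglongrightarrow> pi * Re J" by (intro tendsto_intros IJ(3))
  moreover have "pi * Re J = measure lebesgue (g ` ball 0 \<rho>)"
    using has_integral_linear[OF IJ(2) bounded_linear_Re] unfolding meas by (simp add: o_def integral_unique)
  ultimately show ?thesis by (simp add: IN)
qed

end

context riemann_map
begin

definition Taylor_deriv :: "nat \<Rightarrow> complex \<Rightarrow> complex" where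
  "Taylor_deriv N w = (\<Sum>k<N. coeff k * w ^ k)"

text \<open>The mean of \<open>(cmod (Taylor_deriv N w))\<^sup>2\<close> over the circle of radius
  \<open>sqrt x\<close>, and up to the factor \<open>pi\<close> the derivative of
  \<open>Taylor_area N\<close>.\<close>

definition mean_density :: "nat \<Rightarrow> real \<Rightarrow> real" where
  "mean_density N x = (\<Sum>k<N. (cmod (coeff k))\<^sup>2 * x ^ k)"

text \<open>The angular primitive of \<open>|Taylor_deriv N|^2 - mean_density N\<close>: the monomial
  \<open>w^j (cnj w)^k\<close> is an eigenvector of the rotation field with eigenvalue \<open>i (j - k)\<close>.\<close>

definition angular_primitive :: "nat \<Rightarrow> complex \<Rightarrow> complex" where
  "angular_primitive N w = (\<Sum>j<N. \<Sum>k<N. (if j = k then 0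
     else coeff j * cnj (coeff k) / (\<i> * of_real (real j - real k)) * (w ^ j * cnj w ^ k)))"

text \<open>Polar coordinates equalize the density only on average over each circle. Adding this
  term to the normalized argument redistributes points along the circle, so that together with
  \<open>Taylor_area N\<close> of the squared modulus the Jacobian becomes exactly
  \<open>(cmod (Taylor_deriv N w))\<^sup>2\<close>.\<close>

definition angle_correction :: "nat \<Rightarrow> complex \<Rightarrow> real" where
  "angle_correction N w = Re (angular_primitive N w) / (2 * pi * mean_density N ((cmod w)\<^sup>2))"

lemma coeff_0: "coeff 0 \<noteq> 0"
  using deriv_g_nonzero[of 0] by (simp add: coeff_def)

lemma mean_density_pos: assumes "N > 0" "x \<ge> 0" shows "mean_density N x > 0"
proof -
  have "(\<Sum>k<N. (cmod (coeff k))\<^sup>2 * x ^ k) \<ge> (\<Sum>k\<in>{0}. (cmod (coeff k))\<^sup>2 * x ^ k)"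
    using assms by (intro sum_mono2) auto
  moreover have "(\<Sum>k\<in>{0}. (cmod (coeff k))\<^sup>2 * x ^ k) > 0" using coeff_0 by simp
  ultimately show ?thesis unfolding mean_density_def by linarith
qed

lemma Taylor_area_has_derivative:
  "(Taylor_area N has_real_derivative pi * mean_density N x) (at x)"
proof -
  have "((\<lambda>x. pi * (\<Sum>k<N. (cmod (coeff k))\<^sup>2 * x ^ (k + 1) / (k + 1))) has_real_derivative
    pi * (\<Sum>k<N. (cmod (coeff k))\<^sup>2 * (real (k + 1) * x ^ k) / (k + 1))) (at x)"
    by (intro DERIV_cmult DERIV_sum DERIV_cdivide) (metis DERIV_pow add_diff_cancel_right' One_nat_def)
  then show ?thesis unfolding Taylor_area_def[abs_def] mean_density_def
    by (simp add: field_simps del: of_nat_Suc of_nat_add)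
qed

lemma Taylor_area_0 [simp]: "Taylor_area N 0 = 0"
  by (simp add: Taylor_area_def)

lemma Taylor_area_strict_mono:
  assumes "N > 0" "0 \<le> x" "x < y" shows "Taylor_area N x < Taylor_area N y"
proof (rule DERIV_pos_imp_increasing[OF \<open>x < y\<close>])
  fix t assume "x \<le> t"
  then show "\<exists>d. (Taylor_area N has_real_derivative d) (at t) \<and> 0 < d"
    using Taylor_area_has_derivative mean_density_pos[OF \<open>N > 0\<close>, of t] \<open>0 \<le> x\<close>
    by (intro exI[of _ "pi * mean_density N t"]) auto
qed

lemma smooth_on_Taylor_area: "smooth_on UNIV (Taylor_area N)"
  unfolding Taylor_area_def[abs_def] by (intro smooth_intros) auto

lemma smooth_on_angle_correction:
  assumes "N > 0" shows "smooth_on UNIV (angle_correction N)"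
proof -
  have ap: "smooth_on UNIV (angular_primitive N)"
  proof -
    have "smooth_on UNIV (\<lambda>w. if j = k then 0
      else coeff j * cnj (coeff k) / (\<i> * of_real (real j - real k)) * (w ^ j * cnj w ^ k))" for j k
      by (cases "j = k") (auto intro!: smooth_intros)
    then show ?thesis unfolding angular_primitive_def[abs_def] by (intro smooth_intros) auto
  qed
  have "smooth_on UNIV (mean_density N)"
    unfolding mean_density_def[abs_def] by (intro smooth_intros) auto
  then have md: "smooth_on UNIV (\<lambda>w. mean_density N ((cmod w)\<^sup>2))"
    by (rule smooth_on_compose) (auto intro!: smooth_on_cmod_square[OF _ smooth_on_id])
  show ?thesis
    unfolding angle_correction_def[abs_def] using mean_density_pos[OF assms, THEN less_imp_neq, THEN not_sym]
    by (intro smooth_intros ap md) auto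
qed

lemma angle_correction_rotation_derivative:
  assumes "N > 0"
  shows "frechet_derivative (angle_correction N) (at w) (\<i> * w) =
    ((cmod (Taylor_deriv N w))\<^sup>2 - mean_density N ((cmod w)\<^sup>2)) / (2 * pi * mean_density N ((cmod w)\<^sup>2))"
proof -
  let ?M = "mean_density N ((cmod w)\<^sup>2)"
  define c where "c j k = coeff j * cnj (coeff k) * (w ^ j * cnj w ^ k)" for j k
  \<comment> \<open>The derivative in direction \<open>\<i> * w\<close> is computed along the orbit
    of the rotation. The modulus is constant on it, so the denominator of the correction is a
    constant factor.\<close>
  have rot: "((\<lambda>\<alpha>. cis \<alpha> * w) has_vector_derivative \<i> * w) (at 0)"
  proof -
    have "((\<lambda>z. exp (\<i> * z) * w) has_field_derivative (exp (\<i> * of_real 0) * (\<i> * 1)) * w) (at (of_real 0))"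
      by (intro DERIV_cmult_right DERIV_chain2[OF DERIV_exp] DERIV_cmult DERIV_ident)
    from has_vector_derivative_real_field[OF this] show ?thesis by (simp add: cis_conv_exp)
  qed
  have "(angle_correction N has_derivative frechet_derivative (angle_correction N) (at w)) (at (cis 0 * w))"
    using smooth_on_has_derivative[OF smooth_on_angle_correction[OF assms]] by simp
  from vector_derivative_diff_chain_within[OF rot, of "angle_correction N", simplified] this
  have d1: "((\<lambda>\<alpha>. angle_correction N (cis \<alpha> * w)) has_vector_derivative
      frechet_derivative (angle_correction N) (at w) (\<i> * w)) (at 0)"
    using has_derivative_at_withinI by (fastforce simp: o_def)
  have ac: "angle_correction N (cis \<alpha> * w) = Re (\<Sum>j<N. \<Sum>k<N. (if j = k then 0
      else c j k * (cis ((real j - real k) * \<alpha>) / (\<i> * of_real (real j - real k))))) / (2 * pi * ?M)" for \<alpha>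
  proof -
    have "coeff j * cnj (coeff k) / (\<i> * of_real (real j - real k)) * ((cis \<alpha> * w) ^ j * cnj (cis \<alpha> * w) ^ k)
      = c j k * (cis ((real j - real k) * \<alpha>) / (\<i> * of_real (real j - real k)))" for j k
    proof -
      have "cis \<alpha> ^ j * cnj (cis \<alpha>) ^ k = cis ((real j - real k) * \<alpha>)"
        unfolding cis_cnj Complex.DeMoivre cis_mult by (rule arg_cong[where f = cis]) (simp add: algebra_simps)
      then have "(cis \<alpha> * w) ^ j * cnj (cis \<alpha> * w) ^ k = cis ((real j - real k) * \<alpha>) * (w ^ j * cnj w ^ k)"
        unfolding complex_cnj_mult power_mult_distrib by (metis (no_types, lifting) mult.commute mult.left_commute)
      then show ?thesis by (simp add: c_def)
    qed
    then have "angular_primitive N (cis \<alpha> * w) = (\<Sum>j<N. \<Sum>k<N. (if j = k then 0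
      else c j k * (cis ((real j - real k) * \<alpha>) / (\<i> * of_real (real j - real k)))))"
      unfolding angular_primitive_def by (intro sum.cong refl if_cong)
    moreover have "cmod (cis \<alpha> * w) = cmod w" by (simp add: norm_mult)
    ultimately show ?thesis
      unfolding angle_correction_def by (simp only:)
  qed
  have "((\<lambda>\<alpha>. \<Sum>j<N. \<Sum>k<N. (if j = k then 0
      else c j k * (cis ((real j - real k) * \<alpha>) / (\<i> * of_real (real j - real k))))) has_vector_derivative
      (\<Sum>j<N. \<Sum>k<N. (if j = k then 0 else c j k))) (at 0)"
  proof (intro has_vector_derivative_sum)
    fix j k
    show "((\<lambda>\<alpha>. if j = k then 0 else c j k * (cis ((real j - real k) * \<alpha>) / (\<i> * of_real (real j - real k)))) has_vector_derivative
      (if j = k then 0 else c j k)) (at 0)"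
    proof (cases "j = k")
      case False
      define n where "n = real j - real k"
      have n: "n \<noteq> 0" using False by (simp add: n_def)
      have "((\<lambda>z. c j k * (exp (\<i> * n * z) / (\<i> * n))) has_field_derivative
          c j k * (exp (\<i> * n * of_real 0) * (\<i> * n * 1) / (\<i> * n))) (at (of_real 0))"
        by (intro DERIV_cmult DERIV_cdivide DERIV_chain2[OF DERIV_exp] DERIV_ident)
      then have "((\<lambda>z. c j k * (exp (\<i> * n * z) / (\<i> * n))) has_field_derivative c j k) (at (of_real 0))"
        using n by simp
      from has_vector_derivative_real_field[OF this]
      show ?thesis using False by (simp add: cis_conv_exp n_def[symmetric] mult.assoc)
    qed simp
  qed
  then have "((\<lambda>\<alpha>. Re (\<Sum>j<N. \<Sum>k<N. (if j = k then 0
      else c j k * (cis ((real j - real k) * \<alpha>) / (\<i> * of_real (real j - real k))))) / (2 * pi * ?M)) has_vector_derivative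
      Re (\<Sum>j<N. \<Sum>k<N. (if j = k then 0 else c j k)) / (2 * pi * ?M)) (at 0)"
    by (intro bounded_linear.has_vector_derivative[OF bounded_linear_divide]
        bounded_linear.has_vector_derivative[OF bounded_linear_Re])
  then have "frechet_derivative (angle_correction N) (at w) (\<i> * w) =
      Re (\<Sum>j<N. \<Sum>k<N. (if j = k then 0 else c j k)) / (2 * pi * ?M)"
    using d1 unfolding ac by (rule vector_derivative_unique_at[rotated])
  also have "(\<Sum>j<N. \<Sum>k<N. (if j = k then 0 else c j k)) = (\<Sum>j<N. (\<Sum>k<N. c j k) - c j j)"
  proof (rule sum.cong[OF refl])
    fix j assume j: "j \<in> {..<N}"
    have "(\<Sum>k<N. c j k) = c j j + (\<Sum>k\<in>{..<N} - {j}. c j k)"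
      using j by (intro sum.remove) auto
    moreover have "(\<Sum>k<N. (if j = k then 0 else c j k)) = 0 + (\<Sum>k\<in>{..<N} - {j}. (if j = k then 0 else c j k))"
      using j by (subst sum.remove[of _ j]) auto
    moreover have "(\<Sum>k\<in>{..<N} - {j}. (if j = k then 0 else c j k)) = (\<Sum>k\<in>{..<N} - {j}. c j k)"
      by (intro sum.cong) auto
    ultimately show "(\<Sum>k<N. (if j = k then 0 else c j k)) = (\<Sum>k<N. c j k) - c j j" by simp
  qed
  also have "\<dots> = (\<Sum>j<N. \<Sum>k<N. c j k) - (\<Sum>j<N. c j j)" by (rule sum_subtractf)
  also have "(\<Sum>j<N. \<Sum>k<N. c j k) = of_real ((cmod (Taylor_deriv N w))\<^sup>2)"
  proof -
    have "(\<Sum>j<N. \<Sum>k<N. c j k) = Taylor_deriv N w * cnj (Taylor_deriv N w)"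
      unfolding Taylor_deriv_def cnj_sum sum_product c_def
      by (intro sum.cong refl) simp
    then show ?thesis using complex_norm_square[of "Taylor_deriv N w"] by simp
  qed
  also have "(\<Sum>j<N. c j j) = of_real ?M"
  proof -
    have "c j j = of_real ((cmod (coeff j))\<^sup>2 * ((cmod w)\<^sup>2) ^ j)" for j
      unfolding c_def of_real_mult of_real_power complex_norm_square[symmetric, simplified of_real_power[symmetric]]
      by (simp add: complex_norm_square power_mult_distrib flip: of_real_power)
    then show ?thesis by (simp add: mean_density_def)
  qed
  finally show ?thesis by simp
qed

text \<open>\<open>f\<close> has a simple zero at \<open>w0\<close> and no other, so
  \<open>f z / (z - w0)\<close> extends without zeros and has a logarithm on the simply connected
  domain. Thus the argument of \<open>f\<close> differs from that of \<open>z - w0\<close> by a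
  single-valued function.\<close>

lemma holomorphic_log_f:
  obtains L where "L holomorphic_on \<Omega>" "\<And>z. z \<in> \<Omega> \<Longrightarrow> f z = (z - w0) * exp (L z)"
proof -
  let ?h = "\<lambda>z. if z = w0 then deriv f w0 else (f z - f w0) / (z - w0)"
  have h: "?h holomorphic_on \<Omega>" by (rule pole_lemma_open[OF holf open_domain])
  have nz: "?h z \<noteq> 0" if "z \<in> \<Omega>" for z
    using deriv_f_mult_deriv_g[OF that] f_eq_0_iff[OF that] f_w0 by auto
  obtain L where "L holomorphic_on \<Omega>" "\<And>z. z \<in> \<Omega> \<Longrightarrow> ?h z = exp (L z)"
    using simply_connected_imp_holomorphic_log[OF h] simply_connected_domain open_domain nz
    by (metis (no_types, lifting) open_imp_locally_path_connected)
  then show ?thesis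
  proof (intro that[of L])
    fix z assume z: "z \<in> \<Omega>"
    assume "\<And>z. z \<in> \<Omega> \<Longrightarrow> ?h z = exp (L z)"
    from this[OF z] show "f z = (z - w0) * exp (L z)"
      using f_w0 by (cases "z = w0") (auto simp: divide_eq_eq mult.commute)
  qed
qed

text \<open>The angle coordinate is the argument of \<open>z - w0\<close> over \<open>2 * pi\<close>
  plus \<open>Q\<close>; only the first summand is multivalued, and \<open>Q\<close> is smooth
  across \<open>w0\<close>. The Jacobian is the product of the one in the disk with the squared
  modulus of \<open>deriv f\<close>, the reciprocal of that of \<open>deriv g\<close>.\<close>

lemma area_angle_coordinates:
  assumes "N > 0"
  defines "A \<equiv> \<lambda>z. Taylor_area N ((cmod (f z))\<^sup>2)"
  obtains Q where "smooth_on \<Omega> A" "smooth_on \<Omega> Q"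
    "\<And>z. z \<in> \<Omega> - {w0} \<Longrightarrow>
      frechet_derivative A (at z) 1 * (Im (\<i> / (z - w0)) / (2 * pi) + frechet_derivative Q (at z) \<i>)
      - frechet_derivative A (at z) \<i> * (Im (1 / (z - w0)) / (2 * pi) + frechet_derivative Q (at z) 1)
      = (cmod (Taylor_deriv N (f z)))\<^sup>2 / (cmod (deriv g (f z)))\<^sup>2"
proof -
  obtain L where L: "L holomorphic_on \<Omega>" "\<And>z. z \<in> \<Omega> \<Longrightarrow> f z = (z - w0) * exp (L z)"
    using holomorphic_log_f by blast
  define Q where "Q z = Im (L z) / (2 * pi) + angle_correction N (f z)" for z
  have sf: "smooth_on \<Omega> f" by (rule smooth_on_holomorphic[OF open_domain holf])
  have sA: "smooth_on \<Omega> A" unfolding A_def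
    by (intro smooth_on_compose[OF smooth_on_Taylor_area] smooth_on_cmod_square sf open_domain) auto
  have sQ: "smooth_on \<Omega> Q" unfolding Q_def[abs_def]
    by (intro smooth_intros smooth_on_compose[OF smooth_on_angle_correction] smooth_on_holomorphic L sf open_domain assms) auto
  show ?thesis
  proof (rule that[OF sA sQ])
    fix z assume z: "z \<in> \<Omega> - {w0}"
    define w where "w = f z"
    define f' where "f' = deriv f z"
    let ?M = "mean_density N ((cmod w)\<^sup>2)"
    have w: "w \<noteq> 0" using f_eq_0_iff z by (auto simp: w_def)
    have df: "(f has_field_derivative f') (at z)"
      unfolding f'_def using holomorphic_derivI[OF holf open_domain] z by auto
    have dL: "(L has_field_derivative deriv L z) (at z)"
      using holomorphic_derivI[OF L(1) open_domain] z by auto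
    have f'eq: "f' / w = 1 / (z - w0) + deriv L z"
    proof -
      have "((\<lambda>z. (z - w0) * exp (L z)) has_field_derivative exp (L z) + (z - w0) * (exp (L z) * deriv L z)) (at z)"
        using dL by (auto intro!: derivative_eq_intros)
      then have "(f has_field_derivative exp (L z) + (z - w0) * (exp (L z) * deriv L z)) (at z)"
        by (rule has_field_derivative_transform_within_open[OF _ open_domain]) (use z L(2) in auto)
      then have "f' = exp (L z) + (z - w0) * (exp (L z) * deriv L z)" using df DERIV_unique by blast
      moreover have "(e + d * (e * l)) / (d * e) = 1 / d + l" if "d \<noteq> 0" "e \<noteq> 0" for d e l :: complex
        using that by (simp add: field_simps)
      ultimately show ?thesis using z L(2)[of z] by (simp add: w_def)
    qed
    define \<alpha> where "\<alpha> u = 2 * pi * ?M * (Re w * Re u + Im w * Im u)" for u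
    define T' where "T' = frechet_derivative (angle_correction N) (at w)"
    define \<beta> where "\<beta> u = Im (u / w) / (2 * pi) + T' u" for u
    have dT: "(angle_correction N has_derivative T') (at w)"
      unfolding T'_def using smooth_on_has_derivative[OF smooth_on_angle_correction[OF assms(1)]] by simp
    have lin: "linear \<alpha>" "linear \<beta>"
    proof -
      show "linear \<alpha>" unfolding \<alpha>_def[abs_def] by (intro linearI) (simp_all add: algebra_simps)
      have "linear T'" using dT has_derivative_linear by blast
      moreover have "linear (\<lambda>u. Im (u / w) / (2 * pi))"
        by (intro linearI) (simp_all add: add_divide_distrib scaleR_conv_of_real mult.assoc
            times_divide_eq_right[symmetric] del: times_divide_eq_right)
      ultimately show "linear \<beta>" unfolding \<beta>_def[abs_def]
        using linear_compose_add[of "\<lambda>u. Im (u / w) / (2 * pi)" T'] by blast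
    qed
    have "(A has_derivative (\<lambda>v. \<alpha> (f' * v))) (at z)"
    proof -
      have "((\<lambda>u. (Re u)\<^sup>2 + (Im u)\<^sup>2) has_derivative (\<lambda>u. 2 * (Re w * Re u + Im w * Im u))) (at w)"
        by (auto intro!: derivative_eq_intros simp: algebra_simps)
      from has_derivative_compose[OF df[unfolded has_field_derivative_def] this[unfolded w_def]]
      have "((\<lambda>z. (cmod (f z))\<^sup>2) has_derivative (\<lambda>v. 2 * (Re w * Re (f' * v) + Im w * Im (f' * v)))) (at z)"
        unfolding cmod_power2 w_def by simp
      from has_derivative_compose[OF this Taylor_area_has_derivative[unfolded has_field_derivative_def]]
      have "(A has_derivative (\<lambda>v. pi * ?M * (2 * (Re w * Re (f' * v) + Im w * Im (f' * v))))) (at z)"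
        unfolding A_def w_def .
      moreover have "(\<lambda>v. pi * ?M * (2 * (Re w * Re (f' * v) + Im w * Im (f' * v)))) = (\<lambda>v. \<alpha> (f' * v))"
        by (intro ext) (simp only: \<alpha>_def mult_ac)
      ultimately show ?thesis by (simp only:)
    qed
    then have fA: "frechet_derivative A (at z) = (\<lambda>v. \<alpha> (f' * v))" by (rule frechet_derivative_at[symmetric])
    have "(Q has_derivative (\<lambda>v. Im (deriv L z * v) / (2 * pi) + T' (f' * v))) (at z)"
      unfolding Q_def[abs_def]
      by (intro has_derivative_add bounded_linear.has_derivative[OF bounded_linear_divide] has_derivative_Im
          dL[unfolded has_field_derivative_def] has_derivative_compose[OF df[unfolded has_field_derivative_def] dT[unfolded w_def]])
    then have fQ: "frechet_derivative Q (at z) = (\<lambda>v. Im (deriv L z * v) / (2 * pi) + T' (f' * v))"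
      by (rule frechet_derivative_at[symmetric])
    have \<beta>: "Im (v / (z - w0)) / (2 * pi) + frechet_derivative Q (at z) v = \<beta> (f' * v)" for v
    proof -
      have "f' * v / w = v / (z - w0) + deriv L z * v"
        using arg_cong[OF f'eq, of "\<lambda>x. x * v"] by (simp add: algebra_simps)
      then show ?thesis unfolding fQ \<beta>_def by (simp add: add_divide_distrib)
    qed
    have "(cmod w)\<^sup>2 * (\<alpha> 1 * \<beta> \<i> - \<alpha> \<i> * \<beta> 1) = \<alpha> w * \<beta> (\<i> * w) - \<alpha> (\<i> * w) * \<beta> w"
      by (rule linear_complex_det[OF lin, symmetric])
    also have "\<alpha> (\<i> * w) = 0" by (simp add: \<alpha>_def)
    also have "\<alpha> w = 2 * pi * ?M * (cmod w)\<^sup>2"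
      unfolding \<alpha>_def by (simp only: cmod_power2[of w] power2_eq_square[of "Re w"] power2_eq_square[of "Im w"])
    also have "\<beta> (\<i> * w) = (cmod (Taylor_deriv N w))\<^sup>2 / (2 * pi * ?M)"
      using w mean_density_pos[OF assms(1), of "(cmod w)\<^sup>2"]
      by (simp add: \<beta>_def T'_def angle_correction_rotation_derivative[OF assms(1)] field_simps)
    finally have "(cmod w)\<^sup>2 * (\<alpha> 1 * \<beta> \<i> - \<alpha> \<i> * \<beta> 1) = (cmod w)\<^sup>2 * (cmod (Taylor_deriv N w))\<^sup>2"
      using mean_density_pos[OF assms(1), of "(cmod w)\<^sup>2"] by simp
    then have det: "\<alpha> 1 * \<beta> \<i> - \<alpha> \<i> * \<beta> 1 = (cmod (Taylor_deriv N w))\<^sup>2" using w by simp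
    have "\<alpha> f' * \<beta> (\<i> * f') - \<alpha> (\<i> * f') * \<beta> f' = (cmod f')\<^sup>2 * (cmod (Taylor_deriv N w))\<^sup>2"
      unfolding linear_complex_det[OF lin] det ..
    moreover have "(cmod f')\<^sup>2 = 1 / (cmod (deriv g w))\<^sup>2"
    proof -
      have "cmod f' * cmod (deriv g w) = 1"
        unfolding norm_mult[symmetric] f'_def w_def using deriv_f_mult_deriv_g z by simp
      then have "(cmod f')\<^sup>2 * (cmod (deriv g w))\<^sup>2 = 1" by (metis power_mult_distrib power_one)
      then show ?thesis by (metis mult_eq_0_iff nonzero_eq_divide_eq zero_neq_one)
    qed
    ultimately show "frechet_derivative A (at z) 1 * (Im (\<i> / (z - w0)) / (2 * pi) + frechet_derivative Q (at z) \<i>)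
      - frechet_derivative A (at z) \<i> * (Im (1 / (z - w0)) / (2 * pi) + frechet_derivative Q (at z) 1)
      = (cmod (Taylor_deriv N (f z)))\<^sup>2 / (cmod (deriv g (f z)))\<^sup>2"
      unfolding \<beta> fA by (simp add: mult.commute w_def)
  qed
qed

text \<open>On a smaller closed disk the modulus of \<open>deriv g\<close> has a positive minimum,
  so a uniformly small error of the truncation is also relatively small.\<close>

lemma eventually_Taylor_deriv_le:
  assumes "0 < r" "r < 1" "\<epsilon> > 0"
  shows "\<forall>\<^sub>F N in sequentially. \<forall>w\<in>cball 0 r. (cmod (Taylor_deriv N w))\<^sup>2 / (cmod (deriv g w))\<^sup>2 \<le> 1 + \<epsilon>"
proof -
  have cont: "continuous_on (cball 0 r) (\<lambda>w. cmod (deriv g w))"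
    using assms by (intro continuous_intros continuous_on_subset[OF holomorphic_on_imp_continuous_on[OF holg']]) auto
  obtain w1 where w1: "w1 \<in> cball 0 r" "\<And>w. w \<in> cball 0 r \<Longrightarrow> cmod (deriv g w1) \<le> cmod (deriv g w)"
    using continuous_attains_inf[OF compact_cball _ cont] assms by auto
  define m where "m = cmod (deriv g w1)"
  have m: "m > 0" using deriv_g_nonzero[of w1] w1 assms by (auto simp: m_def)
  \<comment> \<open>Chosen so that \<open>(1 + \<delta>)\<^sup>2 = 1 + \<epsilon>\<close>.\<close>
  define \<delta> where "\<delta> = sqrt (1 + \<epsilon>) - 1"
  have \<delta>: "\<delta> > 0" using assms by (simp add: \<delta>_def)
  have "uniform_limit (cball 0 r) Taylor_deriv (deriv g) sequentially"
    using uniform_limit_Taylor_unit_ball[OF holg', of r] assms by (simp add: Taylor_deriv_def[abs_def] coeff_def)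
  then have "\<forall>\<^sub>F N in sequentially. \<forall>w\<in>cball 0 r. dist (Taylor_deriv N w) (deriv g w) < \<delta> * m"
    unfolding uniform_limit_iff using m \<delta> by simp
  then show ?thesis
  proof eventually_elim
    case (elim N)
    show ?case
    proof
      fix w :: complex assume w: "w \<in> cball 0 r"
      have gw: "cmod (deriv g w) \<ge> m" using w1(2)[OF w] by (simp add: m_def)
      have "cmod (Taylor_deriv N w) \<le> cmod (deriv g w) + dist (Taylor_deriv N w) (deriv g w)"
        using norm_triangle_sub[of "Taylor_deriv N w" "deriv g w"] by (simp add: dist_norm)
      also have "\<dots> \<le> cmod (deriv g w) + \<delta> * m" using elim w by (simp add: less_imp_le)
      also have "\<dots> \<le> cmod (deriv g w) + \<delta> * cmod (deriv g w)" using gw \<delta> by simp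
      also have "\<dots> = sqrt (1 + \<epsilon>) * cmod (deriv g w)" by (simp add: \<delta>_def algebra_simps)
      finally have "(cmod (Taylor_deriv N w))\<^sup>2 \<le> (sqrt (1 + \<epsilon>) * cmod (deriv g w))\<^sup>2"
        by (intro power_mono) auto
      also have "\<dots> = (1 + \<epsilon>) * (cmod (deriv g w))\<^sup>2" using assms by (simp add: power_mult_distrib)
      finally show "(cmod (Taylor_deriv N w))\<^sup>2 / (cmod (deriv g w))\<^sup>2 \<le> 1 + \<epsilon>"
        using gw m assms by (simp add: divide_le_eq)
    qed
  qed
qed

end

text \<open>An automorphism of the disk moves the image of \<open>w0\<close> to the centre. Both
  domains can thus be based at the same point, which makes their angles comparable.\<close>

lemma riemann_map_exists:
  assumes "open \<Omega>" "simply_connected \<Omega>" "\<Omega> \<noteq> UNIV" "w0 \<in> \<Omega>"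
  obtains f g where "riemann_map \<Omega> f g w0"
proof -
  obtain f g where fg: "f holomorphic_on \<Omega>" "g holomorphic_on ball 0 1"
    "\<forall>z\<in>\<Omega>. f z \<in> ball 0 1 \<and> g (f z) = z" "\<forall>z\<in>ball 0 1. g z \<in> \<Omega> \<and> f (g z) = z"
    using Riemann_mapping_theorem[of \<Omega>] assms by auto
  have "f w0 \<in> ball 0 1" using fg assms by auto
  then obtain h k where hk: "h (f w0) = 0" "h holomorphic_on ball 0 1" "h ` ball 0 1 \<subseteq> ball 0 1"
    "k holomorphic_on ball 0 1" "k ` ball 0 1 \<subseteq> ball 0 1"
    "\<And>z. z \<in> ball 0 1 \<Longrightarrow> h (k z) = z" "\<And>z. z \<in> ball 0 1 \<Longrightarrow> k (h z) = z"
    using ball_biholomorphism_exists by blast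
  have "riemann_map \<Omega> (h \<circ> f) (g \<circ> k) w0"
  proof
    show "h \<circ> f holomorphic_on \<Omega>"
      using fg by (intro holomorphic_on_compose_gen[OF fg(1) hk(2)]) auto
    show "g \<circ> k holomorphic_on ball 0 1"
      by (intro holomorphic_on_compose_gen[OF hk(4) fg(2) hk(5)])
    show "(h \<circ> f) z \<in> ball 0 1" if "z \<in> \<Omega>" for z
      using fg(3) hk(3) that by (metis comp_apply image_subset_iff)
    show "(g \<circ> k) ((h \<circ> f) z) = z" if "z \<in> \<Omega>" for z using fg hk(7) that by auto
    show "(g \<circ> k) w \<in> \<Omega>" if "w \<in> ball 0 1" for w
      using fg(4) hk(5) that by (metis comp_apply image_subset_iff)
    show "(h \<circ> f) ((g \<circ> k) w) = w" if "w \<in> ball 0 1" for w using fg hk(5,6) that by (metis comp_apply image_subset_iff)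
  qed (use assms hk in auto)
  then show ?thesis by (rule that)
qed

context riemann_map
begin

lemma image_ball_subset: "\<rho> \<le> 1 \<Longrightarrow> g ` ball 0 \<rho> \<subseteq> \<Omega>"
  using g_in by (meson ball_subset_ball_iff image_subset_iff subset_ball subsetD)

lemma open_image_ball: "\<rho> \<le> 1 \<Longrightarrow> open (g ` ball 0 \<rho>)"
proof -
  assume "\<rho> \<le> 1"
  have "inj_on g (ball 0 1)" by (intro inj_on_inverseI[of _ f] fg)
  then have "inj_on g (ball 0 \<rho>)" using \<open>\<rho> \<le> 1\<close> by (meson inj_on_subset subset_ball)
  then show ?thesis
    using \<open>\<rho> \<le> 1\<close> by (intro open_mapping_thm3 holomorphic_on_subset[OF holg] subset_ball) auto
qed

lemma emeasure_image_ball_tendsto: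
  "(\<lambda>n. emeasure lebesgue (g ` ball 0 (1 - 1 / (real n + 2)))) \<longlonglongrightarrow> emeasure lebesgue \<Omega>"
proof -
  \<comment> \<open>The shift by \<open>2\<close> keeps every radius strictly between
    \<open>0\<close> and \<open>1\<close>.\<close>
  let ?A = "\<lambda>n::nat. g ` ball 0 (1 - 1 / (real n + 2))"
  have "incseq ?A"
    by (intro monoI image_mono subset_ball) (auto simp: frac_le)
  moreover have "range ?A \<subseteq> sets lebesgue"
    using open_image_ball by (intro image_subsetI borel_open[THEN sets_completionI_sets[of _ lborel, simplified]]) auto
  ultimately have "(\<lambda>n. emeasure lebesgue (?A n)) \<longlonglongrightarrow> emeasure lebesgue (\<Union>n. ?A n)"
    by (intro Lim_emeasure_incseq)
  moreover have "(\<Union>n. ?A n) = \<Omega>"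
  proof
    show "(\<Union>n. ?A n) \<subseteq> \<Omega>" by (intro UN_least image_ball_subset) simp
    show "\<Omega> \<subseteq> (\<Union>n. ?A n)"
    proof
      fix z assume z: "z \<in> \<Omega>"
      have "1 - cmod (f z) > 0" using f_in[OF z] by simp
      then obtain n where n: "inverse (real (Suc n)) < 1 - cmod (f z)" using reals_Archimedean by blast
      have "1 / (real n + 2) \<le> inverse (real (Suc n))" by (simp add: field_simps)
      then have "f z \<in> ball 0 (1 - 1 / (real n + 2))" using n by simp
      then show "z \<in> (\<Union>n. ?A n)" using gf[OF z] by (metis UN_I UNIV_I image_eqI)
    qed
  qed
  ultimately show ?thesis by simp
qed

lemma emeasure_image_ball_finite:
  assumes "0 < \<rho>" "\<rho> < 1" shows "emeasure lebesgue (g ` ball 0 \<rho>) < \<infinity>"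
proof -
  have "compact (g ` cball 0 \<rho>)"
    using assms by (intro compact_continuous_image continuous_on_subset[OF holomorphic_on_imp_continuous_on[OF holg]]) auto
  then have "bounded (g ` ball 0 \<rho>)"
    by (meson ball_subset_cball bounded_subset compact_imp_bounded image_mono)
  then have "g ` ball 0 \<rho> \<in> lmeasurable"
    using open_image_ball assms by (intro lmeasurable_open) auto
  from fmeasurableD2[OF this] show ?thesis by (simp add: less_top)
qed

lemma measure_image_ball_large:
  assumes "B < emeasure lebesgue \<Omega>" "B \<ge> 0" "r0 < 1"
  obtains r where "r0 < r" "0 < r" "r < 1" "measure lebesgue (g ` ball 0 r) > B"
proof -
  have "\<forall>\<^sub>F n in sequentially. emeasure lebesgue (g ` ball 0 (1 - 1 / (real n + 2))) > ennreal B"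
    using order_tendstoD(1)[OF emeasure_image_ball_tendsto, of "ennreal B"] assms by simp
  moreover have "\<forall>\<^sub>F n in sequentially. 1 - 1 / (real n + 2) > r0"
  proof -
    have "1 - r0 > 0" using assms by simp
    then obtain N where N: "inverse (real (Suc N)) < 1 - r0" using reals_Archimedean by blast
    have "1 - 1 / (real n + 2) > r0" if "n \<ge> N" for n
    proof -
      have "1 / (real n + 2) \<le> 1 / real (Suc N)" using that by (intro divide_left_mono) auto
      then show ?thesis using N by (simp add: inverse_eq_divide)
    qed
    then show ?thesis unfolding eventually_sequentially by blast
  qed
  ultimately have "\<forall>\<^sub>F n in sequentially. emeasure lebesgue (g ` ball 0 (1 - 1 / (real n + 2))) > ennreal B \<and> 1 - 1 / (real n + 2) > r0"
    by (rule eventually_conj)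
  from eventually_happens[OF this] obtain n where n: "emeasure lebesgue (g ` ball 0 (1 - 1 / (real n + 2))) > ennreal B" "1 - 1 / (real n + 2) > r0"
    by auto
  let ?r = "1 - 1 / (real n + 2)"
  have r: "0 < ?r" "?r < 1" by (auto simp: field_simps)
  have "emeasure lebesgue (g ` ball 0 ?r) = ennreal (measure lebesgue (g ` ball 0 ?r))"
    using emeasure_image_ball_finite[OF r] by (intro emeasure_eq_ennreal_measure) auto
  then have "measure lebesgue (g ` ball 0 ?r) > B"
    using n(1) assms(2) by (simp add: ennreal_less_iff)
  then show ?thesis using r n by (intro that[of ?r]) auto
qed

text \<open>\<open>Taylor_area N\<close> is strictly increasing, so the bound by its value at
  \<open>r\<close> confines \<open>f z\<close> to the closed disk of radius \<open>r\<close>, whose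
  image under \<open>g\<close> is compact inside the open domain. Such sets are where the cutoffs
  are extended from.\<close>

lemma compact_area_sublevel:
  assumes "0 < r" "r < 1" "N > 0" "c \<le> Taylor_area N (r\<^sup>2)"
  shows "compact {z \<in> \<Omega>. Taylor_area N ((cmod (f z))\<^sup>2) \<le> c}"
proof -
  have cont: "continuous_on UNIV (\<lambda>w::complex. Taylor_area N ((cmod w)\<^sup>2))"
    by (intro continuous_on_compose2[OF smooth_on_imp_continuous_on[OF smooth_on_Taylor_area]] continuous_intros) auto
  have "{w. Taylor_area N ((cmod w)\<^sup>2) \<le> c} = (\<lambda>w::complex. Taylor_area N ((cmod w)\<^sup>2)) -` {..c}" by auto
  then have "closed {w::complex. Taylor_area N ((cmod w)\<^sup>2) \<le> c}"
    using continuous_closed_preimage[OF cont closed_UNIV, of "{..c}"] by simp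
  then have "compact (cball 0 r \<inter> {w::complex. Taylor_area N ((cmod w)\<^sup>2) \<le> c})"
    by (intro compact_Int_closed) auto
  then have "compact (g ` (cball 0 r \<inter> {w. Taylor_area N ((cmod w)\<^sup>2) \<le> c}))"
    using assms by (intro compact_continuous_image continuous_on_subset[OF holomorphic_on_imp_continuous_on[OF holg]]) auto
  moreover have "g ` (cball 0 r \<inter> {w. Taylor_area N ((cmod w)\<^sup>2) \<le> c}) = {z \<in> \<Omega>. Taylor_area N ((cmod (f z))\<^sup>2) \<le> c}"
  proof (intro equalityI subsetI)
    fix z assume "z \<in> g ` (cball 0 r \<inter> {w. Taylor_area N ((cmod w)\<^sup>2) \<le> c})"
    then obtain w where w: "z = g w" "cmod w \<le> r" "Taylor_area N ((cmod w)\<^sup>2) \<le> c" by auto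
    then have "w \<in> ball 0 1" using assms by simp
    then show "z \<in> {z \<in> \<Omega>. Taylor_area N ((cmod (f z))\<^sup>2) \<le> c}" using w g_in fg by simp
  next
    fix z assume z: "z \<in> {z \<in> \<Omega>. Taylor_area N ((cmod (f z))\<^sup>2) \<le> c}"
    have "cmod (f z) \<le> r"
    proof (rule ccontr)
      assume "\<not> cmod (f z) \<le> r"
      then have "r\<^sup>2 < (cmod (f z))\<^sup>2" using assms by (intro power_strict_mono) auto
      then have "Taylor_area N (r\<^sup>2) < Taylor_area N ((cmod (f z))\<^sup>2)"
        using assms by (intro Taylor_area_strict_mono) auto
      then show False using z assms by auto
    qed
    then show "z \<in> g ` (cball 0 r \<inter> {w. Taylor_area N ((cmod w)\<^sup>2) \<le> c})"
      using z gf[of z] by (intro image_eqI[of _ _ "f z"]) auto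
  qed
  ultimately show ?thesis by simp
qed

lemma norm_f_le_of_area_le:
  assumes "0 < r" "N > 0" "Taylor_area N ((cmod (f z))\<^sup>2) \<le> Taylor_area N (r\<^sup>2)"
  shows "f z \<in> cball 0 r"
proof (rule ccontr)
  assume "f z \<notin> cball 0 r"
  then have "r\<^sup>2 < (cmod (f z))\<^sup>2" using assms by (intro power_strict_mono) auto
  then show False using Taylor_area_strict_mono[of N "r\<^sup>2" "(cmod (f z))\<^sup>2"] assms by auto
qed

end

section \<open>The quadrant and the leaf\<close>

abbreviation quadrant :: "complex set" where
  "quadrant \<equiv> {z. 0 < Re z \<and> 0 < Im z}"

lemma open_quadrant: "open quadrant" and convex_quadrant: "convex quadrant"
proof -
  have "quadrant = {z. Re z > 0} \<inter> {z. Im z > 0}" by auto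
  then show "open quadrant" "convex quadrant"
    by (auto intro!: open_Int open_halfspace_Re_gt open_halfspace_Im_gt convex_Int convex_halfspace_Re_gt convex_halfspace_Im_gt)
qed

lemma emeasure_quadrant: "emeasure lebesgue quadrant = \<infinity>"
proof -
  have "emeasure lebesgue quadrant \<ge> ennreal (real n)" for n
  proof -
    let ?B = "box 0 (Complex (real n) 1)"
    have "emeasure lebesgue ?B = emeasure lborel ?B" by simp
    also have "\<dots> = ennreal (\<Prod>b\<in>Basis. (Complex (real n) 1 - 0) \<bullet> b)"
      by (intro emeasure_lborel_box) (auto simp: Basis_complex_def)
    also have "(\<Prod>b\<in>Basis. (Complex (real n) 1 - 0) \<bullet> b) = real n"
      by (simp add: Basis_complex_def complex_eq_iff)
    finally have "ennreal (real n) = emeasure lebesgue ?B" by simp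
    also have "\<dots> \<le> emeasure lebesgue quadrant"
      using open_quadrant by (intro emeasure_mono) (auto simp: box_def Basis_complex_def)
    finally show ?thesis .
  qed
  then show ?thesis
    by (metis ennreal_le_epsilon ennreal_of_nat_eq_real_of_nat ennreal_Ex_less_of_nat infinity_ennreal_def leD top.not_eq_extremum)
qed

lemma smooth_has_vector_derivative:
  fixes \<eta> :: "real \<Rightarrow> 'a::real_normed_vector"
  assumes "smooth \<eta>"
  shows "(\<eta> has_vector_derivative vector_derivative \<eta> (at t)) (at t)"
  using smooth_on_has_derivative[of UNIV \<eta> t] assms
  by (auto simp: smooth_iff_smooth_on_UNIV vector_derivative_works[symmetric] differentiable_def)

lemma smooth_on_vector_derivative:
  fixes \<eta> :: "real \<Rightarrow> 'a::real_normed_vector"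
  assumes "smooth \<eta>"
  shows "smooth_on UNIV (\<lambda>t. vector_derivative \<eta> (at t))"
proof -
  have "frechet_derivative \<eta> (at t) 1 = vector_derivative \<eta> (at t)" for t
  proof -
    have "frechet_derivative \<eta> (at t) = (\<lambda>h. h *\<^sub>R vector_derivative \<eta> (at t))"
      using smooth_has_vector_derivative[OF assms, of t] unfolding has_vector_derivative_def
      by (rule frechet_derivative_at[symmetric])
    then show ?thesis by simp
  qed
  then show ?thesis
    using smooth_on_frechet_derivative[of UNIV \<eta> 1] assms by (simp add: smooth_iff_smooth_on_UNIV)
qed

locale leaf_curve =
  fixes \<eta> :: "real \<Rightarrow> complex" and a :: real
  assumes leaf: "leaf \<eta> a" and a_pos: "a > 0"
begin

lemma smooth_\<eta>: "smooth \<eta>" and periodic: "\<eta> (t + 1) = \<eta> t"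
  and inj_mod_1: "\<eta> t = \<eta> t' \<Longrightarrow> t - t' \<in> \<int>" and in_quadrant: "\<eta> t \<in> quadrant"
  and signed_area_pos: "integral {0..1} (\<lambda>t. Im (cnj (\<eta> t) * vector_derivative \<eta> (at t))) / 2 > 0"
  and regular: "vector_derivative \<eta> (at t) \<noteq> 0"
  and area: "measure lebesgue (inside (path_image \<eta>)) = a"
  using leaf by (auto simp: leaf_def ccw_curve_def path_image_def)

lemma cont_\<eta>: "continuous_on S \<eta>"
  using smooth_on_imp_continuous_on[of UNIV \<eta>] smooth_\<eta> continuous_on_subset
  by (auto simp: smooth_iff_smooth_on_UNIV)

lemma periodic_int: "\<eta> (t + of_int k) = \<eta> t"
proof (induction k rule: int_induct[of _ 0])
  case (step1 i)
  then show ?case using periodic[of "t + of_int i"] by (simp add: add.assoc)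
next
  case (step2 i)
  then show ?case using periodic[of "t + of_int (i - 1)"] by simp
qed simp

lemma closed_curve: "pathfinish \<eta> = pathstart \<eta>"
  using periodic[of 0] by (simp add: pathfinish_def pathstart_def)

lemma simple_path: "simple_path \<eta>"
  unfolding simple_path_def
proof
  show "path \<eta>" by (simp add: path_def cont_\<eta>)
  show "loop_free \<eta>"
    unfolding loop_free_def
  proof (intro ballI impI)
    fix x y :: real assume xy: "x \<in> {0..1}" "y \<in> {0..1}" "\<eta> x = \<eta> y"
    obtain k :: int where k: "x - y = of_int k" using inj_mod_1[OF xy(3)] by (auto elim: Ints_cases)
    have "k = -1 \<or> k = 0 \<or> k = 1"
    proof -
      have "-2 < real_of_int k" "real_of_int k < 2" using xy k by auto
      then show ?thesis by auto
    qed
    then show "x = y \<or> x = 0 \<and> y = 1 \<or> x = 1 \<and> y = 0" using xy k by auto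
  qed
qed

abbreviation "interior_domain \<equiv> inside (path_image \<eta>)"

lemma compact_leaf: "compact (path_image \<eta>)"
  using simple_path by (simp add: compact_simple_path_image)

lemma interior_facts: "interior_domain \<noteq> {}" "open interior_domain" "bounded interior_domain"
  using Jordan_inside_outside[OF simple_path closed_curve] by auto

lemma simply_connected_interior: "simply_connected interior_domain"
  by (rule simply_connected_inside_simple_path[OF simple_path])

lemma leaf_subset_quadrant: "path_image \<eta> \<subseteq> quadrant"
  using in_quadrant by (auto simp: path_image_def)

lemma interior_subset_quadrant: "interior_domain \<subseteq> quadrant"
proof -
  have "- quadrant \<subseteq> outside (path_image \<eta>)"
    using outside_mono[OF leaf_subset_quadrant] unfolding outside_convex[OF convex_quadrant] .
  then show ?thesis using inside_Int_outside[of "path_image \<eta>"] by blast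
qed

lemma compact_closed_interior: "compact (path_image \<eta> \<union> interior_domain)"
  using closed_path_image_Un_inside[of \<eta>] simple_path_imp_path[OF simple_path] interior_facts(3) compact_leaf
  by (simp add: compact_eq_bounded_closed)

text \<open>For a Jordan curve the winding number inside is \<open>1\<close> or \<open>-1\<close>,
  constantly. The Green formula identifies the line integral in \<open>ccw_curve\<close> with this
  sign times the area, and positivity decides.\<close>

lemma winding_number_interior:
  assumes "z \<in> interior_domain" shows "winding_number \<eta> z = 1"
proof -
  obtain \<sigma> :: real where \<sigma>: "\<sigma> = 1 \<or> \<sigma> = -1" "\<And>z. z \<in> interior_domain \<Longrightarrow> winding_number \<eta> z = of_real \<sigma>"
    using simple_closed_path_winding_number_inside[OF simple_path] by (metis of_real_1 of_real_minus)
  have "bounded (path_image \<eta> \<union> interior_domain)" using compact_closed_interior compact_imp_bounded by blast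
  then obtain R where R: "\<And>z. z \<in> path_image \<eta> \<union> interior_domain \<Longrightarrow> norm z < R"
    using bounded_pos_less by metis
  have Rb: "\<bar>Re z\<bar> < R \<and> \<bar>Im z\<bar> < R" if "z \<in> path_image \<eta> \<union> interior_domain" for z
    using R[OF that] abs_Re_le_cmod[of z] abs_Im_le_cmod[of z] by linarith
  have "\<sigma> * measure lebesgue interior_domain = integral {0..1} (\<lambda>t. Im (cnj (\<eta> t) * vector_derivative \<eta> (at t))) / 2"
  proof (rule winding_number_area[of \<eta> _ R])
    show "continuous_on UNIV (\<lambda>t. vector_derivative \<eta> (at t))"
      by (rule smooth_on_imp_continuous_on[OF smooth_on_vector_derivative[OF smooth_\<eta>]])
    show "\<eta> 1 = \<eta> 0" using periodic[of 0] by simp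
    show "winding_number \<eta> p = of_real (\<sigma> * indicator interior_domain p)" if "p \<notin> \<eta> ` {0..1}" for p
    proof (cases "p \<in> interior_domain")
      case False
      then have "p \<in> outside (path_image \<eta>)"
        using that UnE[of p "interior_domain" "outside (path_image \<eta>)"]
        unfolding inside_Un_outside by (auto simp: path_image_def)
      then show ?thesis
        using False winding_number_zero_in_outside[OF simple_path_imp_path[OF simple_path] closed_curve] by simp
    qed (simp add: \<sigma>)
    show "\<bar>Re (\<eta> t)\<bar> < R \<and> \<bar>Im (\<eta> t)\<bar> < R" if "t \<in> {0..1}" for t
      by (rule Rb) (use that in \<open>auto simp: path_image_def\<close>)
    show "\<bar>Re p\<bar> \<le> R \<and> \<bar>Im p\<bar> \<le> R" if "p \<in> interior_domain" for p
      using Rb[of p] that by auto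
  qed (use smooth_has_vector_derivative[OF smooth_\<eta>] interior_facts in auto)
  then have "\<sigma> * a > 0" using signed_area_pos area by simp
  then have "\<sigma> = 1" using \<sigma>(1) a_pos by auto
  then show ?thesis using \<sigma>(2)[OF assms] by simp
qed

text \<open>The parameter along the leaf differs from the normalized argument of \<open>z - w0\<close> by a
  single-valued function, which we extend approximately to a polynomial in the plane.\<close>

lemma angle_extension:
  assumes w0: "w0 \<in> interior_domain" and "\<kappa> > 0"
  obtains Q :: "complex \<Rightarrow> real" where "smooth_on UNIV Q"
    "\<And>t. \<bar>Arg ((\<eta> t - w0) * cis (2 * pi * Q (\<eta> t)) * cis (- 2 * pi * t))\<bar> \<le> \<kappa>"
proof -
  have w0n: "w0 \<notin> path_image \<eta>" using w0 inside_no_overlap by blast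
  obtain q where q: "path q" "pathfinish q - pathstart q = 2 * of_real pi * \<i> * winding_number \<eta> w0"
    "\<And>t. t \<in> {0..1} \<Longrightarrow> \<eta> t = w0 + exp (q t)"
    using winding_number_as_continuous_log[OF simple_path_imp_path[OF simple_path] w0n] by blast
  define T where "T t = t - Im (q t) / (2 * pi)" for t
  \<comment> \<open>Along one period the parameter and the normalized argument both grow by
    \<open>1\<close>, the latter because the winding number is \<open>1\<close>.\<close>
  have T01: "T 0 = T 1"
  proof -
    have "q 1 = q 0 + 2 * of_real pi * \<i>"
      using q(2) winding_number_interior[OF w0] by (simp add: pathfinish_def pathstart_def algebra_simps)
    then show ?thesis by (simp add: T_def field_simps)
  qed
  have contT: "continuous_on {0..1} T"
    unfolding T_def using q(1) by (intro continuous_intros) (auto simp: path_def)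
  have Teq: "T x = T y" if "x \<in> {0..1}" "y \<in> {0..1}" "\<eta> x = \<eta> y" for x y
    using simple_path that T01 unfolding simple_path_def loop_free_def by metis
  define \<Theta> where "\<Theta> z = T (SOME t. t \<in> {0..1} \<and> \<eta> t = z)" for z
  have \<Theta>: "\<Theta> (\<eta> t) = T t" if "t \<in> {0..1}" for t
  proof -
    have "(SOME s. s \<in> {0..1} \<and> \<eta> s = \<eta> t) \<in> {0..1} \<and> \<eta> (SOME s. s \<in> {0..1} \<and> \<eta> s = \<eta> t) = \<eta> t"
      by (rule someI[of _ t]) (use that in auto)
    then show ?thesis unfolding \<Theta>_def using Teq that by blast
  qed
  \<comment> \<open>The preimage of a closed set under \<open>\<Theta>\<close> is the image under
    \<open>\<eta>\<close> of a compact set of parameters, so continuity descends from the interval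
    to the leaf.\<close>
  have "continuous_on (path_image \<eta>) \<Theta>"
  proof (subst continuous_on_closed_vimage)
    show "closed (path_image \<eta>)" using compact_leaf compact_imp_closed by blast
    show "\<forall>B. closed B \<longrightarrow> closed (\<Theta> -` B \<inter> path_image \<eta>)"
    proof (intro allI impI)
      fix B :: "real set" assume "closed B"
      have "\<Theta> -` B \<inter> path_image \<eta> = \<eta> ` ({0..1} \<inter> T -` B)"
        using \<Theta> by (auto simp: path_image_def image_iff)
      moreover have "compact ({0..1} \<inter> T -` B)"
        using continuous_closed_preimage[OF contT _ \<open>closed B\<close>]
        by (metis bounded_Int bounded_closed_interval closed_real_atLeastAtMost compact_eq_bounded_closed)
      ultimately show "closed (\<Theta> -` B \<inter> path_image \<eta>)"
        using compact_continuous_image[OF cont_\<eta>] compact_imp_closed by metis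
    qed
  qed
  \<comment> \<open>The bound \<open>pi / 2\<close> keeps the deviation inside the range of the
    principal argument, so that \<open>Arg\<close> returns the deviation itself.\<close>
  define \<kappa>' where "\<kappa>' = min \<kappa> (pi / 2)"
  have \<kappa>': "\<kappa>' > 0" "\<kappa>' \<le> \<kappa>" "\<kappa>' \<le> pi / 2" using \<open>\<kappa> > 0\<close> by (auto simp: \<kappa>'_def)
  then obtain Q where Q: "real_polynomial_function Q" "\<And>z. z \<in> path_image \<eta> \<Longrightarrow> \<bar>\<Theta> z - Q z\<bar> < \<kappa>' / (2 * pi)"
    using Stone_Weierstrass_real_polynomial_function[OF compact_leaf \<open>continuous_on (path_image \<eta>) \<Theta>\<close>, of "\<kappa>' / (2 * pi)"]
    by (metis divide_pos_pos mult_pos_pos pi_gt_zero zero_less_numeral)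
  have "smooth_on UNIV Q" using Q(1)
  proof (induction rule: real_polynomial_function.induct)
    case (linear f)
    then show ?case by (intro smooth_on_bounded_linear[of UNIV f "\<lambda>x. x"] smooth_on_id) auto
  qed (auto intro: smooth_intros)
  moreover have "\<bar>Arg ((\<eta> t - w0) * cis (2 * pi * Q (\<eta> t)) * cis (- 2 * pi * t))\<bar> \<le> \<kappa>" for t
  proof -
    have main: "\<bar>Arg ((\<eta> t - w0) * cis (2 * pi * Q (\<eta> t)) * cis (- 2 * pi * t))\<bar> \<le> \<kappa>" if t: "t \<in> {0..1}" for t
    proof -
      define d where "d = 2 * pi * (Q (\<eta> t) - T t)"
      have "\<bar>T t - Q (\<eta> t)\<bar> < \<kappa>' / (2 * pi)"
        using Q(2)[of "\<eta> t"] \<Theta>[OF t] t by (auto simp: path_image_def)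
      then have "2 * pi * \<bar>T t - Q (\<eta> t)\<bar> < \<kappa>'" by (simp add: field_simps)
      moreover have "\<bar>d\<bar> = 2 * pi * \<bar>T t - Q (\<eta> t)\<bar>"
        unfolding d_def abs_mult by (simp add: abs_minus_commute)
      ultimately have d: "\<bar>d\<bar> < \<kappa>'" by simp
      have "\<eta> t - w0 = exp (q t)" using q(3)[OF t] by simp
      also have "\<dots> = exp (Re (q t)) * cis (Im (q t))" by (simp add: exp_eq_polar)
      finally have "(\<eta> t - w0) * cis (2 * pi * Q (\<eta> t)) * cis (- 2 * pi * t)
        = exp (Re (q t)) * cis (Im (q t) + 2 * pi * Q (\<eta> t) + (- 2 * pi * t))"
        by (simp only: mult.assoc cis_mult add.assoc)
      also have "Im (q t) + 2 * pi * Q (\<eta> t) + (- 2 * pi * t) = d"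
        by (simp add: d_def T_def algebra_simps)
      finally have "(\<eta> t - w0) * cis (2 * pi * Q (\<eta> t)) * cis (- 2 * pi * t) = rcis (exp (Re (q t))) d"
        by (simp add: rcis_def)
      moreover have "Arg (rcis (exp (Re (q t))) d) = d"
        using d \<kappa>' by (intro Arg_rcis) auto
      ultimately show ?thesis using d \<kappa>' by simp
    qed
    define s where "s = frac t"
    have s: "s \<in> {0..1}" "t = s + of_int \<lfloor>t\<rfloor>" using frac_ge_0[of t] frac_lt_1[of t] by (auto simp: s_def frac_def)
    have "\<eta> t = \<eta> s" using periodic_int[of s "\<lfloor>t\<rfloor>"] s(2) by simp
    moreover have "cis (- 2 * pi * t) = cis (- 2 * pi * s)"
    proof -
      have "- 2 * pi * t = - 2 * pi * s + 2 * pi * of_int (- \<lfloor>t\<rfloor>)"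
        by (subst s(2)) (simp add: algebra_simps)
      then show ?thesis using cis_multiple_2pi[of "of_int (- \<lfloor>t\<rfloor>)"] by (metis Ints_of_int cis_mult mult.right_neutral)
    qed
    ultimately show ?thesis using main[OF s(1)] by simp
  qed
  ultimately show ?thesis by (rule that)
qed

end

section \<open>The cutoff in the quadrant\<close>

text \<open>The coefficient of \<open>dh \<and> d\<theta>\<close> with respect to the area form,
  where \<open>\<theta>\<close> is the argument of \<open>E\<close> over \<open>2 * pi\<close>.
  Since \<open>d\<theta>\<close> is the imaginary part of the logarithmic differential, no branch of
  the argument is needed.\<close>

definition angular_bracket :: "(complex \<Rightarrow> real) \<Rightarrow> (complex \<Rightarrow> complex) \<Rightarrow> complex \<Rightarrow> real" where
  "angular_bracket h E z = (frechet_derivative h (at z) 1 * Im (frechet_derivative E (at z) \<i> / E z)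
     - frechet_derivative h (at z) \<i> * Im (frechet_derivative E (at z) 1 / E z)) / (2 * pi)"

text \<open>For a function of \<open>A\<close> alone the differential is \<open>h'\<close> times
  \<open>dA\<close>, so the bracket is \<open>h'\<close> times the Jacobian of the pair of area and
  angle.\<close>

lemma angular_bracket_area_angle:
  assumes U: "open U" "z \<in> U" and "z \<noteq> w0"
    and A: "(A has_derivative A') (at z)" and Q: "(Q has_derivative Q') (at z)"
    and h: "(h has_real_derivative h') (at (A z))"
    and eqs: "\<And>y. y \<in> U \<Longrightarrow> k y = h (A y)" "\<And>y. y \<in> U \<Longrightarrow> E y = (y - w0) * cis (2 * pi * Q y)"
  shows "angular_bracket k E z = h' * (A' 1 * (Im (\<i> / (z - w0)) / (2 * pi) + Q' \<i>)
    - A' \<i> * (Im (1 / (z - w0)) / (2 * pi) + Q' 1))"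
proof -
  have "((\<lambda>y. h (A y)) has_derivative (\<lambda>v. h' * A' v)) (at z)"
    using has_derivative_compose[OF A h[unfolded has_field_derivative_def]] .
  then have "(k has_derivative (\<lambda>v. h' * A' v)) (at z)"
    by (rule has_derivative_transform_within_open[OF _ U]) (simp add: eqs)
  then have k: "frechet_derivative k (at z) = (\<lambda>v. h' * A' v)" by (rule frechet_derivative_at[symmetric])
  define e where "e = cis (2 * pi * Q z)"
  have e: "e \<noteq> 0" by (simp add: e_def)
  have dcis: "((\<lambda>y. cis (2 * pi * Q y)) has_derivative (\<lambda>v. e * (\<i> * (2 * pi * Q' v)))) (at z)"
  proof -
    have "((\<lambda>y. \<i> * complex_of_real (2 * pi * Q y)) has_derivative (\<lambda>v. \<i> * complex_of_real (2 * pi * Q' v))) (at z)"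
      by (intro has_derivative_mult_right has_derivative_of_real Q)
    from has_derivative_compose[OF this DERIV_exp[unfolded has_field_derivative_def]]
    show ?thesis unfolding cis_conv_exp e_def by simp
  qed
  have "((\<lambda>y. (y - w0) * cis (2 * pi * Q y)) has_derivative
      (\<lambda>v. (z - w0) * (e * (\<i> * (2 * pi * Q' v))) + (v - 0) * cis (2 * pi * Q z))) (at z)"
    by (intro has_derivative_mult has_derivative_diff has_derivative_ident has_derivative_const dcis)
  then have "(E has_derivative (\<lambda>v. (z - w0) * (e * (\<i> * (2 * pi * Q' v))) + (v - 0) * cis (2 * pi * Q z))) (at z)"
    by (rule has_derivative_transform_within_open[OF _ U]) (simp add: eqs)
  then have E: "frechet_derivative E (at z) = (\<lambda>v. (z - w0) * (e * (\<i> * (2 * pi * Q' v))) + v * e)"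
    by (simp add: frechet_derivative_at[symmetric] e_def)
  have Ez: "E z = (z - w0) * e" using eqs(2)[OF U(2)] by (simp add: e_def)
  have "frechet_derivative E (at z) v / E z = v / (z - w0) + \<i> * (2 * pi * Q' v)" for v
    unfolding E Ez using e \<open>z \<noteq> w0\<close> by (simp add: add_divide_distrib)
  then have "Im (frechet_derivative E (at z) v / E z) / (2 * pi) = Im (v / (z - w0)) / (2 * pi) + Q' v" for v
    by (simp add: add_divide_distrib)
  then show ?thesis
    unfolding angular_bracket_def k diff_divide_distrib times_divide_eq_right[symmetric]
    by (simp only: right_diff_distrib mult.assoc)
qed

lemma angular_bracket_locally_const:
  assumes "open U" "z \<in> U" "\<And>y. y \<in> U \<Longrightarrow> k y = c"
  shows "angular_bracket k E z = 0"
proof -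
  have "(k has_derivative (\<lambda>v. 0)) (at z)"
    by (rule has_derivative_transform_within_open[OF has_derivative_const assms(1,2)]) (simp add: assms(3))
  then show ?thesis unfolding angular_bracket_def by (simp add: frechet_derivative_at[symmetric])
qed

lemma (in riemann_map) good_truncation:
  assumes "0 < r" "r < 1" "\<delta> > 0" "B < measure lebesgue (g ` ball 0 r)"
    and "0 < r0" "r0 < 1" "measure lebesgue (g ` ball 0 r0) < B0"
  obtains N where "N > 0" "Taylor_area N (r\<^sup>2) > B" "Taylor_area N (r0\<^sup>2) < B0"
    "\<And>w. w \<in> cball 0 r \<Longrightarrow> (cmod (Taylor_deriv N w))\<^sup>2 / (cmod (deriv g w))\<^sup>2 \<le> 1 + \<delta>"
proof -
  have "\<forall>\<^sub>F N in sequentially. N > 0 \<and> Taylor_area N (r\<^sup>2) > B \<and> Taylor_area N (r0\<^sup>2) < B0 \<and>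
      (\<forall>w\<in>cball 0 r. (cmod (Taylor_deriv N w))\<^sup>2 / (cmod (deriv g w))\<^sup>2 \<le> 1 + \<delta>)"
    using order_tendstoD(1)[OF measure_image_ball[OF assms(1,2)] assms(4)]
      order_tendstoD(2)[OF measure_image_ball[OF assms(5,6)] assms(7)]
      eventually_Taylor_deriv_le[OF assms(1-3)] eventually_gt_at_top[of "0::nat"]
    by eventually_elim auto
  from eventually_happens[OF this] show ?thesis using that by auto
qed

context leaf_curve
begin

text \<open>\<open>E\<close> carries the angle multiplicatively, so that it can later be raised to
  the power \<open>m\<close>. The lower bound \<open>- \<epsilon>\<close> comes from the descent of
  \<open>k\<close> outside the leaf and the upper bound from its rise inside; \<open>C\<close> stays
  away from \<open>w0\<close>, the zero of \<open>E\<close>, and from the edge of the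
  quadrant.\<close>

theorem plane_profile:
  assumes "\<kappa> > 0" "\<epsilon> > 0"
  obtains k :: "complex \<Rightarrow> real" and E :: "complex \<Rightarrow> complex" and C V where
    "compact C" "C \<subseteq> V" "open V" "V \<subseteq> quadrant" "smooth_on UNIV k" "\<And>z. 0 \<le> k z" "\<And>z. k z \<le> 1"
    "\<And>z. z \<notin> C \<Longrightarrow> k z = 0" "smooth_on V E" "\<And>z. z \<in> V \<Longrightarrow> E z \<noteq> 0"
    "\<And>t. k (\<eta> t) = 1" "\<And>t. \<bar>Arg (E (\<eta> t) * cis (- 2 * pi * t))\<bar> \<le> \<kappa>"
    "\<And>z. z \<in> V \<Longrightarrow> - \<epsilon> \<le> k z * angular_bracket k E z"
    "\<And>z. z \<in> V \<Longrightarrow> k z * angular_bracket k E z \<le> (1 + \<epsilon>) / (2 * a)"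
proof -
  obtain w0 where w0: "w0 \<in> interior_domain" using interior_facts by auto
  obtain Qm where Qm: "smooth_on UNIV Qm"
    "\<And>t. \<bar>Arg ((\<eta> t - w0) * cis (2 * pi * Qm (\<eta> t)) * cis (- 2 * pi * t))\<bar> \<le> \<kappa>"
    using angle_extension[OF w0 \<open>\<kappa> > 0\<close>] by blast
  have w0q: "w0 \<in> quadrant" using w0 interior_subset_quadrant by blast
  have "interior_domain \<noteq> UNIV" using interior_facts(3) not_bounded_UNIV by metis
  then obtain f g where "riemann_map interior_domain f g w0"
    using riemann_map_exists[OF interior_facts(2) simply_connected_interior _ w0] by blast
  then interpret I: riemann_map interior_domain f g w0 .
  have "quadrant \<noteq> UNIV" using UNIV_I[of "0::complex"] by (metis (mono_tags, lifting) mem_Collect_eq zero_complex.sel(1) less_irrefl)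
  then obtain F G where "riemann_map quadrant F G w0"
    using riemann_map_exists[OF open_quadrant convex_imp_simply_connected[OF convex_quadrant] _ w0q] by blast
  then interpret O: riemann_map quadrant F G w0 .

  \<comment> \<open>Three factors \<open>1 + \<delta>\<close> accumulate inside the leaf: from the
    profile, the Jacobian and the area lost by shrinking the disk. For
    \<open>\<delta> \<le> 1\<close> their product is at most
    \<open>1 + 7 * \<delta>\<close>.\<close>
  define \<delta> where "\<delta> = min 1 (\<epsilon> / 7)"
  have \<delta>: "\<delta> > 0" "\<delta> \<le> 1" "7 * \<delta> \<le> \<epsilon>" using \<open>\<epsilon> > 0\<close> by (auto simp: \<delta>_def)

  obtain \<kappa>p p p' where p: "smooth_on UNIV p" "\<kappa>p > 0" "\<kappa>p < 1"
    "\<And>x. (p has_real_derivative p' x) (at x)" "\<And>x. 0 \<le> p x * p' x" "\<And>x. p x * p' x \<le> (1 + \<delta>) / 2"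
    "\<And>x. x \<le> \<kappa>p \<Longrightarrow> p x = 0" "\<And>x. x \<ge> 1 - \<kappa>p \<Longrightarrow> p x = 1" "\<And>x. 0 \<le> p x" "\<And>x. p x \<le> 1"
    using tight_smooth_sqrt_step[OF \<delta>(1)] by metis
  have "emeasure lebesgue interior_domain = ennreal a"
    using emeasure_eq_measure2[OF lmeasurable_open[OF interior_facts(3,2)]] area by simp
  moreover have "a / (1 + \<delta>) < a" using a_pos \<delta> by (simp add: divide_less_eq)
  ultimately have "ennreal (a / (1 + \<delta>)) < emeasure lebesgue interior_domain"
    using a_pos \<delta> by (simp add: ennreal_less_iff)
  then obtain r where r: "0 < r" "r < 1" "measure lebesgue (g ` ball 0 r) > a / (1 + \<delta>)"
    using I.measure_image_ball_large[of "a / (1 + \<delta>)" 0] a_pos \<delta> by (metis divide_nonneg_nonneg less_eq_real_def zero_less_one add_nonneg_nonneg)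
  obtain N where N: "N > 0" "I.Taylor_area N (r\<^sup>2) > a / (1 + \<delta>)"
    "\<And>w. w \<in> cball 0 r \<Longrightarrow> (cmod (I.Taylor_deriv N w))\<^sup>2 / (cmod (deriv g w))\<^sup>2 \<le> 1 + \<delta>"
    using I.good_truncation[OF r(1,2) \<delta>(1) r(3) r(1,2) less_add_one] by metis
  define Am where "Am = I.Taylor_area N (r\<^sup>2)"
  have Am: "Am > 0" "Am > a / (1 + \<delta>)"
    using N(2) a_pos \<delta> by (auto simp: Am_def intro: less_trans[OF _ N(2)])
  define A where "A = (\<lambda>z. I.Taylor_area N ((cmod (f z))\<^sup>2))"
  obtain Qi where Qi: "smooth_on interior_domain A" "smooth_on interior_domain Qi"
    "\<And>z. z \<in> interior_domain - {w0} \<Longrightarrow>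
      frechet_derivative A (at z) 1 * (Im (\<i> / (z - w0)) / (2 * pi) + frechet_derivative Qi (at z) \<i>)
      - frechet_derivative A (at z) \<i> * (Im (1 / (z - w0)) / (2 * pi) + frechet_derivative Qi (at z) 1)
      = (cmod (I.Taylor_deriv N (f z)))\<^sup>2 / (cmod (deriv g (f z)))\<^sup>2"
    using I.area_angle_coordinates[OF N(1)] unfolding A_def by blast
  have Aw0: "A w0 = 0" by (simp add: A_def I.f_w0)
  have compA: "compact {z \<in> interior_domain. A z \<le> c}" if "c \<le> Am" for c
    unfolding A_def by (rule I.compact_area_sublevel[OF r(1,2) N(1)]) (use that in \<open>simp add: Am_def\<close>)
  have openA: "open {z \<in> interior_domain. A z < c}" for c
  proof -
    have "{z \<in> interior_domain. A z < c} = interior_domain \<inter> A -` {..<c}" by auto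
    then show ?thesis
      using continuous_open_preimage[OF smooth_on_imp_continuous_on[OF Qi(1)] interior_facts(2) open_lessThan] by simp
  qed

  have "compact (F ` (path_image \<eta> \<union> interior_domain))"
    using leaf_subset_quadrant interior_subset_quadrant
    by (intro compact_continuous_image compact_closed_interior continuous_on_subset[OF holomorphic_on_imp_continuous_on[OF O.holf]]) auto
  then have "compact ((\<lambda>z. cmod (F z)) ` (path_image \<eta> \<union> interior_domain))"
    using compact_continuous_image[OF continuous_on_norm[OF continuous_on_id]] by (metis image_image)
  then obtain s0 where s0: "s0 \<in> path_image \<eta> \<union> interior_domain"
    "\<And>z. z \<in> path_image \<eta> \<union> interior_domain \<Longrightarrow> cmod (F z) \<le> cmod (F s0)"
    using compact_attains_sup[of "(\<lambda>z. cmod (F z)) ` (path_image \<eta> \<union> interior_domain)"] w0 by auto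
  \<comment> \<open>The disk of radius \<open>r0\<close> contains the image of the closed inside of
    the leaf; the \<open>1/2\<close> only ensures a positive radius.\<close>
  define r0 where "r0 = max (1/2) (cmod (F s0))"
  have r0: "0 < r0" "r0 < 1"
    using O.f_in[of s0] s0(1) leaf_subset_quadrant interior_subset_quadrant by (auto simp: r0_def)
  have r0': "cmod (F z) \<le> r0" if "z \<in> path_image \<eta> \<union> interior_domain" for z
    using s0(2)[OF that] by (simp add: r0_def)
  \<comment> \<open>The width, measured in area, of the descent outside the leaf. The step has slope
    at most \<open>2\<close> and the Jacobian is at most \<open>2\<close> there, so the bracket is
    at most \<open>4 / l\<close>.\<close>
  define l where "l = 4 / \<epsilon>"
  have l: "l > 0" using \<open>\<epsilon> > 0\<close> by (simp add: l_def)
  let ?m0 = "measure lebesgue (G ` ball 0 r0)"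
  \<comment> \<open>Beyond \<open>r0\<close> there must be room for a collar of width
    \<open>2\<close> and the descent of width \<open>l\<close>; one more unit absorbs the truncation
    error in \<open>A0\<close>. Here the infinite area of the quadrant enters.\<close>
  obtain R where R: "r0 < R" "0 < R" "R < 1" "measure lebesgue (G ` ball 0 R) > ?m0 + l + 3"
  proof (rule O.measure_image_ball_large[of "?m0 + l + 3" r0])
    show "ennreal (?m0 + l + 3) < emeasure lebesgue quadrant" by (simp add: emeasure_quadrant)
  qed (use l r0 in \<open>auto intro: add_nonneg_nonneg\<close>)
  obtain N' where N': "N' > 0" "O.Taylor_area N' (R\<^sup>2) > ?m0 + l + 3" "O.Taylor_area N' (r0\<^sup>2) < ?m0 + 1"
    "\<And>w. w \<in> cball 0 R \<Longrightarrow> (cmod (O.Taylor_deriv N' w))\<^sup>2 / (cmod (deriv G w))\<^sup>2 \<le> 1 + 1"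
    using O.good_truncation[OF R(2,3) zero_less_one R(4) r0 less_add_one] by metis
  define A0 where "A0 = O.Taylor_area N' (r0\<^sup>2)"
  have A0R: "A0 + 2 + l \<le> O.Taylor_area N' (R\<^sup>2)" using N'(2,3) by (simp add: A0_def)
  define Ao where "Ao = (\<lambda>z. O.Taylor_area N' ((cmod (F z))\<^sup>2))"
  obtain Qo where Qo: "smooth_on quadrant Ao" "smooth_on quadrant Qo"
    "\<And>z. z \<in> quadrant - {w0} \<Longrightarrow>
      frechet_derivative Ao (at z) 1 * (Im (\<i> / (z - w0)) / (2 * pi) + frechet_derivative Qo (at z) \<i>)
      - frechet_derivative Ao (at z) \<i> * (Im (1 / (z - w0)) / (2 * pi) + frechet_derivative Qo (at z) 1)
      = (cmod (O.Taylor_deriv N' (F z)))\<^sup>2 / (cmod (deriv G (F z)))\<^sup>2"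
    using O.area_angle_coordinates[OF N'(1)] unfolding Ao_def by blast
  have Ao_le: "Ao z \<le> A0" if "z \<in> path_image \<eta> \<union> interior_domain" for z
  proof (cases "cmod (F z) = r0")
    case False
    then have "cmod (F z) < r0" using r0'[OF that] by simp
    then have "(cmod (F z))\<^sup>2 < r0\<^sup>2" by (intro power_strict_mono) auto
    then show ?thesis unfolding Ao_def A0_def using O.Taylor_area_strict_mono[OF N'(1)] by (simp add: less_imp_le)
  qed (simp add: Ao_def A0_def)
  have compAo: "compact {z \<in> quadrant. Ao z \<le> A0 + 2 + l}"
    unfolding Ao_def by (rule O.compact_area_sublevel[OF R(2,3) N'(1) A0R])
  have contAo: "continuous_on quadrant Ao" by (rule smooth_on_imp_continuous_on[OF Qo(1)])
  have openAo: "open {z \<in> quadrant. Ao z < c}" "open {z \<in> quadrant. Ao z > c}" for c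
  proof -
    have "{z \<in> quadrant. Ao z < c} = quadrant \<inter> Ao -` {..<c}" "{z \<in> quadrant. Ao z > c} = quadrant \<inter> Ao -` {c<..}" by auto
    then show "open {z \<in> quadrant. Ao z < c}" "open {z \<in> quadrant. Ao z > c}"
      using continuous_open_preimage[OF contAo open_quadrant] by simp_all
  qed
  obtain T T' where T: "smooth_on UNIV T"
    "\<And>x. (T has_real_derivative T' x) (at x)" "\<And>x. 0 \<le> T' x" "\<And>x. T' x \<le> 1 + 1"
    "\<And>x. x \<le> 0 \<Longrightarrow> T x = 0" "\<And>x. x \<ge> 1 \<Longrightarrow> T x = 1" "\<And>x. 0 \<le> T x" "\<And>x. T x \<le> 1"
    using tight_smooth_step[OF zero_less_one] by metis
  have T'1: "T' x = 0" if "x > 1" for x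
  proof -
    have "(T has_real_derivative 0) (at x)"
      by (rule has_field_derivative_transform_within_open[of "\<lambda>x. 1" _ _ "{1<..}"]) (use that T(6) in auto)
    then show ?thesis using T(2) DERIV_unique by blast
  qed

  define kin where "kin z = (if z \<in> interior_domain then p (A z / Am) else 1)" for z
  define kout where "kout z = (if z \<in> quadrant then 1 - T ((Ao z - (A0 + 2)) / l) else 0)" for z
  define \<chi>in where "\<chi>in z = (if z \<in> interior_domain then 1 - smooth_step ((A z / Am - (1 - \<kappa>p / 2)) / (\<kappa>p / 2)) else 0)" for z
  define \<chi>out where "\<chi>out z = smooth_step (Ao z - A0)" for z
  define k where "k z = kin z * kout z" for z
  \<comment> \<open>\<open>\<chi>in\<close> varies only where \<open>A\<close> is between
    \<open>(1 - \<kappa>p / 2) * Am\<close> and \<open>Am\<close>, and \<open>\<chi>out\<close> only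
    where \<open>Ao\<close> is between \<open>A0\<close> and \<open>A0 + 1\<close>. In both collars
    \<open>k\<close> is \<open>1\<close>, so the interpolation leaves no trace in the
    bracket.\<close>
  define Q where "Q z = Qm z + \<chi>in z * (Qi z - Qm z) + \<chi>out z * (Qo z - Qm z)" for z
  define E where "E z = (z - w0) * cis (2 * pi * Q z)" for z
  define V where "V = quadrant - {w0}"
  \<comment> \<open>The removed core contains \<open>w0\<close>, because \<open>A\<close> vanishes
    there; on the core \<open>k\<close> is \<open>0\<close> because \<open>p\<close> vanishes up to
    \<open>\<kappa>p\<close>.\<close>
  define C where "C = {z \<in> quadrant. Ao z \<le> A0 + 2 + l} - {z \<in> interior_domain. A z < \<kappa>p * Am}"
  have openV: "open V" unfolding V_def by (intro open_Diff open_quadrant) auto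

  have kin_smooth: "smooth_on UNIV kin"
  proof -
    \<comment> \<open>It is \<open>1 - kin\<close>, not \<open>kin\<close>, that vanishes outside a
      compact subset of the inside of the leaf, so smoothness across the leaf follows by extension
      with zero.\<close>
    have "smooth_on UNIV (\<lambda>z. 1 - kin z)"
    proof (rule smooth_on_zero_extension[of interior_domain "{z \<in> interior_domain. A z \<le> (1 - \<kappa>p) * Am}"])
      show "closed {z \<in> interior_domain. A z \<le> (1 - \<kappa>p) * Am}"
        using p(2,3) Am by (intro compact_imp_closed compA) (auto simp: algebra_simps)
      have "smooth_on interior_domain (\<lambda>z. 1 - p (A z / Am))"
        using Am by (intro smooth_intros smooth_on_compose[OF p(1)] interior_facts Qi(1)) auto
      then show "smooth_on interior_domain (\<lambda>z. 1 - kin z)"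
        by (rule smooth_on_cong[OF interior_facts(2), rotated]) (simp add: kin_def)
      show "1 - kin z = 0" if "z \<notin> {z \<in> interior_domain. A z \<le> (1 - \<kappa>p) * Am}" for z
        using that Am by (auto simp: kin_def p(8) field_simps)
    qed (use interior_facts in auto)
    from smooth_on_diff[OF open_UNIV smooth_on_const[OF open_UNIV, of 1] this] show ?thesis by simp
  qed
  have kout_smooth: "smooth_on UNIV kout"
  proof (rule smooth_on_zero_extension[OF open_quadrant compact_imp_closed[OF compAo]])
    have "smooth_on quadrant (\<lambda>z. 1 - T ((Ao z - (A0 + 2)) / l))"
      using l by (intro smooth_intros smooth_on_compose[OF T(1)] open_quadrant Qo(1)) auto
    then show "smooth_on quadrant kout"
      by (rule smooth_on_cong[OF open_quadrant, rotated]) (simp add: kout_def)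
    show "kout z = 0" if "z \<notin> {z \<in> quadrant. Ao z \<le> A0 + 2 + l}" for z
      using that l by (auto simp: kout_def T(6) le_divide_eq)
  qed auto
  have \<chi>Q_smooth: "smooth_on UNIV (\<lambda>z. \<chi>in z * (Qi z - Qm z))"
  proof (rule smooth_on_zero_extension[OF interior_facts(2) compact_imp_closed[OF compA[OF order_refl]]])
    have "smooth_on interior_domain (\<lambda>z. (1 - smooth_step ((A z / Am - (1 - \<kappa>p / 2)) / (\<kappa>p / 2))) * (Qi z - Qm z))"
      using Am p(2)
      by (intro smooth_intros smooth_on_compose[OF smooth_on_smooth_step] interior_facts Qi smooth_on_subset[OF Qm(1)]) auto
    then show "smooth_on interior_domain (\<lambda>z. \<chi>in z * (Qi z - Qm z))"
      by (rule smooth_on_cong[OF interior_facts(2), rotated]) (simp add: \<chi>in_def)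
    show "\<chi>in z * (Qi z - Qm z) = 0" if "z \<notin> {z \<in> interior_domain. A z \<le> Am}" for z
    proof (cases "z \<in> interior_domain")
      case True
      then have "A z / Am \<ge> 1" using that Am by (simp add: le_divide_eq)
      moreover have "(x - (1 - \<kappa>p / 2)) / (\<kappa>p / 2) \<ge> 1" if "x \<ge> 1" for x
        using that p(2) by (simp add: le_divide_eq)
      ultimately have "(A z / Am - (1 - \<kappa>p / 2)) / (\<kappa>p / 2) \<ge> 1" by blast
      then show ?thesis by (simp add: \<chi>in_def)
    qed (simp add: \<chi>in_def)
  qed auto
  have Q_smooth: "smooth_on quadrant Q"
    unfolding Q_def[abs_def] \<chi>out_def
    by (intro smooth_on_add smooth_on_mult smooth_on_diff smooth_on_compose[OF smooth_on_smooth_step] open_quadrant Qo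
        smooth_on_const smooth_on_subset[OF Qm(1)] smooth_on_subset[OF \<chi>Q_smooth]) auto
  have E_smooth: "smooth_on V E"
    unfolding E_def[abs_def]
    by (intro smooth_intros openV smooth_on_subset[OF Q_smooth]) (auto simp: V_def)

  have in_Q: "Q z = Qi z" "k z = p (A z / Am)" if "z \<in> interior_domain" "A z < (1 - \<kappa>p / 2) * Am" for z
  proof -
    have "Ao z \<le> A0" using Ao_le that by auto
    moreover have "(A z / Am - (1 - \<kappa>p / 2)) / (\<kappa>p / 2) \<le> 0"
    proof -
      have "A z / Am < 1 - \<kappa>p / 2" using that(2) Am(1) by (simp only: divide_less_eq if_True)
      moreover have "(x - (1 - \<kappa>p / 2)) / (\<kappa>p / 2) \<le> 0" if "x < 1 - \<kappa>p / 2" for x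
        using that p(2) by (simp add: divide_le_0_iff)
      ultimately show ?thesis by blast
    qed
    moreover have "(Ao z - (A0 + 2)) / l \<le> 0" using calculation(1) l by (simp add: divide_le_0_iff)
    ultimately show "Q z = Qi z" "k z = p (A z / Am)"
      using that interior_subset_quadrant by (auto simp: Q_def \<chi>in_def \<chi>out_def k_def kin_def kout_def T(5))
  qed
  have out_Q: "Q z = Qo z" "k z = 1 - T ((Ao z - (A0 + 2)) / l)" if "z \<in> quadrant" "Ao z > A0 + 1" for z
  proof -
    have "z \<notin> interior_domain" using Ao_le[of z] that by auto
    then show "Q z = Qo z" "k z = 1 - T ((Ao z - (A0 + 2)) / l)"
      using that by (auto simp: Q_def \<chi>in_def \<chi>out_def k_def kin_def kout_def)
  qed
  have k_bounds: "0 \<le> k z" "k z \<le> 1" for z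
    using p(9,10) T(7,8) by (auto simp: k_def kin_def kout_def intro: mult_le_one)

  have bracket: "- \<epsilon> \<le> k z * angular_bracket k E z \<and> k z * angular_bracket k E z \<le> (1 + \<epsilon>) / (2 * a)"
    if zV: "z \<in> V" for z
  proof -
    have zq: "z \<in> quadrant" "z \<noteq> w0" using zV by (auto simp: V_def)
    have ub: "0 \<le> (1 + \<epsilon>) / (2 * a)" using a_pos \<open>\<epsilon> > 0\<close> by simp
    \<comment> \<open>Three overlapping regions: inside, where \<open>k\<close> depends on
      \<open>A\<close> and the angle is the inner one; far outside, where \<open>k\<close> depends
      on \<open>Ao\<close> and the angle is the outer one; and a middle region where
      \<open>k\<close> is \<open>1\<close>.\<close>
    consider "z \<in> interior_domain" "A z < (1 - \<kappa>p / 2) * Am" | "Ao z > A0 + 1"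
      | "z \<notin> {z \<in> interior_domain. A z \<le> (1 - \<kappa>p) * Am}" "Ao z < A0 + 2"
    proof -
      assume h: "z \<in> interior_domain \<Longrightarrow> A z < (1 - \<kappa>p / 2) * Am \<Longrightarrow> thesis" "Ao z > A0 + 1 \<Longrightarrow> thesis"
        "z \<notin> {z \<in> interior_domain. A z \<le> (1 - \<kappa>p) * Am} \<Longrightarrow> Ao z < A0 + 2 \<Longrightarrow> thesis"
      have "(1 - \<kappa>p) * Am < (1 - \<kappa>p / 2) * Am" using p(2) Am by (intro mult_strict_right_mono) auto
      then show thesis using h by (cases "z \<in> interior_domain \<and> A z \<le> (1 - \<kappa>p) * Am"; cases "Ao z > A0 + 1") auto
    qed
    then show ?thesis
    proof cases
      case 1
      let ?U = "{z \<in> interior_domain. A z < (1 - \<kappa>p / 2) * Am}"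
      let ?J = "(cmod (I.Taylor_deriv N (f z)))\<^sup>2 / (cmod (deriv g (f z)))\<^sup>2"
      have dh: "((\<lambda>x. p (x / Am)) has_real_derivative p' (A z / Am) * (1 / Am)) (at (A z))"
        by (rule DERIV_chain2[OF p(4)]) (auto intro!: derivative_eq_intros simp: Am(1)[THEN less_imp_neq, THEN not_sym])
      have "angular_bracket k E z = p' (A z / Am) * (1 / Am) * ?J"
        unfolding Qi(3)[symmetric, OF DiffI[OF 1(1), of "{w0}"], simplified, OF zq(2)]
        by (rule angular_bracket_area_angle[OF openA _ zq(2) smooth_on_has_derivative[OF Qi(1) 1(1)]
            smooth_on_has_derivative[OF Qi(2) 1(1)] dh]) (use 1 in_Q in \<open>auto simp: E_def\<close>)
      then have eq: "k z * angular_bracket k E z = (p (A z / Am) * p' (A z / Am)) * (?J / Am)"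
        using in_Q(2)[OF 1] by (simp add: mult_ac)
      have "A z \<le> I.Taylor_area N (r\<^sup>2)"
      proof -
        have "(1 - \<kappa>p / 2) * Am \<le> 1 * Am" using p(2) Am by (intro mult_right_mono) auto
        then show ?thesis using 1 by (simp add: Am_def)
      qed
      then have J: "0 \<le> ?J" "?J \<le> 1 + \<delta>"
        using N(3)[OF I.norm_f_le_of_area_le[OF r(1) N(1)]] by (auto simp: A_def)
      have "(p (A z / Am) * p' (A z / Am)) * (?J / Am) \<le> (1 + \<delta>) / 2 * ((1 + \<delta>) / (a / (1 + \<delta>)))"
        using p(5,6)[of "A z / Am"] J Am a_pos \<delta> by (intro mult_mono frac_le) auto
      also have "\<dots> = (1 + \<delta>) ^ 3 / (2 * a)"
        using a_pos \<delta> by (simp add: power3_eq_cube)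
      also have "\<dots> \<le> (1 + \<epsilon>) / (2 * a)"
      proof (rule divide_right_mono)
        have "\<delta>\<^sup>2 \<le> \<delta>" "\<delta> ^ 3 \<le> \<delta>" using \<delta> by (auto simp: power2_eq_square power3_eq_cube mult_le_one intro!: mult_left_le mult_le_cancel_left1[THEN iffD2])
        then have "(1 + \<delta>) ^ 3 \<le> 1 + 7 * \<delta>" by (simp add: power3_eq_cube power2_eq_square algebra_simps)
        then show "(1 + \<delta>) ^ 3 \<le> 1 + \<epsilon>" using \<delta> by linarith
      qed (use a_pos in simp)
      finally have "k z * angular_bracket k E z \<le> (1 + \<epsilon>) / (2 * a)" unfolding eq .
      moreover have "0 \<le> k z * angular_bracket k E z"
        unfolding eq by (rule mult_nonneg_nonneg[OF p(5) divide_nonneg_nonneg[OF J(1) less_imp_le[OF Am(1)]]])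
      ultimately show ?thesis using \<open>\<epsilon> > 0\<close> by auto
    next
      case 2
      let ?U = "{z \<in> quadrant. Ao z > A0 + 1}"
      let ?J = "(cmod (O.Taylor_deriv N' (F z)))\<^sup>2 / (cmod (deriv G (F z)))\<^sup>2"
      let ?x = "(Ao z - (A0 + 2)) / l"
      have dh: "((\<lambda>x. 1 - T ((x - (A0 + 2)) / l)) has_real_derivative 0 - T' ?x * (1 / l)) (at (Ao z))"
        by (intro DERIV_diff DERIV_const DERIV_chain2[OF T(2)])
          (auto intro!: derivative_eq_intros simp: l[THEN less_imp_neq, THEN not_sym])
      have "angular_bracket k E z = (0 - T' ?x * (1 / l)) * ?J"
        unfolding Qo(3)[symmetric, OF DiffI[OF zq(1), of "{w0}"], simplified, OF zq(2)]
        by (rule angular_bracket_area_angle[OF openAo(2) _ zq(2) smooth_on_has_derivative[OF Qo(1) zq(1)]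
            smooth_on_has_derivative[OF Qo(2) zq(1)] dh]) (use 2 zq out_Q in \<open>auto simp: E_def\<close>)
      then have eq: "k z * angular_bracket k E z = - (k z * (T' ?x * ?J) / l)" by simp
      have TJ: "0 \<le> T' ?x * ?J" "T' ?x * ?J \<le> 2 * 2"
      proof -
        show "0 \<le> T' ?x * ?J" using T(3) by simp
        show "T' ?x * ?J \<le> 2 * 2"
        proof (cases "?x > 1")
          case False
          \<comment> \<open>Where \<open>?x \<le> 1\<close>, the value of \<open>Ao\<close> puts
            \<open>F z\<close> into the disk on which the Jacobian is controlled; where
            \<open>?x > 1\<close> the factor \<open>T' ?x\<close> vanishes.\<close>
          then have "Ao z \<le> O.Taylor_area N' (R\<^sup>2)" using l A0R by (simp add: divide_le_eq)
          then have "?J \<le> 2"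
            using N'(4)[OF O.norm_f_le_of_area_le[OF R(2) N'(1)]] by (auto simp: Ao_def)
          then show ?thesis using T(3,4)[of ?x] by (intro mult_mono) auto
        qed (simp add: T'1)
      qed
      have "k z * (T' ?x * ?J) \<le> 1 * 4"
        using TJ k_bounds[of z] by (intro mult_mono) auto
      then have "k z * (T' ?x * ?J) / l \<le> 4 / l" using l by (intro divide_right_mono) auto
      also have "4 / l = \<epsilon>" using \<open>\<epsilon> > 0\<close> by (simp add: l_def)
      finally have "- \<epsilon> \<le> k z * angular_bracket k E z" unfolding eq by simp
      moreover have "k z * angular_bracket k E z \<le> 0"
        unfolding eq neg_le_0_iff_le
        by (rule divide_nonneg_nonneg[OF mult_nonneg_nonneg[OF k_bounds(1) TJ(1)] less_imp_le[OF l]])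
      ultimately show ?thesis using ub by auto
    next
      case 3
      let ?U = "{z \<in> quadrant. Ao z < A0 + 2} - {z \<in> interior_domain. A z \<le> (1 - \<kappa>p) * Am}"
      have "closed {z \<in> interior_domain. A z \<le> (1 - \<kappa>p) * Am}"
        using p(2,3) Am by (intro compact_imp_closed compA) (auto simp: algebra_simps)
      then have "open ?U" by (intro open_Diff openAo)
      moreover have "k y = 1" if "y \<in> ?U" for y
      proof -
        have "(Ao y - (A0 + 2)) / l \<le> 0" using that l by (simp add: divide_le_0_iff)
        moreover have "y \<in> interior_domain \<Longrightarrow> 1 - \<kappa>p \<le> A y / Am" using that Am by (auto simp: le_divide_eq)
        ultimately show ?thesis using that by (auto simp: k_def kin_def kout_def T(5) p(8))
      qed
      ultimately have "angular_bracket k E z = 0"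
        using 3 zq by (intro angular_bracket_locally_const[of ?U]) auto
      then show ?thesis using ub \<open>\<epsilon> > 0\<close> by simp
    qed
  qed

  show ?thesis
  proof (rule that[of C V k E])
    show "compact C" unfolding C_def by (intro compact_diff compAo openA)
    show "C \<subseteq> V" unfolding C_def V_def using w0 Aw0 p(2) Am by auto
    show "open V" "V \<subseteq> quadrant" using openV by (auto simp: V_def)
    show "smooth_on UNIV k" unfolding k_def[abs_def] by (intro smooth_intros kin_smooth kout_smooth open_UNIV)
    show "0 \<le> k z" "k z \<le> 1" for z by (fact k_bounds)+
    show "k z = 0" if "z \<notin> C" for z
    proof (cases "z \<in> {z \<in> quadrant. Ao z \<le> A0 + 2 + l}")
      case True
      then have "z \<in> interior_domain" "A z / Am \<le> \<kappa>p" using that Am by (auto simp: C_def divide_le_eq)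
      then show ?thesis by (simp add: k_def kin_def p(7))
    next
      case False
      then have "kout z = 0" using l by (auto simp: kout_def T(6) le_divide_eq)
      then show ?thesis by (simp add: k_def)
    qed
    show "smooth_on V E" by fact
    show "E z \<noteq> 0" if "z \<in> V" for z using that by (simp add: E_def V_def)
    fix t
    have \<eta>t: "\<eta> t \<in> path_image \<eta>"
    proof -
      have "t = frac t + of_int \<lfloor>t\<rfloor>" by (simp add: frac_def)
      then have "\<eta> t = \<eta> (frac t)" using periodic_int by metis
      then show ?thesis using frac_ge_0[of t] frac_lt_1[of t] by (auto simp: path_image_def)
    qed
    have nin: "\<eta> t \<notin> interior_domain" using \<eta>t inside_no_overlap by blast
    have "Ao (\<eta> t) \<le> A0" using Ao_le \<eta>t by blast
    then have "(Ao (\<eta> t) - (A0 + 2)) / l \<le> 0" using l by (simp add: divide_le_0_iff)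
    then show "k (\<eta> t) = 1" using nin in_quadrant[of t] by (simp add: k_def kin_def kout_def T(5))
    have "Q (\<eta> t) = Qm (\<eta> t)" using nin \<open>Ao (\<eta> t) \<le> A0\<close> by (simp add: Q_def \<chi>in_def \<chi>out_def)
    then show "\<bar>Arg (E (\<eta> t) * cis (- 2 * pi * t))\<bar> \<le> \<kappa>" using Qm(2)[of t] by (simp add: E_def)
  qed (use bracket in auto)
qed

end

section \<open>Poisson brackets in polar coordinates\<close>

lemma omega_nondegenerate:
  assumes "\<And>v. omega X v = omega Y v" shows "X = Y"
proof (intro prod_eqI complex_eqI)
  show "Re (fst X) = Re (fst Y)" using assms[of "(\<i>, 0)"] by (simp add: omega_def)
  show "Im (fst X) = Im (fst Y)" using assms[of "(1, 0)"] by (simp add: omega_def)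
  show "Re (snd X) = Re (snd Y)" using assms[of "(0, \<i>)"] by (simp add: omega_def)
  show "Im (snd X) = Im (snd Y)" using assms[of "(0, 1)"] by (simp add: omega_def)
qed

lemma sgrad_eqI:
  assumes "\<And>v. omega X v = - frechet_derivative G (at x) v"
  shows "sgrad G x = X"
  unfolding sgrad_def
proof (rule the_equality)
  show "\<forall>v. omega X v = - frechet_derivative G (at x) v" using assms by blast
  show "Y = X" if "\<forall>v. omega Y v = - frechet_derivative G (at x) v" for Y
    by (rule omega_nondegenerate) (metis that assms)
qed

lemma linear_complex_pair_expand:
  fixes \<beta> :: "complex \<times> complex \<Rightarrow> real"
  assumes "linear \<beta>"
  shows "\<beta> v = Re (fst v) * \<beta> (1, 0) + Im (fst v) * \<beta> (\<i>, 0) + Re (snd v) * \<beta> (0, 1) + Im (snd v) * \<beta> (0, \<i>)"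
proof -
  have "v = Re (fst v) *\<^sub>R (1, 0) + Im (fst v) *\<^sub>R (\<i>, 0) + Re (snd v) *\<^sub>R (0, 1) + Im (snd v) *\<^sub>R (0, \<i>)"
    by (intro prod_eqI complex_eqI) auto
  then have "\<beta> v = \<beta> (Re (fst v) *\<^sub>R (1, 0) + Im (fst v) *\<^sub>R (\<i>, 0) + Re (snd v) *\<^sub>R (0, 1) + Im (snd v) *\<^sub>R (0, \<i>))"
    by (rule arg_cong)
  also have "\<dots> = Re (fst v) * \<beta> (1, 0) + Im (fst v) * \<beta> (\<i>, 0) + Re (snd v) * \<beta> (0, 1) + Im (snd v) * \<beta> (0, \<i>)"
    by (simp only: linear_add[OF assms] linear_scale[OF assms] real_scaleR_def)
  finally show ?thesis .
qed

lemma sgrad_eq: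
  assumes "G differentiable (at x)"
  defines "D \<equiv> frechet_derivative G (at x)"
  shows "sgrad G x = (Complex (- D (\<i>, 0)) (D (1, 0)), Complex (- D (0, \<i>)) (D (0, 1)))"
proof (rule sgrad_eqI)
  have lin: "linear D" unfolding D_def by (rule linear_frechet_derivative[OF assms(1)])
  show "omega (Complex (- D (\<i>, 0)) (D (1, 0)), Complex (- D (0, \<i>)) (D (0, 1))) v
    = - frechet_derivative G (at x) v" for v
    unfolding D_def[symmetric] by (subst linear_complex_pair_expand[OF lin, of v]) (simp add: omega_def algebra_simps)
qed

lemma poisson_eq:
  assumes "F differentiable (at x)" "G differentiable (at x)"
  shows "poisson F G x =
    frechet_derivative F (at x) (\<i>, 0) * frechet_derivative G (at x) (1, 0)
    - frechet_derivative F (at x) (1, 0) * frechet_derivative G (at x) (\<i>, 0)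
    + frechet_derivative F (at x) (0, \<i>) * frechet_derivative G (at x) (0, 1)
    - frechet_derivative F (at x) (0, 1) * frechet_derivative G (at x) (0, \<i>)"
  unfolding poisson_def sgrad_eq[OF assms(2)]
  by (subst linear_complex_pair_expand[OF linear_frechet_derivative[OF assms(1)]]) simp

text \<open>In polar coordinates \<open>I = |z|\<^sup>2/2\<close>, \<open>\<theta>\<close> one has \<open>dI v = Re (cnj z * v)\<close> and
  \<open>d\<theta> v = Im (v / z)\<close>, and \<open>{\<theta>, I} = 1\<close> in the present sign convention.\<close>

definition polar_form :: "complex \<times> complex \<Rightarrow> real \<Rightarrow> real \<Rightarrow> real \<Rightarrow> real \<Rightarrow> complex \<times> complex \<Rightarrow> real" where
  "polar_form z p1 p2 q1 q2 v = p1 * Re (cnj (fst z) * fst v) + p2 * Re (cnj (snd z) * snd v)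
     + q1 * Im (fst v / fst z) + q2 * Im (snd v / snd z)"

lemma poisson_polar:
  assumes z: "fst z \<noteq> 0" "snd z \<noteq> 0"
    and F: "(F has_derivative polar_form z p1 p2 q1 q2) (at z)"
    and G: "(G has_derivative polar_form z p1' p2' q1' q2') (at z)"
  shows "poisson F G z = (q1 * p1' - p1 * q1') + (q2 * p2' - p2 * q2')"
proof -
  have fd: "frechet_derivative F (at z) = polar_form z p1 p2 q1 q2"
    "frechet_derivative G (at z) = polar_form z p1' p2' q1' q2'"
    using F G by (metis frechet_derivative_at)+
  have n: "cmod w ^ 2 \<noteq> 0" if "w \<noteq> 0" for w using that by simp
  \<comment> \<open>The derivative of \<open>G\<close> in the action rotates the corresponding
    coordinate, the derivative in the angle dilates it.\<close>
  have "sgrad G z = (of_real p1' * \<i> * fst z - of_real (q1' / (cmod (fst z))\<^sup>2) * fst z,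
      of_real p2' * \<i> * snd z - of_real (q2' / (cmod (snd z))\<^sup>2) * snd z)" (is "_ = (?X1, ?X2)")
  proof (rule sgrad_eqI)
    have "Im (cnj (of_real p * \<i> * w - of_real (q / (cmod w)\<^sup>2) * w) * v) = - (p * Re (cnj w * v) + q * Im (v / w))"
      if "w \<noteq> 0" for p q v w
    proof -
      have "Im (v / w) = Im (cnj w * v) / (cmod w)\<^sup>2"
        by (simp add: complex_div_cnj[of v w] mult.commute)
      moreover have "cnj (of_real p * \<i> * w - of_real s * w) * v
          = - (of_real p * (\<i> * (cnj w * v))) - of_real s * (cnj w * v)" for s
        by (simp add: algebra_simps)
      then have "Im (cnj (of_real p * \<i> * w - of_real s * w) * v) = - (p * Re (cnj w * v)) - s * Im (cnj w * v)" for s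
        by (simp del: complex_cnj_diff complex_cnj_mult)
      ultimately show ?thesis by (simp only: times_divide_eq_left times_divide_eq_right minus_add_distrib diff_conv_add_uminus)
    qed
    from this[OF z(1)] this[OF z(2)] show "omega (?X1, ?X2) v = - frechet_derivative G (at z) v" for v
      unfolding fd polar_form_def omega_def fst_conv snd_conv by simp
  qed
  moreover have "Re (cnj w * (of_real p * \<i> * w - of_real (q / (cmod w)\<^sup>2) * w)) = - q"
    "Im ((of_real p * \<i> * w - of_real (q / (cmod w)\<^sup>2) * w) / w) = p" if "w \<noteq> 0" for p q w
  proof -
    have "cnj w * (of_real p * \<i> * w - of_real s * w) = (of_real p * \<i> - of_real s) * of_real ((cmod w)\<^sup>2)" for s
    proof -
      have "cnj w * (of_real p * \<i> * w - of_real s * w) = (of_real p * \<i> - of_real s) * (w * cnj w)"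
        by (simp add: algebra_simps)
      then show ?thesis by (simp only: complex_norm_square[symmetric] of_real_power)
    qed
    then have "Re (cnj w * (of_real p * \<i> * w - of_real s * w)) = - (s * (cmod w)\<^sup>2)" for s
      by (simp flip: of_real_power)
    moreover have "x * y / y = x" if "y \<noteq> 0" for x y :: real using that by simp
    ultimately show "Re (cnj w * (of_real p * \<i> * w - of_real (q / (cmod w)\<^sup>2) * w)) = - q"
      using n[OF that] by (metis times_divide_eq_left)
    show "Im ((of_real p * \<i> * w - of_real (q / (cmod w)\<^sup>2) * w) / w) = p"
      using that by (simp add: diff_divide_distrib)
  qed
  ultimately show ?thesis
    unfolding poisson_def fd polar_form_def using z by (simp del: of_real_divide)
qed

section \<open>Admissible pairs of functions\<close>

definition pb4_pairs where
  "pb4_pairs X0 X1 Y0 Y1 = {(F, G). smooth F \<and> smooth G \<and> compactly_supported F \<and> compactly_supported G \<and>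
       (\<forall>x\<in>X0. F x \<le> 0) \<and> (\<forall>x\<in>X1. F x \<ge> 1) \<and> (\<forall>x\<in>Y0. G x \<le> 0) \<and> (\<forall>x\<in>Y1. G x \<ge> 1)}"

text \<open>The bracket vanishes off the compact support of \<open>F\<close>. It is also bounded
  above, without which the real supremum would carry no information. The lemma bounds from below the
  set whose infimum is \<open>pb4plus\<close>, so that a single pair yields an upper
  estimate.\<close>

lemma SUP_poisson_nonneg:
  assumes "smooth F" "smooth G" "compactly_supported F"
  shows "0 \<le> (SUP x. poisson F G x)"
proof -
  define S where "S = closure {x. F x \<noteq> 0}"
  have S: "compact S" using assms by (simp add: S_def compactly_supported_def)
  have sm: "smooth_on UNIV F" "smooth_on UNIV G" using assms by (simp_all add: smooth_iff_smooth_on_UNIV)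
  have diff: "F differentiable (at x)" "G differentiable (at x)" for x
    using smooth_on_has_derivative[OF sm(1)] smooth_on_has_derivative[OF sm(2)] unfolding differentiable_def by blast+
  have cont: "continuous_on UNIV (poisson F G)"
    unfolding poisson_eq[OF diff, abs_def]
    by (intro continuous_intros smooth_on_imp_continuous_on smooth_on_frechet_derivative sm)
  have zero: "poisson F G x = 0" if "x \<notin> S" for x
  proof -
    have o: "open (- S)" "x \<in> - S" using that S compact_imp_closed by auto
    have "F y = 0" if "y \<in> - S" for y using that closure_subset[of "{x. F x \<noteq> 0}"] unfolding S_def by blast
    then have "(F has_derivative (\<lambda>v. 0)) (at x)"
      by (intro has_derivative_transform_within_open[OF has_derivative_const[of 0] o]) simp
    then have "frechet_derivative F (at x) = (\<lambda>v. 0)" by (metis frechet_derivative_at)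
    then show ?thesis by (simp add: poisson_def)
  qed
  have "bounded (poisson F G ` S)"
    using S cont by (intro compact_imp_bounded compact_continuous_image continuous_on_subset[OF cont]) auto
  then obtain b where b: "\<And>x. x \<in> S \<Longrightarrow> \<bar>poisson F G x\<bar> \<le> b" by (auto simp: bounded_iff)
  have "poisson F G x \<le> max b 0" for x using b[of x] zero[of x] by (cases "x \<in> S") auto
  then have bdd: "bdd_above (range (poisson F G))" by (intro bdd_aboveI[of _ "max b 0"]) auto
  have "S \<noteq> UNIV" using S compact_imp_bounded not_bounded_UNIV by metis
  then obtain x where "x \<notin> S" by auto
  then have "poisson F G x = 0" by (rule zero)
  then show ?thesis using cSUP_upper[OF UNIV_I bdd, of x] by simp
qed

lemma pb4plus_eq: "pb4plus X0 X1 Y0 Y1 = Inf ((\<lambda>(F, G). SUP x. poisson F G x) ` pb4_pairs X0 X1 Y0 Y1)"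
  unfolding pb4plus_def pb4_pairs_def by (rule arg_cong[where f = Inf]) auto

lemma pb4plus_le:
  assumes "(F, G) \<in> pb4_pairs X0 X1 Y0 Y1" "\<And>x. poisson F G x \<le> b"
  shows "pb4plus X0 X1 Y0 Y1 \<le> b"
proof -
  have "pb4plus X0 X1 Y0 Y1 \<le> (SUP x. poisson F G x)"
    unfolding pb4plus_eq
  proof (rule cInf_lower)
    show "bdd_below ((\<lambda>(F, G). SUP x. poisson F G x) ` pb4_pairs X0 X1 Y0 Y1)"
      using SUP_poisson_nonneg by (intro bdd_belowI[of _ 0]) (auto simp: pb4_pairs_def)
  qed (use assms in \<open>auto intro: rev_image_eqI\<close>)
  also have "\<dots> \<le> b" by (rule cSUP_least) (use assms in auto)
  finally show ?thesis .
qed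

text \<open>The real infimum of the empty set is an unspecified value, so an admissible pair must be
  exhibited first.\<close>

lemma pb4plus_nonneg:
  assumes "pb4_pairs X0 X1 Y0 Y1 \<noteq> {}" shows "0 \<le> pb4plus X0 X1 Y0 Y1"
  unfolding pb4plus_eq
  by (rule cInf_greatest) (use assms SUP_poisson_nonneg in \<open>auto simp: pb4_pairs_def\<close>)

lemma smooth_on_power_int [smooth_intros]:
  fixes f :: "_ \<Rightarrow> complex"
  assumes "open S" "smooth_on S f" "\<And>x. x \<in> S \<Longrightarrow> f x \<noteq> 0"
  shows "smooth_on S (\<lambda>x. f x powi n)"
  by (rule smooth_on_compose[of "- {0}" "\<lambda>u. u powi n"])
    (use assms in \<open>auto intro!: smooth_on_holomorphic holomorphic_intros\<close>)

lemma has_derivative_log_power_int: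
  assumes "(f has_derivative f') (at x)" "(f x :: complex) \<noteq> 0"
  shows "((\<lambda>x. f x powi n) has_derivative (\<lambda>v. f x powi n * (of_int n * (f' v / f x)))) (at x)"
proof -
  have "((\<lambda>u. u powi n) has_field_derivative of_int n * f x powi (n - 1)) (at (f x))"
    using assms(2) by (auto intro!: derivative_eq_intros)
  from has_derivative_compose[OF assms(1) this[unfolded has_field_derivative_def]]
  show ?thesis using assms(2) by (simp add: power_int_diff mult_ac)
qed

text \<open>Symplectic coordinates near the torus: \<open>c\<close> and \<open>s = arg (phase) / 2 pi\<close> are conjugate, and
  \<open>plane_part\<close> is the Chekanov plane coordinate. The shear by \<open>K c\<^sup>2\<close> makes room
  for arbitrarily large \<open>|c|\<close> while keeping \<open>plane_part\<close> in a fixed compact subset of the quadrant.\<close>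

definition moment :: "complex \<times> complex \<Rightarrow> real" where
  "moment z = pi * ((cmod (fst z))\<^sup>2 - (cmod (snd z))\<^sup>2)"

definition sheared_radius :: "real \<Rightarrow> complex \<times> complex \<Rightarrow> real" where
  "sheared_radius K z = ((cmod (fst z))\<^sup>2 + (cmod (snd z))\<^sup>2) / 2 - K * (moment z)\<^sup>2"

definition total_angle :: "complex \<times> complex \<Rightarrow> real" where
  "total_angle z = Im (Ln (fst z * snd z))"

definition chart_domain :: "real \<Rightarrow> (complex \<times> complex) set" where
  "chart_domain K = {z. Im (fst z * snd z) > 0 \<and> sheared_radius K z > 0}"

definition plane_part :: "real \<Rightarrow> complex \<times> complex \<Rightarrow> complex" where
  "plane_part K z = of_real (sqrt (2 * sheared_radius K z)) * exp (\<i> * of_real (total_angle z / 2))"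

text \<open>For \<open>K = 0\<close> the argument is half the difference of the two angles. The term
  with \<open>K\<close> adds \<open>K\<close> times \<open>moment\<close> times
  \<open>total_angle\<close> to \<open>s\<close>; its contribution to \<open>dc \<and> ds\<close>
  cancels the one of the shear to the area form of \<open>plane_part\<close>, so the chart stays
  symplectic.\<close>

definition phase :: "real \<Rightarrow> complex \<times> complex \<Rightarrow> complex" where
  "phase K z = fst z * exp (\<i> * of_real (2 * pi * K * moment z * total_angle z - total_angle z / 2))"

lemma smooth_on_moment: "open S \<Longrightarrow> smooth_on S moment"
  unfolding moment_def[abs_def] by (intro smooth_intros smooth_on_cmod_square)

lemma smooth_on_sheared_radius: "open S \<Longrightarrow> smooth_on S (sheared_radius K)"
  unfolding sheared_radius_def[abs_def]
  by (intro smooth_on_diff smooth_on_divide_real smooth_on_add smooth_on_mult smooth_on_const smooth_on_power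
      smooth_on_moment smooth_on_cmod_square smooth_on_fst smooth_on_snd smooth_on_id) auto

lemma open_chart_domain: "open (chart_domain K)"
proof -
  have "continuous_on UNIV (sheared_radius K)"
    by (intro smooth_on_imp_continuous_on smooth_on_sheared_radius open_UNIV)
  then have "open {z. sheared_radius K z > 0}" by (intro open_Collect_less continuous_intros)
  moreover have "open {z::complex \<times> complex. Im (fst z * snd z) > 0}"
    by (intro open_Collect_less continuous_intros)
  ultimately have "open ({z. Im (fst z * snd z) > 0} \<inter> {z. sheared_radius K z > 0})" by blast
  then show ?thesis unfolding chart_domain_def by (simp add: Collect_conj_eq)
qed

lemma not_nonpos_of_Im_pos: "Im w > 0 \<Longrightarrow> w \<notin> \<real>\<^sub>\<le>\<^sub>0"
  by (auto simp: complex_nonpos_Reals_iff)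

lemma smooth_on_total_angle: "open S \<Longrightarrow> S \<subseteq> chart_domain K \<Longrightarrow> smooth_on S total_angle"
  unfolding total_angle_def[abs_def]
  by (intro smooth_intros not_nonpos_of_Im_pos) (auto simp: chart_domain_def)

lemma smooth_on_plane_part: "open S \<Longrightarrow> S \<subseteq> chart_domain K \<Longrightarrow> smooth_on S (plane_part K)"
  unfolding plane_part_def[abs_def]
  by (intro smooth_on_mult smooth_on_of_real smooth_on_sqrt smooth_on_exp smooth_on_divide_real
      smooth_on_const smooth_on_sheared_radius smooth_on_total_angle) (auto simp: chart_domain_def)

lemma smooth_on_phase: "open S \<Longrightarrow> S \<subseteq> chart_domain K \<Longrightarrow> smooth_on S (phase K)"
  unfolding phase_def[abs_def]
  by (intro smooth_on_mult smooth_on_of_real smooth_on_exp smooth_on_divide_real smooth_on_diff smooth_on_fst smooth_on_id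
      smooth_on_const smooth_on_moment smooth_on_total_angle) auto

lemma phase_nonzero: "z \<in> chart_domain K \<Longrightarrow> phase K z \<noteq> 0"
  by (auto simp: phase_def chart_domain_def)

lemma polar_form_scale: "x * polar_form z a b c d v = polar_form z (x * a) (x * b) (x * c) (x * d) v"
  by (simp add: polar_form_def algebra_simps)

lemma has_derivative_cmod_square:
  "((\<lambda>w. (cmod w)\<^sup>2) has_derivative (\<lambda>v. 2 * Re (cnj w * v))) (at w)"
  unfolding cmod_power2 by (auto intro!: derivative_eq_intros simp: algebra_simps)

lemma has_derivative_moment:
  "(moment has_derivative polar_form z (2 * pi) (- 2 * pi) 0 0) (at z)"
proof -
  have "(moment has_derivative (\<lambda>v. pi * (2 * Re (cnj (fst z) * fst v) - 2 * Re (cnj (snd z) * snd v)))) (at z)"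
    unfolding moment_def[abs_def]
    by (intro has_derivative_mult_right has_derivative_diff has_derivative_compose[OF _ has_derivative_cmod_square]
        has_derivative_fst has_derivative_snd has_derivative_ident)
  moreover have "(\<lambda>v. pi * (2 * Re (cnj (fst z) * fst v) - 2 * Re (cnj (snd z) * snd v))) = polar_form z (2 * pi) (- 2 * pi) 0 0"
    by (intro ext) (simp add: polar_form_def algebra_simps)
  ultimately show ?thesis by simp
qed

lemma has_derivative_sheared_radius:
  "(sheared_radius K has_derivative polar_form z (1 - 4 * pi * K * moment z) (1 + 4 * pi * K * moment z) 0 0) (at z)"
proof -
  have "(sheared_radius K has_derivative (\<lambda>v. (2 * Re (cnj (fst z) * fst v) + 2 * Re (cnj (snd z) * snd v)) / 2
      - K * (of_nat 2 * polar_form z (2 * pi) (- 2 * pi) 0 0 v * moment z ^ (2 - 1)))) (at z)"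
    unfolding sheared_radius_def[abs_def]
    by (intro has_derivative_mult_right has_derivative_diff has_derivative_add has_derivative_power
        bounded_linear.has_derivative[OF bounded_linear_divide]
        has_derivative_compose[OF _ has_derivative_cmod_square] has_derivative_moment
        has_derivative_fst has_derivative_snd has_derivative_ident)
  moreover have "(\<lambda>v. (2 * Re (cnj (fst z) * fst v) + 2 * Re (cnj (snd z) * snd v)) / 2
      - K * (of_nat 2 * polar_form z (2 * pi) (- 2 * pi) 0 0 v * moment z ^ (2 - 1)))
    = polar_form z (1 - 4 * pi * K * moment z) (1 + 4 * pi * K * moment z) 0 0"
    by (intro ext) (simp add: polar_form_def algebra_simps)
  ultimately show ?thesis by simp
qed

lemma has_derivative_total_angle:
  assumes "Im (fst z * snd z) > 0"
  shows "(total_angle has_derivative polar_form z 0 0 1 1) (at z)"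
proof -
  have nz: "fst z \<noteq> 0" "snd z \<noteq> 0" using assms by auto
  have "((\<lambda>z. fst z * snd z) has_derivative (\<lambda>v. fst z * snd v + fst v * snd z)) (at z)"
    by (intro has_derivative_mult has_derivative_fst has_derivative_snd has_derivative_ident)
  from has_derivative_compose[OF this has_field_derivative_Ln[OF not_nonpos_of_Im_pos[OF assms], unfolded has_field_derivative_def]]
  have "(total_angle has_derivative (\<lambda>v. Im (inverse (fst z * snd z) * (fst z * snd v + fst v * snd z)))) (at z)"
    unfolding total_angle_def[abs_def] by (rule has_derivative_Im)
  moreover have "inverse (fst z * snd z) * (fst z * snd v + fst v * snd z) = fst v / fst z + snd v / snd z" for v
    using nz by (simp add: field_simps)
  then have "(\<lambda>v. Im (inverse (fst z * snd z) * (fst z * snd v + fst v * snd z))) = polar_form z 0 0 1 1"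
    by (intro ext) (simp add: polar_form_def)
  ultimately show ?thesis by simp
qed

lemma has_derivative_exp_i:
  assumes "(f has_derivative f') (at x)"
  shows "((\<lambda>x. exp (\<i> * complex_of_real (f x))) has_derivative
    (\<lambda>v. exp (\<i> * complex_of_real (f x)) * (\<i> * of_real (f' v)))) (at x)"
  using has_derivative_compose[OF has_derivative_mult_right[OF has_derivative_of_real[OF assms], of \<i>] DERIV_exp[unfolded has_field_derivative_def]]
  by simp

lemma has_derivative_plane_part:
  assumes z: "z \<in> chart_domain K"
  defines "\<rho> \<equiv> sheared_radius K z" and "c \<equiv> 4 * pi * K * moment z"
  shows "(plane_part K has_derivative (\<lambda>v. plane_part K z *
    (of_real (polar_form z ((1 - c) / (2 * \<rho>)) ((1 + c) / (2 * \<rho>)) 0 0 v) + \<i> * of_real (polar_form z 0 0 (1/2) (1/2) v)))) (at z)"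
proof -
  have \<rho>: "\<rho> > 0" and im: "Im (fst z * snd z) > 0" using z by (auto simp: chart_domain_def \<rho>_def)
  let ?d\<rho> = "polar_form z (1 - c) (1 + c) 0 0"
  have d1: "(sheared_radius K has_derivative ?d\<rho>) (at z)" unfolding c_def by (rule has_derivative_sheared_radius)
  have "((\<lambda>z. sqrt (2 * sheared_radius K z)) has_derivative (\<lambda>v. inverse (sqrt (2 * \<rho>)) / 2 * (2 * ?d\<rho> v))) (at z)"
    using has_derivative_compose[OF has_derivative_mult_right[OF d1, of 2] DERIV_real_sqrt[unfolded has_field_derivative_def]] \<rho>
    by (simp add: \<rho>_def)
  moreover have "inverse (sqrt (2 * \<rho>)) = sqrt (2 * \<rho>) / (2 * \<rho>)"
    using \<rho> by (simp add: field_simps)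
  then have "inverse (sqrt (2 * \<rho>)) / 2 * (2 * ?d\<rho> v) = sqrt (2 * \<rho>) * (1 / (2 * \<rho>) * ?d\<rho> v)" for v by simp
  ultimately have d2: "((\<lambda>z. sqrt (2 * sheared_radius K z)) has_derivative
      (\<lambda>v. sqrt (2 * \<rho>) * polar_form z ((1 - c) / (2 * \<rho>)) ((1 + c) / (2 * \<rho>)) 0 0 v)) (at z)"
    unfolding polar_form_scale by simp
  have "((\<lambda>z. total_angle z / 2) has_derivative (\<lambda>v. polar_form z 0 0 1 1 v / 2)) (at z)"
    by (intro bounded_linear.has_derivative[OF bounded_linear_divide] has_derivative_total_angle im)
  moreover have "polar_form z 0 0 1 1 v / 2 = polar_form z 0 0 (1/2) (1/2) v" for v by (simp add: polar_form_def)
  ultimately have d3: "((\<lambda>z. total_angle z / 2) has_derivative polar_form z 0 0 (1/2) (1/2)) (at z)" by simp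
  have "(plane_part K has_derivative (\<lambda>v.
      of_real (sqrt (2 * \<rho>)) * (exp (\<i> * of_real (total_angle z / 2)) * (\<i> * of_real (polar_form z 0 0 (1/2) (1/2) v)))
      + of_real (sqrt (2 * \<rho>) * polar_form z ((1 - c) / (2 * \<rho>)) ((1 + c) / (2 * \<rho>)) 0 0 v) * exp (\<i> * of_real (total_angle z / 2)))) (at z)"
    unfolding plane_part_def[abs_def] \<rho>_def
    by (intro has_derivative_mult has_derivative_of_real d2[unfolded \<rho>_def] has_derivative_exp_i d3)
  moreover have "of_real (sqrt (2 * \<rho>)) * (e * (\<i> * of_real y)) + of_real (sqrt (2 * \<rho>) * x) * e
    = of_real (sqrt (2 * \<rho>)) * e * (of_real x + \<i> * of_real y)" for x y e
    by (simp add: algebra_simps)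
  ultimately show ?thesis by (simp only: plane_part_def \<rho>_def)
qed

lemma has_derivative_phase:
  assumes z: "z \<in> chart_domain K"
  defines "c \<equiv> 4 * pi * K * moment z" and "e \<equiv> 4 * pi\<^sup>2 * K * total_angle z"
  obtains D where "(phase K has_derivative D) (at z)"
    "\<And>v. Im (D v / phase K z) = polar_form z e (- e) ((1 + c) / 2) ((c - 1) / 2) v"
proof -
  have im: "Im (fst z * snd z) > 0" using z by (auto simp: chart_domain_def)
  then have nz: "fst z \<noteq> 0" by auto
  let ?\<theta> = "\<lambda>z. 2 * pi * K * moment z * total_angle z - total_angle z / 2"
  define \<theta>' where "\<theta>' v = 2 * pi * K * moment z * polar_form z 0 0 1 1 v + 2 * pi * K * polar_form z (2 * pi) (- 2 * pi) 0 0 v * total_angle z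
      - polar_form z 0 0 1 1 v / 2" for v
  have "(?\<theta> has_derivative \<theta>') (at z)"
    unfolding \<theta>'_def
    by (intro has_derivative_diff has_derivative_mult has_derivative_mult_right has_derivative_moment
        bounded_linear.has_derivative[OF bounded_linear_divide] has_derivative_total_angle im)
  from has_derivative_exp_i[OF this]
  have "(phase K has_derivative (\<lambda>v. fst z * (exp (\<i> * of_real (?\<theta> z)) * (\<i> * of_real (\<theta>' v))) + fst v * exp (\<i> * of_real (?\<theta> z)))) (at z)"
    unfolding phase_def[abs_def] by (intro has_derivative_mult has_derivative_fst has_derivative_ident)
  moreover have "Im ((fst z * (E * (\<i> * of_real y)) + u * E) / (fst z * E)) = y + Im (u / fst z)" if "E \<noteq> 0" for E u y
    using that nz by (simp add: add_divide_distrib)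
  then have "Im ((fst z * (exp (\<i> * of_real (?\<theta> z)) * (\<i> * of_real (\<theta>' v))) + fst v * exp (\<i> * of_real (?\<theta> z))) / phase K z)
    = \<theta>' v + Im (fst v / fst z)" for v
    unfolding phase_def by simp
  moreover have "\<theta>' v + Im (fst v / fst z) = polar_form z e (- e) ((1 + c) / 2) ((c - 1) / 2) v" for v
    unfolding \<theta>'_def polar_form_def c_def e_def by (simp add: power2_eq_square field_simps)
  ultimately show ?thesis by (intro that) (assumption, simp only:)
qed

text \<open>The shear in \<open>plane_part\<close> contributes nothing to the bracket.\<close>

lemma poisson_lift:
  fixes k \<xi> :: "_ \<Rightarrow> real" and P1 P2 :: "complex \<Rightarrow> real" and m n :: int
  assumes z: "z \<in> chart_domain K" and E0: "E (plane_part K z) \<noteq> 0"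
    and dk: "(k has_derivative k') (at (plane_part K z))"
    and dE: "(E has_derivative E') (at (plane_part K z))"
    and d\<xi>: "(\<xi> has_real_derivative \<xi>') (at (moment z))"
    and dP1: "\<And>u. u \<noteq> 0 \<Longrightarrow> (P1 has_derivative (\<lambda>v. P1' u * Im (v / u))) (at u)"
    and dP2: "\<And>u. u \<noteq> 0 \<Longrightarrow> (P2 has_derivative (\<lambda>v. P2' u * Im (v / u))) (at u)"
  defines "h \<equiv> \<lambda>z. k (plane_part K z) * \<xi> (moment z)"
    and "W \<equiv> \<lambda>z. E (plane_part K z) powi m * phase K z powi n"
  assumes U: "open U" "z \<in> U" and F: "\<And>y. y \<in> U \<Longrightarrow> F y = C1 + h y * P1 (W y)"
    and G: "\<And>y. y \<in> U \<Longrightarrow> G y = C2 + h y * P2 (W y)"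
  shows "poisson F G z = 2 * pi * (P1' (W z) * P2 (W z) - P1 (W z) * P2' (W z)) *
    (m * (\<xi> (moment z))\<^sup>2 * (k (plane_part K z) * angular_bracket k E (plane_part K z))
      + n * (k (plane_part K z))\<^sup>2 * (\<xi> (moment z) * \<xi>'))"
proof -
  define Y where "Y = plane_part K z"
  define \<rho> where "\<rho> = sheared_radius K z"
  define c where "c = 4 * pi * K * moment z"
  define e where "e = 4 * pi\<^sup>2 * K * total_angle z"
  define x where "x = \<xi> (moment z)"
  have \<rho>: "\<rho> > 0" and im: "Im (fst z * snd z) > 0" using z by (auto simp: chart_domain_def \<rho>_def)
  have nz: "fst z \<noteq> 0" "snd z \<noteq> 0" using im by auto
  let ?R = "polar_form z ((1 - c) / (2 * \<rho>)) ((1 + c) / (2 * \<rho>)) 0 0" and ?A = "polar_form z 0 0 (1/2) (1/2)"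
  have dY: "(plane_part K has_derivative (\<lambda>v. Y * (of_real (?R v) + \<i> * of_real (?A v)))) (at z)"
    using has_derivative_plane_part[OF z] unfolding Y_def \<rho>_def c_def .
  obtain D where D: "(phase K has_derivative D) (at z)"
    "\<And>v. Im (D v / phase K z) = polar_form z e (- e) ((1 + c) / 2) ((c - 1) / 2) v"
    using has_derivative_phase[OF z] unfolding c_def e_def by blast
  have lin: "L (Y * (of_real a + \<i> * of_real b)) = a * L Y + b * L (\<i> * Y)" if "linear L" for L :: "complex \<Rightarrow> real" and a b
  proof -
    have "Y * (of_real a + \<i> * of_real b) = a *\<^sub>R Y + b *\<^sub>R (\<i> * Y)" by (simp add: scaleR_conv_of_real algebra_simps)
    then show ?thesis by (simp only: linear_add[OF that] linear_scale[OF that] real_scaleR_def)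
  qed
  have lk: "linear k'" using dk has_derivative_linear by blast
  have lE': "linear E'" using dE has_derivative_linear by blast
  define \<beta> where "\<beta> u = Im (E' u / E Y)" for u
  have l\<beta>: "linear \<beta>"
  proof -
    have "linear (\<lambda>u. Im (u / E Y))"
      by (intro linearI) (simp_all add: add_divide_distrib scaleR_conv_of_real mult.assoc
          times_divide_eq_right[symmetric] del: times_divide_eq_right)
    from linear_compose[OF lE' this] show ?thesis by (simp add: \<beta>_def[abs_def] o_def)
  qed
  define p1 where "p1 = x * k' Y * (1 - c) / (2 * \<rho>) + k Y * \<xi>' * (2 * pi)"
  define p2 where "p2 = x * k' Y * (1 + c) / (2 * \<rho>) - k Y * \<xi>' * (2 * pi)"
  define q where "q = x * k' (\<i> * Y) / 2"
  define r1 where "r1 = m * \<beta> Y * (1 - c) / (2 * \<rho>) + n * e"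
  define r2 where "r2 = m * \<beta> Y * (1 + c) / (2 * \<rho>) - n * e"
  define s1 where "s1 = m * \<beta> (\<i> * Y) / 2 + n * ((1 + c) / 2)"
  define s2 where "s2 = m * \<beta> (\<i> * Y) / 2 + n * ((c - 1) / 2)"
  have dh: "(h has_derivative polar_form z p1 p2 q q) (at z)"
  proof -
    have "((\<lambda>z. k (plane_part K z)) has_derivative (\<lambda>v. k' (Y * (of_real (?R v) + \<i> * of_real (?A v))))) (at z)"
      using has_derivative_compose[OF dY dk] .
    moreover have "((\<lambda>z. \<xi> (moment z)) has_derivative (\<lambda>v. \<xi>' * polar_form z (2 * pi) (- 2 * pi) 0 0 v)) (at z)"
      using has_derivative_compose[OF has_derivative_moment d\<xi>[unfolded has_field_derivative_def]] .
    ultimately have "(h has_derivative (\<lambda>v. k Y * (\<xi>' * polar_form z (2 * pi) (- 2 * pi) 0 0 v)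
        + k' (Y * (of_real (?R v) + \<i> * of_real (?A v))) * x)) (at z)"
      unfolding h_def x_def Y_def by (rule has_derivative_mult)
    moreover have "(\<lambda>v. k Y * (\<xi>' * polar_form z (2 * pi) (- 2 * pi) 0 0 v)
        + k' (Y * (of_real (?R v) + \<i> * of_real (?A v))) * x) = polar_form z p1 p2 q q"
      unfolding lin[OF lk] p1_def p2_def q_def polar_form_def by (intro ext) (simp add: algebra_simps add_divide_distrib diff_divide_distrib)
    ultimately show ?thesis by simp
  qed
  have W0: "W z \<noteq> 0" using E0 phase_nonzero[OF z] by (simp add: W_def)
  obtain W' where W': "(W has_derivative W') (at z)" "\<And>v. Im (W' v / W z) = polar_form z r1 r2 s1 s2 v"
  proof -
    define W' where "W' v = E Y powi m * (phase K z powi n * (of_int n * (D v / phase K z)))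
      + E Y powi m * (of_int m * (E' (Y * (of_real (?R v) + \<i> * of_real (?A v))) / E Y)) * phase K z powi n" for v
    have "((\<lambda>z. E (plane_part K z)) has_derivative (\<lambda>v. E' (Y * (of_real (?R v) + \<i> * of_real (?A v))))) (at z)"
      using has_derivative_compose[OF dY dE] .
    then have dW: "(W has_derivative W') (at z)"
      unfolding W_def W'_def Y_def
      by (intro has_derivative_mult has_derivative_log_power_int D(1) E0 phase_nonzero[OF z])
    have Wr: "W' v / W z = of_int n * (D v / phase K z) + of_int m * (E' (Y * (of_real (?R v) + \<i> * of_real (?A v))) / E Y)" for v
    proof -
      have "(A * (B * y) + A * x * B) / (A * B) = y + x" if "A \<noteq> 0" "B \<noteq> 0" for A B x y :: complex
        using that by (simp add: field_simps)
      moreover have "E Y powi m \<noteq> 0" "phase K z powi n \<noteq> 0" using W0 by (auto simp: W_def Y_def)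
      ultimately show ?thesis unfolding W'_def W_def Y_def[symmetric] by blast
    qed
    have "Im (W' v / W z) = n * Im (D v / phase K z) + m * \<beta> (Y * (of_real (?R v) + \<i> * of_real (?A v)))" for v
    proof -
      have "Im (of_int j * X) = j * Im X" for j :: int and X by simp
      then show ?thesis unfolding \<beta>_def Wr by (simp only: plus_complex.sel)
    qed
    then have "Im (W' v / W z) = polar_form z r1 r2 s1 s2 v" for v
      unfolding D(2) lin[OF l\<beta>] r1_def r2_def s1_def s2_def polar_form_def
      by (simp add: algebra_simps add_divide_distrib diff_divide_distrib)
    then show ?thesis using that dW by blast
  qed
  let ?H = "h z"
  have dF: "(f has_derivative polar_form z (p1 * P (W z) + ?H * Pd * r1) (p2 * P (W z) + ?H * Pd * r2)
      (q * P (W z) + ?H * Pd * s1) (q * P (W z) + ?H * Pd * s2)) (at z)"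
    if dP: "(P has_derivative (\<lambda>v. Pd * Im (v / W z))) (at (W z))" and f: "\<And>y. y \<in> U \<Longrightarrow> f y = C + h y * P (W y)"
    for f P Pd C
  proof -
    have "((\<lambda>z. P (W z)) has_derivative (\<lambda>v. Pd * Im (W' v / W z))) (at z)"
      using has_derivative_compose[OF W'(1) dP] .
    then have "((\<lambda>z. C + h z * P (W z)) has_derivative (\<lambda>v. 0 + (?H * (Pd * polar_form z r1 r2 s1 s2 v) + polar_form z p1 p2 q q v * P (W z)))) (at z)"
      unfolding W'(2) by (intro has_derivative_add has_derivative_const has_derivative_mult dh)
    moreover have "(\<lambda>v. 0 + (?H * (Pd * polar_form z r1 r2 s1 s2 v) + polar_form z p1 p2 q q v * P (W z)))
      = polar_form z (p1 * P (W z) + ?H * Pd * r1) (p2 * P (W z) + ?H * Pd * r2)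
      (q * P (W z) + ?H * Pd * s1) (q * P (W z) + ?H * Pd * s2)"
      by (intro ext) (simp add: polar_form_def algebra_simps)
    ultimately have "((\<lambda>z. C + h z * P (W z)) has_derivative polar_form z (p1 * P (W z) + ?H * Pd * r1) (p2 * P (W z) + ?H * Pd * r2)
      (q * P (W z) + ?H * Pd * s1) (q * P (W z) + ?H * Pd * s2)) (at z)" by simp
    then show ?thesis
      by (rule has_derivative_transform_within_open[OF _ U]) (simp add: f)
  qed
  \<comment> \<open>\<open>B\<close> is the bracket of \<open>h\<close> with the argument of
    \<open>W\<close>. The functions \<open>P1\<close> and \<open>P2\<close> of \<open>W\<close>
    commute with each other, since both depend on that argument alone, and \<open>h\<close> commutes
    with itself, so only mixed terms remain.\<close>
  define B where "B = (q * r1 - p1 * s1) + (q * r2 - p2 * s2)"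
  have "poisson F G z = ?H * (P1 (W z) * P2' (W z) - P2 (W z) * P1' (W z)) * B"
  proof -
    have F': "(F has_derivative polar_form z (p1 * P1 (W z) + ?H * P1' (W z) * r1) (p2 * P1 (W z) + ?H * P1' (W z) * r2)
      (q * P1 (W z) + ?H * P1' (W z) * s1) (q * P1 (W z) + ?H * P1' (W z) * s2)) (at z)"
      by (rule dF[OF dP1[OF W0]]) (rule F)
    have G': "(G has_derivative polar_form z (p1 * P2 (W z) + ?H * P2' (W z) * r1) (p2 * P2 (W z) + ?H * P2' (W z) * r2)
      (q * P2 (W z) + ?H * P2' (W z) * s1) (q * P2 (W z) + ?H * P2' (W z) * s2)) (at z)"
      by (rule dF[OF dP2[OF W0]]) (rule G)
    show ?thesis unfolding poisson_polar[OF nz F' G'] B_def by (simp add: algebra_simps)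
  qed
  also have "B = x * m * (k' (\<i> * Y) * \<beta> Y - k' Y * \<beta> (\<i> * Y)) / (2 * \<rho>) - 2 * pi * n * k Y * \<xi>'"
    unfolding B_def p1_def p2_def q_def r1_def r2_def s1_def s2_def using \<rho>
    by (simp add: field_simps)
  also have "k' (\<i> * Y) * \<beta> Y - k' Y * \<beta> (\<i> * Y) = - (2 * \<rho> * (2 * pi * angular_bracket k E Y))"
  proof -
    have "k' Y * \<beta> (\<i> * Y) - k' (\<i> * Y) * \<beta> Y = (cmod Y)\<^sup>2 * (k' 1 * \<beta> \<i> - k' \<i> * \<beta> 1)"
      by (rule linear_complex_det[OF lk l\<beta>])
    moreover have "(cmod Y)\<^sup>2 = 2 * \<rho>" using \<rho> by (simp add: Y_def plane_part_def norm_mult \<rho>_def)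
    moreover have "k' 1 * \<beta> \<i> - k' \<i> * \<beta> 1 = 2 * pi * angular_bracket k E Y"
    proof -
      have "frechet_derivative k (at Y) = k'" "frechet_derivative E (at Y) = E'"
        using dk dE unfolding Y_def by (metis frechet_derivative_at)+
      then show ?thesis by (simp add: angular_bracket_def \<beta>_def)
    qed
    ultimately show ?thesis by simp
  qed
  also have "x * m * (- (2 * \<rho> * (2 * pi * angular_bracket k E Y))) / (2 * \<rho>) = - (x * m * (2 * pi * angular_bracket k E Y))"
    using \<rho> by simp
  also have "?H = k Y * x" by (simp add: h_def Y_def x_def)
  finally show ?thesis unfolding Y_def[symmetric] x_def[symmetric] by (simp add: power2_eq_square algebra_simps)
qed

text \<open>The small slope is paid for by a wide support, hence by large values of the moment map;
  the shear of the chart makes this affordable.\<close>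

lemma slow_cutoff:
  assumes "\<epsilon> > 0"
  obtains \<xi> \<xi>' :: "real \<Rightarrow> real" and b where "b > 0" "smooth_on UNIV \<xi>"
    "\<And>c. (\<xi> has_real_derivative \<xi>' c) (at c)" "\<xi> 0 = 1" "\<And>c. 0 \<le> \<xi> c" "\<And>c. \<xi> c \<le> 1"
    "\<And>c. \<bar>\<xi>' c\<bar> \<le> \<epsilon>" "\<And>c. \<bar>c\<bar> \<ge> b \<Longrightarrow> \<xi> c = 0"
proof -
  obtain T T' where T: "smooth_on UNIV T"
    "\<And>x. (T has_real_derivative T' x) (at x)" "\<And>x. 0 \<le> T' x" "\<And>x. T' x \<le> 1 + 1"
    "\<And>x. x \<le> 0 \<Longrightarrow> T x = 0" "\<And>x. x \<ge> 1 \<Longrightarrow> T x = 1" "\<And>x. 0 \<le> T x" "\<And>x. T x \<le> 1"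
    using tight_smooth_step[OF zero_less_one] by metis
  \<comment> \<open>The cutoff is \<open>1\<close> up to \<open>L\<close> and \<open>0\<close> from
    \<open>2 * L\<close> on. With steps of slope at most \<open>2\<close> the derivative is at most
    \<open>2 / L\<close>, half of \<open>\<epsilon>\<close>.\<close>
  define L where "L = 4 / \<epsilon>"
  have L: "L > 0" using assms by (simp add: L_def)
  define \<xi> where "\<xi> c = T (2 - c / L) * T (2 + c / L)" for c
  define \<xi>' where "\<xi>' c = T' (2 - c / L) * (- (1 / L)) * T (2 + c / L) + T' (2 + c / L) * (1 / L) * T (2 - c / L)" for c
  show ?thesis
  proof (rule that[of "2 * L" \<xi> \<xi>'])
    show "2 * L > 0" using L by simp
    show "smooth_on UNIV \<xi>" unfolding \<xi>_def[abs_def]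
      using L by (intro smooth_intros smooth_on_compose[OF T(1)]) auto
    show "(\<xi> has_real_derivative \<xi>' c) (at c)" for c
      unfolding \<xi>_def[abs_def] \<xi>'_def
      by (intro DERIV_mult DERIV_chain2[OF T(2)])
        (use L in \<open>auto intro!: derivative_eq_intros\<close>)
    show "\<xi> 0 = 1" by (simp add: \<xi>_def T(6))
    show "0 \<le> \<xi> c" "\<xi> c \<le> 1" for c using T(7,8) by (auto simp: \<xi>_def intro: mult_le_one)
    show "\<bar>\<xi>' c\<bar> \<le> \<epsilon>" for c
    proof -
      have b: "0 \<le> T' x * (1 / L) * T y" "T' x * (1 / L) * T y \<le> 2 * (1 / L) * 1" for x y
      proof -
        show "0 \<le> T' x * (1 / L) * T y" using T(3,7) L by simp
        show "T' x * (1 / L) * T y \<le> 2 * (1 / L) * 1" using T(3,4,7,8) L by (intro mult_mono) auto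
      qed
      have "\<xi>' c = T' (2 + c / L) * (1 / L) * T (2 - c / L) - T' (2 - c / L) * (1 / L) * T (2 + c / L)"
        by (simp add: \<xi>'_def)
      then have "\<bar>\<xi>' c\<bar> \<le> 2 * (1 / L) * 1" using b[of "2 + c / L" "2 - c / L"] b[of "2 - c / L" "2 + c / L"] by linarith
      also have "\<dots> \<le> \<epsilon>" using assms by (simp add: L_def)
      finally show ?thesis .
    qed
    show "\<xi> c = 0" if "\<bar>c\<bar> \<ge> 2 * L" for c
    proof (cases "c \<ge> 0")
      case True
      then have "2 - c / L \<le> 0" using that L by (simp add: le_divide_eq)
      then show ?thesis by (simp add: \<xi>_def T(5))
    next
      case False
      then have "2 + c / L \<le> 0" using that L by (simp add: field_simps)
      then show ?thesis by (simp add: \<xi>_def T(5))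
    qed
  qed
qed

text \<open>On the torus the moment map vanishes, so the shear is invisible. The product of the
  coordinates is half the square of \<open>\<eta> t\<close>, whose argument stays in
  \<open>(0, pi)\<close> because the leaf lies in the quadrant; halving it recovers
  \<open>\<eta> t\<close>.\<close>

lemma chart_of_chek:
  assumes w: "\<eta> t \<in> quadrant"
  shows "moment (chek \<eta> t s) = 0" "sheared_radius K (chek \<eta> t s) = (cmod (\<eta> t))\<^sup>2 / 2"
    "chek \<eta> t s \<in> chart_domain K" "plane_part K (chek \<eta> t s) = \<eta> t"
    "phase K (chek \<eta> t s) = of_real (cmod (\<eta> t) / sqrt 2) * cis (2 * pi * s)"
proof -
  let ?z = "chek \<eta> t s" and ?w = "\<eta> t"
  have w0: "?w \<noteq> 0" using w by auto
  have n: "(cmod (fst ?z))\<^sup>2 = (cmod ?w)\<^sup>2 / 2" "(cmod (snd ?z))\<^sup>2 = (cmod ?w)\<^sup>2 / 2"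
    by (simp_all add: chek_def norm_mult norm_divide power_divide)
  show m: "moment ?z = 0" by (simp add: moment_def n)
  show sr: "sheared_radius K ?z = (cmod ?w)\<^sup>2 / 2" by (simp add: sheared_radius_def m n)
  have s2: "complex_of_real (sqrt 2) * complex_of_real (sqrt 2) = 2" by (simp flip: of_real_mult)
  have cc: "cis (2 * pi * s) * cis (- 2 * pi * s) = 1" by (simp add: cis_mult)
  have "fst ?z * snd ?z = (cis (2 * pi * s) * cis (- 2 * pi * s)) * ?w\<^sup>2 / (complex_of_real (sqrt 2) * complex_of_real (sqrt 2))"
    by (simp add: chek_def power2_eq_square)
  then have pr: "fst ?z * snd ?z = ?w\<^sup>2 / 2" unfolding s2 cc by simp
  show "?z \<in> chart_domain K"
  proof -
    have "Im (fst ?z * snd ?z) > 0" unfolding pr using w by (simp add: power2_eq_square)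
    moreover have "sheared_radius K ?z > 0" unfolding sr using w0 by simp
    ultimately show ?thesis unfolding chart_domain_def by blast
  qed
  have Arg: "0 < Arg ?w" "Arg ?w < pi / 2"
  proof -
    show "0 < Arg ?w" using Arg_lt_pi[of ?w] w by auto
    show "Arg ?w < pi / 2" using w Re_Ln_pos_lt[OF w0] w0 by (auto simp: Arg_eq_Im_Ln)
  qed
  have "Ln (?w\<^sup>2 / 2) = of_real (ln ((cmod ?w)\<^sup>2 / 2)) + \<i> * of_real (2 * Arg ?w)"
  proof (rule Ln_unique)
    have "?w\<^sup>2 = (of_real (cmod ?w) * cis (Arg ?w))\<^sup>2" using rcis_cmod_Arg[of ?w] by (simp add: rcis_def)
    also have "\<dots> = of_real ((cmod ?w)\<^sup>2) * cis (2 * Arg ?w)" by (simp add: power_mult_distrib Complex.DeMoivre)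
    finally have "?w\<^sup>2 / 2 = of_real ((cmod ?w)\<^sup>2 / 2) * cis (2 * Arg ?w)" by simp
    moreover have "exp (complex_of_real (ln ((cmod ?w)\<^sup>2 / 2))) = of_real ((cmod ?w)\<^sup>2 / 2)"
      using w0 unfolding exp_of_real by simp
    ultimately show "exp (of_real (ln ((cmod ?w)\<^sup>2 / 2)) + \<i> * of_real (2 * Arg ?w)) = ?w\<^sup>2 / 2"
      by (simp only: exp_add cis_conv_exp)
  qed (use Arg in auto)
  then have ta: "total_angle ?z = 2 * Arg ?w" by (simp add: total_angle_def pr)
  have "plane_part K ?z = of_real (cmod ?w) * exp (\<i> * of_real (Arg ?w))"
    by (simp add: plane_part_def sr ta)
  also have "\<dots> = ?w" using rcis_cmod_Arg[of ?w] by (simp add: rcis_def cis_conv_exp)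
  finally show "plane_part K ?z = ?w" .
  have "phase K ?z = fst ?z * cis (- Arg ?w)" by (simp add: phase_def m ta cis_conv_exp)
  also have "\<dots> = cis (2 * pi * s) * (?w * cis (- Arg ?w)) / complex_of_real (sqrt 2)"
    by (simp add: chek_def)
  also have "?w * cis (- Arg ?w) = of_real (cmod ?w)"
  proof -
    have "?w * cis (- Arg ?w) = of_real (cmod ?w) * cis (Arg ?w) * cis (- Arg ?w)"
      using rcis_cmod_Arg[of ?w] by (simp add: rcis_def)
    then show ?thesis by (simp add: mult.assoc cis_mult)
  qed
  finally show "phase K ?z = of_real (cmod ?w / sqrt 2) * cis (2 * pi * s)" by simp
qed

lemma cis_power_int: "cis x powi n = cis (of_int n * x)"
  by (cases "n \<ge> 0") (auto simp: power_int_def Complex.DeMoivre cis_inverse)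

text \<open>Powers multiply the principal argument only while the product stays below
  \<open>pi\<close> in modulus; the positive factor has no influence on it.\<close>

lemma Arg_power_int_le:
  assumes "w \<noteq> 0" "\<bar>Arg w\<bar> \<le> \<kappa>" "\<bar>of_int m\<bar> * \<kappa> < pi" "r > 0"
  shows "\<bar>Arg (w powi m * of_real r)\<bar> \<le> \<bar>of_int m\<bar> * \<kappa>"
proof -
  have "w powi m * of_real r = (of_real (cmod w) * cis (Arg w)) powi m * of_real r"
    using rcis_cmod_Arg[of w] by (simp add: rcis_def)
  also have "\<dots> = rcis (cmod w powi m * r) (of_int m * Arg w)"
    by (simp add: power_int_mult_distrib cis_power_int rcis_def mult_ac)
  finally have eq: "w powi m * of_real r = rcis (cmod w powi m * r) (of_int m * Arg w)" .
  have le: "\<bar>of_int m * Arg w\<bar> \<le> \<bar>of_int m\<bar> * \<kappa>"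
    unfolding abs_mult using assms(2) by (intro mult_left_mono) auto
  have "Arg (rcis (cmod w powi m * r) (of_int m * Arg w)) = of_int m * Arg w"
    using le assms by (intro Arg_rcis) auto
  then show ?thesis using le by (simp add: eq)
qed

section \<open>The admissible pair for the torus\<close>

context leaf_curve
begin

theorem pb4_pair_exists:
  fixes m n :: int and \<epsilon> :: real
  assumes "\<epsilon> > 0"
  obtains F G where "(F, G) \<in> pb4_pairs (fib_set \<eta> m n 0 (1/4)) (fib_set \<eta> m n (1/2) (3/4))
      (fib_set \<eta> m n (3/4) 1) (fib_set \<eta> m n (1/4) (1/2))"
    "\<And>z. poisson F G z \<le> (1 + \<epsilon>) * (max 0 m * ((1 + \<epsilon>) / a) + 2 * (\<bar>m\<bar> + \<bar>n\<bar>) * \<epsilon>)"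
proof -
  obtain \<kappa> P1 P2 P1' P2' where P: "\<kappa> > 0"
    "smooth_on (- {0}) P1" "smooth_on (- {0}) P2"
    "\<And>u. u \<noteq> 0 \<Longrightarrow> (P1 has_derivative (\<lambda>v. P1' u * Im (v / u))) (at u)"
    "\<And>u. u \<noteq> 0 \<Longrightarrow> (P2 has_derivative (\<lambda>v. P2' u * Im (v / u))) (at u)"
    "\<And>u. u \<noteq> 0 \<Longrightarrow> P1' u * P2 u - P1 u * P2' u \<in> {0..(1 + \<epsilon>) / pi}"
    "\<And>u x. u \<noteq> 0 \<Longrightarrow> \<bar>Arg (u * cis (- 2 * pi * x))\<bar> \<le> 2 * pi * \<kappa> \<Longrightarrow> on_arc 0 (1/4) x \<Longrightarrow> P1 u = -1/2"
    "\<And>u x. u \<noteq> 0 \<Longrightarrow> \<bar>Arg (u * cis (- 2 * pi * x))\<bar> \<le> 2 * pi * \<kappa> \<Longrightarrow> on_arc (1/2) (3/4) x \<Longrightarrow> P1 u = 1/2"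
    "\<And>u x. u \<noteq> 0 \<Longrightarrow> \<bar>Arg (u * cis (- 2 * pi * x))\<bar> \<le> 2 * pi * \<kappa> \<Longrightarrow> on_arc (3/4) 1 x \<Longrightarrow> P2 u = -1/2"
    "\<And>u x. u \<noteq> 0 \<Longrightarrow> \<bar>Arg (u * cis (- 2 * pi * x))\<bar> \<le> 2 * pi * \<kappa> \<Longrightarrow> on_arc (1/4) (1/2) x \<Longrightarrow> P2 u = 1/2"
    by (rule square_loop[OF \<open>\<epsilon> > 0\<close>]) blast
  \<comment> \<open>The power \<open>m\<close> of \<open>E\<close> multiplies the error of the angle
    by \<open>\<bar>m\<bar>\<close>. The \<open>1\<close> keeps the product below \<open>pi\<close>,
    and the \<open>+ 1\<close> in the denominator covers \<open>m = 0\<close>.\<close>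
  define \<kappa>0 where "\<kappa>0 = min (2 * pi * \<kappa>) 1 / (\<bar>m\<bar> + 1)"
  have \<kappa>0: "\<kappa>0 > 0" "\<bar>of_int m\<bar> * \<kappa>0 \<le> 2 * pi * \<kappa>" "\<bar>of_int m\<bar> * \<kappa>0 < pi"
  proof -
    have m1: "0 < \<bar>real_of_int m\<bar> + 1" by linarith
    show "\<kappa>0 > 0" using P(1) m1 by (simp add: \<kappa>0_def)
    have le: "\<bar>of_int m\<bar> * \<kappa>0 \<le> min (2 * pi * \<kappa>) 1"
    proof -
      have "\<bar>real_of_int m\<bar> / (\<bar>real_of_int m\<bar> + 1) \<le> 1"
        using m1 by (simp add: divide_le_eq_1)
      then have "\<bar>real_of_int m\<bar> / (\<bar>real_of_int m\<bar> + 1) * min (2 * pi * \<kappa>) 1 \<le> 1 * min (2 * pi * \<kappa>) 1"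
        using P(1) by (intro mult_right_mono) auto
      then show ?thesis by (simp add: \<kappa>0_def)
    qed
    then show "\<bar>of_int m\<bar> * \<kappa>0 \<le> 2 * pi * \<kappa>" by simp
    show "\<bar>of_int m\<bar> * \<kappa>0 < pi" using le pi_gt3 by linarith
  qed
  obtain k E C V where kE: "compact C" "C \<subseteq> V" "open V" "V \<subseteq> quadrant" "smooth_on UNIV k" "\<And>z. 0 \<le> k z" "\<And>z. k z \<le> 1"
    "\<And>z. z \<notin> C \<Longrightarrow> k z = 0" "smooth_on V E" "\<And>z. z \<in> V \<Longrightarrow> E z \<noteq> 0"
    "\<And>t. k (\<eta> t) = 1" "\<And>t. \<bar>Arg (E (\<eta> t) * cis (- 2 * pi * t))\<bar> \<le> \<kappa>0"
    "\<And>z. z \<in> V \<Longrightarrow> - \<epsilon> \<le> k z * angular_bracket k E z"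
    "\<And>z. z \<in> V \<Longrightarrow> k z * angular_bracket k E z \<le> (1 + \<epsilon>) / (2 * a)"
    by (rule plane_profile[OF \<kappa>0(1) \<open>\<epsilon> > 0\<close>]) blast
  obtain \<xi> \<xi>' b where \<xi>: "b > 0" "smooth_on UNIV \<xi>"
    "\<And>c. (\<xi> has_real_derivative \<xi>' c) (at c)" "\<xi> 0 = 1" "\<And>c. 0 \<le> \<xi> c" "\<And>c. \<xi> c \<le> 1"
    "\<And>c. \<bar>\<xi>' c\<bar> \<le> \<epsilon>" "\<And>c. \<bar>c\<bar> \<ge> b \<Longrightarrow> \<xi> c = 0"
    by (rule slow_cutoff[OF \<open>\<epsilon> > 0\<close>]) blast
  have \<eta>C: "\<eta> t \<in> C" for t using kE(8)[of "\<eta> t"] kE(11)[of t] by auto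
  have Cq: "C \<subseteq> quadrant" using kE by blast
  have Cne: "C \<noteq> {}" using \<eta>C[of 0] by auto
  obtain ylo where ylo: "ylo \<in> C" "\<And>y. y \<in> C \<Longrightarrow> (cmod ylo)\<^sup>2 \<le> (cmod y)\<^sup>2"
    using continuous_attains_inf[OF kE(1) Cne, of "\<lambda>y. (cmod y)\<^sup>2"] by (auto intro!: continuous_intros)
  obtain yhi where yhi: "yhi \<in> C" "\<And>y. y \<in> C \<Longrightarrow> (cmod y)\<^sup>2 \<le> (cmod yhi)\<^sup>2"
    using continuous_attains_sup[OF kE(1) Cne, of "\<lambda>y. (cmod y)\<^sup>2"] by (auto intro!: continuous_intros)
  \<comment> \<open>The sine of twice the argument of \<open>y\<close>. For
    \<open>y = plane_part K z\<close> this is the sine of \<open>total_angle z\<close>, so its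
    minimum on \<open>C\<close> keeps the product of the coordinates away from the real
    axis.\<close>
  let ?sn = "\<lambda>y. 2 * Re y * Im y / (cmod y)\<^sup>2"
  have "continuous_on C ?sn" using Cq by (intro continuous_intros) auto
  then obtain ysn where ysn: "ysn \<in> C" "\<And>y. y \<in> C \<Longrightarrow> ?sn ysn \<le> ?sn y"
    using continuous_attains_inf[OF kE(1) Cne, of ?sn] by auto
  define lo where "lo = (cmod ylo)\<^sup>2"
  define hi where "hi = (cmod yhi)\<^sup>2"
  define sn where "sn = ?sn ysn"
  have lo: "lo > 0" using ylo(1) Cq by (auto simp: lo_def)
  have sn: "sn > 0"
  proof -
    have "Re ysn > 0" "Im ysn > 0" "cmod ysn > 0" using ysn(1) Cq by auto
    then show ?thesis by (simp add: sn_def)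
  qed
  \<comment> \<open>With \<open>x = \<bar>moment z\<bar> / (2 * pi)\<close> the shear term becomes
    \<open>x\<^sup>2 / lo\<close>, which is at least \<open>x - lo / 4\<close>. This bounds twice
    the smaller of the two actions from below by \<open>lo / 4\<close>, whatever the size of the
    moment map.\<close>
  define K where "K = 1 / (4 * pi\<^sup>2 * lo)"
  have K: "K > 0" using lo by (simp add: K_def)
  let ?N = "\<lambda>z :: complex \<times> complex. (cmod (fst z))\<^sup>2 + (cmod (snd z))\<^sup>2"
  define M where "M = hi + 2 * K * b\<^sup>2 + 1"
  have M: "M > 0" using K by (simp add: M_def hi_def add_nonneg_pos)
  \<comment> \<open>Closed conditions that make sense on the whole space, in contrast to
    \<open>plane_part\<close>, and that force membership in \<open>chart_domain K\<close> with a
    margin. Together with the bound on the norm they cut out a compact set.\<close>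
  define Z where "Z = {z. \<bar>moment z\<bar> \<le> b \<and> lo \<le> 2 * sheared_radius K z \<and> sn * cmod (fst z * snd z) \<le> Im (fst z * snd z)
    \<and> lo / 4 \<le> cmod (fst z * snd z) \<and> ?N z \<le> M - 1}"
  have csr: "continuous_on UNIV (sheared_radius K)" and cm: "continuous_on UNIV moment"
    by (intro smooth_on_imp_continuous_on smooth_on_sheared_radius smooth_on_moment open_UNIV)+
  have bdd_N: "bounded {z. ?N z \<le> r}" for r
  proof -
    have "{z. ?N z \<le> r} \<subseteq> cball 0 (sqrt r)"
      by (auto simp: norm_prod_def)
    then show ?thesis using bounded_cball bounded_subset by blast
  qed
  have "closed Z"
    unfolding Z_def by (intro closed_Collect_conj closed_Collect_le continuous_intros csr cm)
  moreover have "bounded Z" using bdd_N[of "M - 1"] by (rule bounded_subset) (auto simp: Z_def)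
  ultimately have compZ: "compact Z" by (simp add: compact_eq_bounded_closed)
  have Zdom: "Z \<subseteq> chart_domain K"
  proof
    fix z assume z: "z \<in> Z"
    have "0 < sn * (lo / 4)" using sn lo by simp
    also have "\<dots> \<le> sn * cmod (fst z * snd z)" using z sn by (intro mult_left_mono) (auto simp: Z_def)
    also have "\<dots> \<le> Im (fst z * snd z)" using z by (simp add: Z_def)
    finally show "z \<in> chart_domain K" using z lo by (simp add: chart_domain_def Z_def)
  qed
  have contY: "continuous_on (chart_domain K) (plane_part K)"
    by (intro smooth_on_imp_continuous_on smooth_on_plane_part open_chart_domain order_refl)
  define Zc where "Zc = Z \<inter> plane_part K -` C"
  have compZc: "compact Zc"
  proof -
    have "closed (Z \<inter> plane_part K -` C)"
      by (rule continuous_closed_preimage[OF continuous_on_subset[OF contY Zdom]])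
        (use compZ kE(1) compact_imp_closed in auto)
    then show ?thesis using compact_Int_closed[OF compZ] unfolding Zc_def by (metis inf.left_idem)
  qed
  define U where "U = chart_domain K \<inter> plane_part K -` V"
  have openU: "open U" unfolding U_def by (rule continuous_open_preimage[OF contY open_chart_domain kE(3)])
  have ZcU: "Zc \<subseteq> U" using Zdom kE(2) by (auto simp: Zc_def U_def)
  \<comment> \<open>This confines the support of \<open>h\<close> to a compact subset of the
    chart.\<close>
  have inZ: "z \<in> Zc" if z: "z \<in> chart_domain K" "plane_part K z \<in> C" "\<bar>moment z\<bar> \<le> b" for z
  proof -
    define Y where "Y = plane_part K z"
    define \<rho> where "\<rho> = sheared_radius K z"
    define x where "x = \<bar>moment z\<bar> / (2 * pi)"
    have \<rho>: "\<rho> > 0" and im: "Im (fst z * snd z) > 0" using z by (auto simp: chart_domain_def \<rho>_def)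
    have Y2: "(cmod Y)\<^sup>2 = 2 * \<rho>" using \<rho> by (simp add: Y_def plane_part_def norm_mult \<rho>_def)
    have lohi: "lo \<le> 2 * \<rho>" "2 * \<rho> \<le> hi" 
      unfolding Y2[symmetric] lo_def hi_def Y_def using ylo(2)[OF z(2)] yhi(2)[OF z(2)] by (simp_all only:)
    have N: "?N z = 2 * \<rho> + 2 * K * (moment z)\<^sup>2" by (simp add: \<rho>_def sheared_radius_def)
    have "(moment z)\<^sup>2 \<le> b\<^sup>2" using z(3) by (metis abs_ge_zero power2_abs power_mono)
    then have "K * (moment z)\<^sup>2 \<le> K * b\<^sup>2" using K by (intro mult_left_mono) auto
    then have N1: "?N z \<le> M - 1" using N lohi by (simp add: M_def)
    define c where "c = cmod (fst z * snd z)"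
    have c0: "c > 0" using im by (auto simp: c_def)
    have "fst z * snd z \<noteq> 0" using im by auto
    then have pr: "fst z * snd z = of_real c * cis (total_angle z)"
      using rcis_cmod_Arg[of "fst z * snd z"] by (simp add: rcis_def c_def total_angle_def Arg_eq_Im_Ln)
    have Imc: "Im (fst z * snd z) = c * sin (total_angle z)" by (simp only: pr) simp
    have "Y\<^sup>2 = (of_real (sqrt (2 * \<rho>)) * cis (total_angle z / 2))\<^sup>2"
      by (simp add: Y_def plane_part_def \<rho>_def cis_conv_exp)
    also have "\<dots> = of_real ((sqrt (2 * \<rho>))\<^sup>2) * cis (total_angle z)"
      by (simp add: power_mult_distrib Complex.DeMoivre del: real_sqrt_pow2_iff of_real_power)
        (simp flip: of_real_power)
    also have "(sqrt (2 * \<rho>))\<^sup>2 = 2 * \<rho>" using \<rho> by simp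
    finally have "Im (Y\<^sup>2) = 2 * \<rho> * sin (total_angle z)" by simp
    moreover have "Im (Y\<^sup>2) = 2 * Re Y * Im Y" by (simp add: power2_eq_square)
    ultimately have "?sn Y = sin (total_angle z)" using \<rho> Y2 by simp
    then have "sn \<le> sin (total_angle z)" using ysn(2)[OF z(2)] unfolding sn_def Y_def by (simp only:)
    then have s: "sn * c \<le> Im (fst z * snd z)" using c0 unfolding Imc by (simp add: mult.commute)
    have K_eq: "K * (moment z)\<^sup>2 = x\<^sup>2 / lo"
      by (simp add: K_def x_def power_divide power_mult_distrib)
    have "0 \<le> (x - lo / 2)\<^sup>2 / lo" using lo by simp
    also have "\<dots> = x\<^sup>2 / lo + lo / 4 - x" using lo by (simp add: power2_eq_square field_simps)
    finally have d1: "\<rho> + K * (moment z)\<^sup>2 - x \<ge> lo / 4" using lohi K_eq by linarith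
    have x0: "x \<ge> 0" by (simp add: x_def)
    have "c\<^sup>2 = (cmod (fst z))\<^sup>2 * (cmod (snd z))\<^sup>2" by (simp add: c_def norm_mult power_mult_distrib)
    \<comment> \<open>The product of the two actions is written through their mean and
      half-difference; it factors into \<open>d1\<close> and a term at least as large, so neither
      coordinate can approach \<open>0\<close>.\<close>
    also have "\<dots> = (?N z / 2)\<^sup>2 - (((cmod (fst z))\<^sup>2 - (cmod (snd z))\<^sup>2) / 2)\<^sup>2"
      by (simp add: power2_eq_square field_simps)
    also have "(((cmod (fst z))\<^sup>2 - (cmod (snd z))\<^sup>2) / 2)\<^sup>2 = x\<^sup>2"
      by (simp add: x_def moment_def abs_mult power_divide)
    also have "?N z / 2 = \<rho> + K * (moment z)\<^sup>2" using N by simp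
    finally have "c\<^sup>2 = (\<rho> + K * (moment z)\<^sup>2 - x) * (\<rho> + K * (moment z)\<^sup>2 + x)"
      by (simp add: power2_eq_square algebra_simps)
    also have "\<dots> \<ge> (lo / 4) * (lo / 4)"
      using d1 x0 lo by (intro mult_mono) auto
    finally have "(lo / 4)\<^sup>2 \<le> c\<^sup>2" by (simp add: power2_eq_square)
    then have "lo / 4 \<le> c" by (rule power2_le_imp_le) (use c0 in simp)
    then show ?thesis
      using z(2,3) lohi N1 s by (simp add: Zc_def Z_def c_def \<rho>_def)
  qed

  define W where "W z = E (plane_part K z) powi m * phase K z powi n" for z
  define h where "h z = k (plane_part K z) * \<xi> (moment z)" for z
  define H where "H P z = (if z \<in> U then h z * P (W z) else 0)" for P :: "complex \<Rightarrow> real" and z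
  define kap where "kap z = smooth_step (2 - ?N z / M)" for z
  have UW: "W z \<noteq> 0" if "z \<in> U" for z
    using that kE(10) phase_nonzero[of z K] by (auto simp: W_def U_def)
  have Usub: "U \<subseteq> chart_domain K" by (auto simp: U_def)
  have sW: "smooth_on U W"
    unfolding W_def[abs_def]
    by (intro smooth_on_mult smooth_on_power_int smooth_on_compose[OF kE(9)] smooth_on_plane_part smooth_on_phase openU Usub kE(3))
      (use kE(10) phase_nonzero in \<open>auto simp: U_def\<close>)
  have sH: "smooth_on UNIV (H P)" if "smooth_on (- {0}) P" for P
  proof (rule smooth_on_zero_extension[OF openU compact_imp_closed[OF compZc] ZcU])
    have "smooth_on U (\<lambda>z. h z * P (W z))"
      unfolding h_def
      by (intro smooth_on_mult smooth_on_compose[OF kE(5)] smooth_on_compose[OF \<xi>(2)] smooth_on_compose[OF that]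
          smooth_on_plane_part smooth_on_moment sW openU Usub) (use UW in auto)
    then show "smooth_on U (H P)"
      by (rule smooth_on_cong[OF openU, rotated]) (simp add: H_def)
    show "H P z = 0" if "z \<notin> Zc" for z
    proof (cases "z \<in> U")
      case True
      then have "plane_part K z \<notin> C \<or> \<bar>moment z\<bar> > b" using inZ[of z] that
        by (cases "\<bar>moment z\<bar> \<le> b") (auto simp: U_def)
      then have "h z = 0" using kE(8) \<xi>(8) by (auto simp: h_def)
      then show ?thesis by (simp add: H_def)
    qed (simp add: H_def)
  qed
  have H0: "H P z = 0" if "z \<notin> Zc" for P z
  proof (cases "z \<in> U")
    case True
    then have "plane_part K z \<notin> C \<or> \<bar>moment z\<bar> > b" using inZ[of z] that
        by (cases "\<bar>moment z\<bar> \<le> b") (auto simp: U_def)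
    then have "h z = 0" using kE(8) \<xi>(8) by (auto simp: h_def)
    then show ?thesis by (simp add: H_def)
  qed (simp add: H_def)
  have skap: "smooth_on UNIV kap"
    unfolding kap_def[abs_def] using M
    by (intro smooth_on_compose[OF smooth_on_smooth_step] smooth_on_diff smooth_on_divide_real smooth_on_add
        smooth_on_const smooth_on_cmod_square smooth_on_fst smooth_on_snd smooth_on_id) auto
  have kap1: "kap z = 1" if "?N z < M" for z using that M by (simp add: kap_def divide_le_eq)
  have kap0: "kap z = 0" if "?N z \<ge> 2 * M" for z using that M by (simp add: kap_def le_divide_eq)
  \<comment> \<open>\<open>kap\<close> is a compactly supported function equal to \<open>1\<close>
    around \<open>Zc\<close>. Half of it lifts the values \<open>-1/2\<close> and \<open>1/2\<close>
    on the torus to \<open>0\<close> and \<open>1\<close>. Both functions contain the same summand,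
    so they agree off \<open>Zc\<close> and their bracket vanishes there.\<close>
  define F where "F z = kap z / 2 + H P1 z" for z
  define G where "G z = kap z / 2 + H P2 z" for z
  have sF: "smooth_on UNIV F" and sG: "smooth_on UNIV G"
    unfolding F_def[abs_def] G_def[abs_def]
    by (intro smooth_on_add smooth_on_divide_real skap sH P smooth_on_const; simp)+
  have ZcN: "?N z < M" if "z \<in> Zc" for z using that by (auto simp: Zc_def Z_def)
  have cs: "compactly_supported (\<lambda>z. kap z / 2 + H P z)" for P
    unfolding compactly_supported_def
  proof -
    have "{z. kap z / 2 + H P z \<noteq> 0} \<subseteq> {z. ?N z \<le> 2 * M}"
    proof (intro subsetI CollectI, rule ccontr)
      fix z assume z: "z \<in> {z. kap z / 2 + H P z \<noteq> 0}" "\<not> ?N z \<le> 2 * M"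
      then have "z \<notin> Zc" using ZcN[of z] M by auto
      then show False using z kap0[of z] H0[of z P] by auto
    qed
    then have "bounded {z. kap z / 2 + H P z \<noteq> 0}" using bdd_N bounded_subset by blast
    then show "compact (closure {z. kap z / 2 + H P z \<noteq> 0})" by (simp add: compact_closure)
  qed

  have on_torus: "F (chek \<eta> t s) = 1/2 + P1 (W (chek \<eta> t s))" "G (chek \<eta> t s) = 1/2 + P2 (W (chek \<eta> t s))"
    "W (chek \<eta> t s) \<noteq> 0" "\<bar>Arg (W (chek \<eta> t s) * cis (- 2 * pi * (m * t + n * s)))\<bar> \<le> 2 * pi * \<kappa>" for t s :: real
  proof -
    let ?z = "chek \<eta> t s"
    note ch = chart_of_chek(1)[where \<eta> = \<eta> and t = t and s = s, OF in_quadrant]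
      chart_of_chek(2-5)[where \<eta> = \<eta> and t = t and s = s and K = K, OF in_quadrant]
    have zc: "?z \<in> Zc" by (rule inZ) (use ch \<eta>C \<xi>(1) in auto)
    then have zU: "?z \<in> U" using ZcU by blast
    have h1: "h ?z = 1" using ch kE(11) \<xi>(4) by (simp add: h_def)
    show "F ?z = 1/2 + P1 (W ?z)" "G ?z = 1/2 + P2 (W ?z)"
      using kap1[OF ZcN[OF zc]] zU h1 by (simp_all add: F_def G_def H_def)
    show "W ?z \<noteq> 0" by (rule UW[OF zU])
    define r where "r = cmod (\<eta> t) / sqrt 2"
    have "\<eta> t \<noteq> 0" using in_quadrant[of t] by auto
    then have r: "r > 0" by (simp add: r_def)
    have "W ?z = E (\<eta> t) powi m * (of_real r * cis (2 * pi * s)) powi n"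
      using ch by (simp add: W_def r_def)
    then have "W ?z * cis (- 2 * pi * (m * t + n * s)) =
      E (\<eta> t) powi m * (of_real (r powi n) * cis (n * (2 * pi * s)) * cis (- 2 * pi * (m * t + n * s)))"
      by (simp add: power_int_mult_distrib cis_power_int)
    also have "of_real (r powi n) * cis (n * (2 * pi * s)) * cis (- 2 * pi * (m * t + n * s)) = of_real (r powi n) * cis (m * (- 2 * pi * t))"
      unfolding mult.assoc cis_mult by (intro arg_cong2[where f = "(*)"] arg_cong[where f = cis] refl) (simp add: algebra_simps)
    also have "E (\<eta> t) powi m * (of_real (r powi n) * cis (m * (- 2 * pi * t))) = (E (\<eta> t) * cis (- 2 * pi * t)) powi m * of_real (r powi n)"
      unfolding power_int_mult_distrib cis_power_int by (simp only: mult_ac)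
    finally have eq: "W ?z * cis (- 2 * pi * (m * t + n * s)) = (E (\<eta> t) * cis (- 2 * pi * t)) powi m * of_real (r powi n)" .
    have "\<bar>Arg ((E (\<eta> t) * cis (- 2 * pi * t)) powi m * of_real (r powi n))\<bar> \<le> \<bar>of_int m\<bar> * \<kappa>0"
    proof (rule Arg_power_int_le[OF _ kE(12) \<kappa>0(3)])
      show "E (\<eta> t) * cis (- 2 * pi * t) \<noteq> 0" using kE(2,10) \<eta>C[of t] by auto
    qed (use r in simp)
    then show "\<bar>Arg (W ?z * cis (- 2 * pi * (m * t + n * s)))\<bar> \<le> 2 * pi * \<kappa>" unfolding eq using \<kappa>0(2) by linarith
  qed
  have mem: "(F, G) \<in> pb4_pairs (fib_set \<eta> m n 0 (1/4)) (fib_set \<eta> m n (1/2) (3/4))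
      (fib_set \<eta> m n (3/4) 1) (fib_set \<eta> m n (1/4) (1/2))"
  proof -
    have "smooth F" "smooth G" using sF sG by (simp_all add: smooth_iff_smooth_on_UNIV)
    moreover have "compactly_supported F" "compactly_supported G"
      using cs unfolding F_def[abs_def] G_def[abs_def] by auto
    moreover have "\<forall>x\<in>fib_set \<eta> m n 0 (1/4). F x \<le> 0" "\<forall>x\<in>fib_set \<eta> m n (1/2) (3/4). F x \<ge> 1"
      "\<forall>x\<in>fib_set \<eta> m n (3/4) 1. G x \<le> 0" "\<forall>x\<in>fib_set \<eta> m n (1/4) (1/2). G x \<ge> 1"
      by (auto simp: fib_set_def on_torus(1,2) P(7-10)[OF on_torus(3,4)])
    ultimately show ?thesis by (simp add: pb4_pairs_def)
  qed

  define bnd where "bnd = max 0 m * ((1 + \<epsilon>) / (2 * a)) + (\<bar>m\<bar> + \<bar>n\<bar>) * \<epsilon>"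
  have bnd: "bnd \<ge> 0" unfolding bnd_def using \<open>\<epsilon> > 0\<close> a_pos by (intro add_nonneg_nonneg mult_nonneg_nonneg) auto
  have bound: "poisson F G z \<le> 2 * (1 + \<epsilon>) * bnd" for z
  proof (cases "z \<in> Zc")
    case False
    have op: "open (- Zc)" "z \<in> - Zc" using compZc compact_imp_closed False by auto
    have "F y = G y" if "y \<in> - Zc" for y using H0[of y] that by (simp add: F_def G_def)
    then have "(G has_derivative frechet_derivative F (at z)) (at z)"
      by (intro has_derivative_transform_within_open[OF smooth_on_has_derivative[OF sF UNIV_I] op]) auto
    then have "frechet_derivative G (at z) = frechet_derivative F (at z)" by (metis frechet_derivative_at)
    moreover have "F differentiable (at z)" "G differentiable (at z)"
      using smooth_on_has_derivative[OF sF UNIV_I] smooth_on_has_derivative[OF sG UNIV_I] unfolding differentiable_def by blast+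
    ultimately have "poisson F G z = 0" by (simp add: poisson_eq)
    then show ?thesis using bnd \<open>\<epsilon> > 0\<close> by simp
  next
    case True
    then have zU: "z \<in> U" using ZcU by blast
    define Y where "Y = plane_part K z"
    have YV: "Y \<in> V" using zU by (simp add: U_def Y_def)
    define x where "x = \<xi> (moment z)"
    define X where "X = m * x\<^sup>2 * (k Y * angular_bracket k E Y) + n * (k Y)\<^sup>2 * (x * \<xi>' (moment z))"
    let ?O = "U \<inter> {z. ?N z < M}"
    have oO: "open ?O" by (intro open_Int openU open_Collect_less continuous_intros)
    have "poisson F G z = 2 * pi * (P1' (W z) * P2 (W z) - P1 (W z) * P2' (W z)) * X"
      unfolding X_def x_def Y_def W_def
    proof (rule poisson_lift[OF _ _ _ _ \<xi>(3) P(4,5) oO])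
      show "z \<in> chart_domain K" using zU by (simp add: U_def)
      show "E (plane_part K z) \<noteq> 0" using YV kE(10) by (simp add: Y_def)
      show "(k has_derivative frechet_derivative k (at (plane_part K z))) (at (plane_part K z))"
        by (rule smooth_on_has_derivative[OF kE(5) UNIV_I])
      show "(E has_derivative frechet_derivative E (at (plane_part K z))) (at (plane_part K z))"
        by (rule smooth_on_has_derivative[OF kE(9)]) (use YV in \<open>simp add: Y_def\<close>)
      show "z \<in> ?O" using zU ZcN[OF True] by simp
      show "F y = 1/2 + k (plane_part K y) * \<xi> (moment y) * P1 (E (plane_part K y) powi m * phase K y powi n)"
        "G y = 1/2 + k (plane_part K y) * \<xi> (moment y) * P2 (E (plane_part K y) powi m * phase K y powi n)" if "y \<in> ?O" for y
        using that kap1[of y] by (simp_all add: F_def G_def H_def h_def W_def)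
    qed
    also have "\<dots> \<le> 2 * pi * ((1 + \<epsilon>) / pi) * bnd"
    proof -
      have wt: "0 \<le> P1' (W z) * P2 (W z) - P1 (W z) * P2' (W z)"
        "P1' (W z) * P2 (W z) - P1 (W z) * P2' (W z) \<le> (1 + \<epsilon>) / pi"
        using P(6)[OF UW[OF zU]] by auto
      have x: "0 \<le> x" "x \<le> 1" using \<xi>(5,6) by (auto simp: x_def)
      have x2: "0 \<le> x\<^sup>2" "x\<^sup>2 \<le> 1" using x by (auto simp: power_le_one)
      \<comment> \<open>The sign of \<open>m\<close> selects the side of the leaf that matters: its
        inside with the bound \<open>(1 + \<epsilon>) / (2 * a)\<close> for
        \<open>m \<ge> 0\<close>, its outside with the bound \<open>\<epsilon>\<close> for
        \<open>m < 0\<close>.\<close>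
      have "m * x\<^sup>2 * (k Y * angular_bracket k E Y) \<le> max 0 m * ((1 + \<epsilon>) / (2 * a)) + \<bar>m\<bar> * \<epsilon>"
      proof (cases "m \<ge> 0")
        case True
        have "x\<^sup>2 * (k Y * angular_bracket k E Y) \<le> x\<^sup>2 * ((1 + \<epsilon>) / (2 * a))"
          using kE(14)[OF YV] x2 by (intro mult_left_mono)
        also have "\<dots> \<le> 1 * ((1 + \<epsilon>) / (2 * a))" using x2 \<open>\<epsilon> > 0\<close> a_pos by (intro mult_right_mono) auto
        finally have "m * (x\<^sup>2 * (k Y * angular_bracket k E Y)) \<le> m * ((1 + \<epsilon>) / (2 * a))"
          using True by (intro mult_left_mono) auto
        moreover have "0 \<le> \<bar>m\<bar> * \<epsilon>" using \<open>\<epsilon> > 0\<close> by simp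
        ultimately show ?thesis using True by (simp add: mult.assoc max_def)
      next
        case False
        have "x\<^sup>2 * - (k Y * angular_bracket k E Y) \<le> x\<^sup>2 * \<epsilon>"
          using kE(13)[OF YV] x2 by (intro mult_left_mono) auto
        also have "\<dots> \<le> 1 * \<epsilon>" using x2 \<open>\<epsilon> > 0\<close> by (intro mult_right_mono) auto
        finally have "- m * (x\<^sup>2 * - (k Y * angular_bracket k E Y)) \<le> - m * \<epsilon>"
          using False by (intro mult_left_mono) auto
        then show ?thesis using False by (simp add: mult.assoc)
      qed
      moreover have "n * (k Y)\<^sup>2 * (x * \<xi>' (moment z)) \<le> \<bar>n\<bar> * \<epsilon>"
      proof -
        have "\<bar>n * (k Y)\<^sup>2 * (x * \<xi>' (moment z))\<bar> = \<bar>n\<bar> * ((k Y)\<^sup>2 * (x * \<bar>\<xi>' (moment z)\<bar>))"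
          using x by (simp add: abs_mult)
        also have "\<dots> \<le> \<bar>n\<bar> * (1 * (1 * \<epsilon>))"
          using x \<xi>(7)[of "moment z"] kE(6,7)[of Y] by (intro mult_left_mono mult_mono) (auto simp: power_le_one)
        finally show ?thesis by simp
      qed
      ultimately have "X \<le> bnd" unfolding X_def bnd_def by (simp add: distrib_right)
      then have "(P1' (W z) * P2 (W z) - P1 (W z) * P2' (W z)) * X \<le> (P1' (W z) * P2 (W z) - P1 (W z) * P2' (W z)) * bnd"
        using wt by (intro mult_left_mono)
      also have "\<dots> \<le> (1 + \<epsilon>) / pi * bnd" using wt bnd by (intro mult_right_mono)
      finally have "2 * pi * ((P1' (W z) * P2 (W z) - P1 (W z) * P2' (W z)) * X) \<le> 2 * pi * ((1 + \<epsilon>) / pi * bnd)"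
        by (intro mult_left_mono) auto
      then show ?thesis by (simp only: mult.assoc)
    qed
    also have "2 * pi * ((1 + \<epsilon>) / pi) * bnd = 2 * (1 + \<epsilon>) * bnd" by simp
    finally show ?thesis .
  qed
  have "2 * (1 + \<epsilon>) * bnd = (1 + \<epsilon>) * (max 0 m * ((1 + \<epsilon>) / a) + 2 * (\<bar>m\<bar> + \<bar>n\<bar>) * \<epsilon>)"
    unfolding bnd_def using a_pos by (simp add: field_simps)
  then show ?thesis using that[OF mem] bound by simp
qed

end

section \<open>Inflating the torus\<close>

lemma has_vector_derivative_polar:
  assumes p: "(p has_real_derivative p') (at x)" "p x > 0" and a: "(\<alpha> has_real_derivative \<alpha>') (at x)"
  shows "((\<lambda>x. of_real (sqrt (p x)) * cis (\<alpha> x)) has_vector_derivative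
    of_real (sqrt (p x)) * cis (\<alpha> x) * Complex (p' / (2 * p x)) \<alpha>') (at x)"
proof -
  have "((\<lambda>x. complex_of_real (sqrt (p x))) has_derivative (\<lambda>h. of_real (inverse (sqrt (p x)) / 2 * (p' * h)))) (at x)"
    using has_derivative_of_real[OF has_derivative_compose[OF p(1)[unfolded has_field_derivative_def] DERIV_real_sqrt[OF p(2), unfolded has_field_derivative_def]]] .
  moreover have "((\<lambda>x. cis (\<alpha> x)) has_derivative (\<lambda>h. cis (\<alpha> x) * (\<i> * of_real (\<alpha>' * h)))) (at x)"
    using has_derivative_exp_i[OF a[unfolded has_field_derivative_def]] by (simp add: cis_conv_exp)
  ultimately have "((\<lambda>x. of_real (sqrt (p x)) * cis (\<alpha> x)) has_derivative
      (\<lambda>h. of_real (sqrt (p x)) * (cis (\<alpha> x) * (\<i> * of_real (\<alpha>' * h))) + of_real (inverse (sqrt (p x)) / 2 * (p' * h)) * cis (\<alpha> x))) (at x)"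
    by (rule has_derivative_mult)
  moreover have "of_real (sqrt (p x)) * (cis (\<alpha> x) * (\<i> * of_real (\<alpha>' * h))) + of_real (inverse (sqrt (p x)) / 2 * (p' * h)) * cis (\<alpha> x)
      = h *\<^sub>R (of_real (sqrt (p x)) * cis (\<alpha> x) * Complex (p' / (2 * p x)) \<alpha>')" for h
  proof -
    have i: "inverse (sqrt (p x)) / 2 * (p' * h) = sqrt (p x) * (p' / (2 * p x)) * h"
    proof -
      have "inverse (sqrt (p x)) = sqrt (p x) / p x" using p(2) by (simp add: field_simps)
      then show ?thesis by simp
    qed
    show ?thesis unfolding i Complex_eq by (simp add: scaleR_conv_of_real algebra_simps)
  qed
  ultimately show ?thesis unfolding has_vector_derivative_def by (simp only:)
qed

text \<open>Tangent vectors are given by logarithmic derivatives, with \<open>p\<close> and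
  \<open>q\<close> the squared moduli; in each coordinate the symplectic form is half of
  \<open>dp \<and> d\<alpha>\<close>.\<close>

lemma omega_polar:
  assumes "p > 0" "q > 0"
  shows "omega (of_real (sqrt p) * cis \<alpha> * Complex (p1 / (2 * p)) a1, of_real (sqrt q) * cis \<beta> * Complex (q1 / (2 * q)) b1)
      (of_real (sqrt p) * cis \<alpha> * Complex (p2 / (2 * p)) a2, of_real (sqrt q) * cis \<beta> * Complex (q2 / (2 * q)) b2)
    = (p1 * a2 - a1 * p2) / 2 + (q1 * b2 - b1 * q2) / 2"
proof -
  have "Im (cnj (of_real (sqrt p) * cis \<alpha> * Complex (p1 / (2 * p)) a1) * (of_real (sqrt p) * cis \<alpha> * Complex (p2 / (2 * p)) a2))
      = (p1 * a2 - a1 * p2) / 2" if "p > 0" for p \<alpha> p1 a1 p2 a2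
  proof -
    have "cnj (of_real (sqrt p) * cis \<alpha> * Complex (p1 / (2 * p)) a1) * (of_real (sqrt p) * cis \<alpha> * Complex (p2 / (2 * p)) a2)
      = (of_real (sqrt p) * of_real (sqrt p)) * (cis \<alpha> * cnj (cis \<alpha>)) * (cnj (Complex (p1 / (2 * p)) a1) * Complex (p2 / (2 * p)) a2)"
      by (simp add: mult_ac)
    also have "complex_of_real (sqrt p) * of_real (sqrt p) = of_real p" using that by (simp flip: of_real_mult)
    also have "cis \<alpha> * cnj (cis \<alpha>) = 1" by (simp add: cis_cnj cis_mult)
    finally have "Im (cnj (of_real (sqrt p) * cis \<alpha> * Complex (p1 / (2 * p)) a1) * (of_real (sqrt p) * cis \<alpha> * Complex (p2 / (2 * p)) a2))
      = Im (of_real p * 1 * (cnj (Complex (p1 / (2 * p)) a1) * Complex (p2 / (2 * p)) a2))" by (simp only:)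
    also have "\<dots> = p * (p1 / (2 * p) * a2 - a1 * (p2 / (2 * p)))" by simp
    also have "\<dots> = (p1 * a2 - a1 * p2) / 2" using that by (simp add: field_simps)
    finally show ?thesis .
  qed
  then show ?thesis unfolding omega_def fst_conv snd_conv using assms by (simp only:)
qed

context leaf_curve
begin

definition angle :: "real \<Rightarrow> real" where "angle t = Im (Ln (\<eta> t))"

definition angle' :: "real \<Rightarrow> real" where "angle' t = Im (vector_derivative \<eta> (at t) / \<eta> t)"

lemma \<eta>_nonzero: "\<eta> t \<noteq> 0" and \<eta>_not_nonpos: "\<eta> t \<notin> \<real>\<^sub>\<le>\<^sub>0"
  using in_quadrant[of t] by (auto simp: complex_nonpos_Reals_iff)

lemma angle_bounds: "0 < angle t" "angle t < pi / 2"
  using Im_Ln_pos_lt[OF \<eta>_nonzero, of t] Re_Ln_pos_lt[OF \<eta>_nonzero, of t] in_quadrant[of t]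
  by (auto simp: angle_def)

lemma \<eta>_polar: "\<eta> t = of_real (cmod (\<eta> t)) * cis (angle t)"
  using rcis_cmod_Arg[of "\<eta> t"] \<eta>_nonzero[of t] by (simp add: angle_def rcis_def Arg_eq_Im_Ln)

lemma angle_periodic: "angle (t + 1) = angle t"
  by (simp add: angle_def periodic)

lemma has_real_derivative_angle: "(angle has_real_derivative angle' t) (at t)"
proof -
  have "((\<lambda>t. Ln (\<eta> t)) has_derivative (\<lambda>h. inverse (\<eta> t) * (h *\<^sub>R vector_derivative \<eta> (at t)))) (at t)"
    using has_derivative_compose[OF smooth_has_vector_derivative[OF smooth_\<eta>, unfolded has_vector_derivative_def]
        has_field_derivative_Ln[OF \<eta>_not_nonpos, unfolded has_field_derivative_def]] .
  then have "(angle has_derivative (\<lambda>h. Im (inverse (\<eta> t) * (h *\<^sub>R vector_derivative \<eta> (at t))))) (at t)"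
    unfolding angle_def[abs_def] by (rule has_derivative_Im)
  moreover have "Im (inverse (\<eta> t) * (h *\<^sub>R vector_derivative \<eta> (at t))) = angle' t * h" for h
  proof -
    have "inverse (\<eta> t) * (h *\<^sub>R vector_derivative \<eta> (at t)) = h *\<^sub>R (vector_derivative \<eta> (at t) / \<eta> t)"
      by (simp add: divide_inverse mult.commute)
    then show ?thesis unfolding angle'_def by (simp only: scaleR_complex.sel mult.commute)
  qed
  ultimately show ?thesis unfolding has_field_derivative_def by (simp only:)
qed

lemma smooth_on_\<eta>: "smooth_on UNIV \<eta>"
  using smooth_\<eta> by (simp add: smooth_iff_smooth_on_UNIV)

lemma smooth_on_angle: "smooth_on UNIV angle"
  unfolding angle_def[abs_def] by (intro smooth_on_Im smooth_on_Ln smooth_on_\<eta> \<eta>_not_nonpos open_UNIV)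

definition half_norm_sq :: "real \<Rightarrow> real" where "half_norm_sq t = (cmod (\<eta> t))\<^sup>2 / 2"

definition half_norm_sq' :: "real \<Rightarrow> real" where
  "half_norm_sq' t = Re (cnj (\<eta> t) * vector_derivative \<eta> (at t))"

lemma has_real_derivative_half_norm_sq: "(half_norm_sq has_real_derivative half_norm_sq' t) (at t)"
proof -
  have "(half_norm_sq has_derivative (\<lambda>h. 2 * Re (cnj (\<eta> t) * (h *\<^sub>R vector_derivative \<eta> (at t))) / 2)) (at t)"
    unfolding half_norm_sq_def[abs_def]
    by (intro bounded_linear.has_derivative[OF bounded_linear_divide] has_derivative_compose[OF _ has_derivative_cmod_square]
        smooth_has_vector_derivative[OF smooth_\<eta>, unfolded has_vector_derivative_def])
  moreover have "2 * Re (cnj (\<eta> t) * (h *\<^sub>R vector_derivative \<eta> (at t))) / 2 = half_norm_sq' t * h" for h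
    by (simp add: half_norm_sq'_def algebra_simps)
  ultimately show ?thesis unfolding has_field_derivative_def by (simp only:)
qed

lemma smooth_on_half_norm_sq: "smooth_on UNIV half_norm_sq"
  unfolding half_norm_sq_def[abs_def]
  by (intro smooth_on_divide_real smooth_on_cmod_square smooth_on_\<eta> smooth_on_const) auto

lemma half_norm_sq_angle': "half_norm_sq t * angle' t = Im (cnj (\<eta> t) * vector_derivative \<eta> (at t)) / 2"
proof -
  have "of_real ((cmod (\<eta> t))\<^sup>2) * (vector_derivative \<eta> (at t) / \<eta> t) = cnj (\<eta> t) * vector_derivative \<eta> (at t)"
    unfolding complex_norm_square using \<eta>_nonzero[of t] by simp
  then have "(cmod (\<eta> t))\<^sup>2 * angle' t = Im (cnj (\<eta> t) * vector_derivative \<eta> (at t))"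
    unfolding angle'_def by (metis Im_complex_of_real Re_complex_of_real add.right_neutral mult_zero_left times_complex.sel(2))
  then show ?thesis by (simp add: half_norm_sq_def)
qed

lemma half_norm_sq_bounds: obtains lo hi where "lo > 0" "\<And>t. lo \<le> half_norm_sq t" "\<And>t. half_norm_sq t \<le> hi"
proof -
  have cont: "continuous_on {0..1} half_norm_sq"
    using smooth_on_imp_continuous_on[OF smooth_on_half_norm_sq] continuous_on_subset by blast
  have red: "half_norm_sq t = half_norm_sq (frac t)" for t
    using periodic_int[of "frac t" "\<lfloor>t\<rfloor>"] by (simp add: half_norm_sq_def frac_def)
  have fr: "frac t \<in> {0..1}" for t using frac_ge_0[of t] frac_lt_1[of t] by simp
  obtain x where x: "x \<in> {0..1}" "\<And>t. t \<in> {0..1} \<Longrightarrow> half_norm_sq x \<le> half_norm_sq t"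
    using continuous_attains_inf[OF compact_Icc _ cont] by auto
  obtain y where y: "y \<in> {0..1}" "\<And>t. t \<in> {0..1} \<Longrightarrow> half_norm_sq t \<le> half_norm_sq y"
    using continuous_attains_sup[OF compact_Icc _ cont] by auto
  show ?thesis
  proof (rule that[of "half_norm_sq x" "half_norm_sq y"])
    show "half_norm_sq x > 0" using \<eta>_nonzero[of x] by (simp add: half_norm_sq_def)
    show "half_norm_sq x \<le> half_norm_sq t" "half_norm_sq t \<le> half_norm_sq y" for t
      using x(2)[OF fr[of t]] y(2)[OF fr[of t]] red[of t] by simp_all
  qed
qed

text \<open>The leaf is inflated by scaling and its Chekanov torus is moved to the level \<open>- n \<tau>\<close> of the
  circle action. The translation by \<open>K \<tau>\<^sup>2\<close> in the radial direction has no flux; it keeps the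
  family in the domain of the polar coordinates, even for negative \<open>\<tau>\<close>, where the
  definition of an isotopy still demands smoothness.\<close>

theorem def_chek_infinite:
  fixes m n :: int
  assumes "m < 0"
  shows "def_chek \<eta> m n = \<infinity>"
proof -
  define I where "I = integral {0..1} (\<lambda>t. Im (cnj (\<eta> t) * vector_derivative \<eta> (at t))) / 2"
  have I: "I > 0" using signed_area_pos by (simp add: I_def)
  \<comment> \<open>Scaling the area at rate \<open>b\<close> sweeps out \<open>b * I\<close> per
    unit of time along the leaf, and the prescribed flux asks for \<open>- m\<close>. The rate is
    positive exactly because \<open>m < 0\<close>.\<close>
  define b where "b = - real_of_int m / I"
  have b: "b > 0" using assms I by (simp add: b_def divide_neg_pos)
  obtain lo hi where lohi: "lo > 0" "\<And>t. lo \<le> half_norm_sq t" "\<And>t. half_norm_sq t \<le> hi"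
    using half_norm_sq_bounds by blast
  \<comment> \<open>Both squared moduli are at least
    \<open>lo - B * \<bar>\<tau>\<bar> + K * \<tau>\<^sup>2\<close>. With
    \<open>K = B\<^sup>2 / lo\<close> this quadratic expression is positive for every
    \<open>\<tau>\<close>.\<close>
  define B where "B = hi * b + \<bar>real_of_int n\<bar> / (2 * pi)"
  define K where "K = B\<^sup>2 / lo"
  define rad where "rad \<tau> t = half_norm_sq t * (1 + b * \<tau>) + K * \<tau>\<^sup>2" for \<tau> t :: real
  define p1 where "p1 \<tau> t = rad \<tau> t - n * \<tau> / (2 * pi)" for \<tau> t :: real
  define p2 where "p2 \<tau> t = rad \<tau> t + n * \<tau> / (2 * pi)" for \<tau> t :: real
  have pos: "p1 \<tau> t > 0" "p2 \<tau> t > 0" for \<tau> t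
  proof -
    define y where "y = B * \<bar>\<tau>\<bar>"
    have "\<bar>half_norm_sq t * (b * \<tau>)\<bar> \<le> hi * (b * \<bar>\<tau>\<bar>)"
      using lohi(1) lohi(2,3)[of t] b unfolding abs_mult by (intro mult_mono) auto
    moreover have "\<bar>n * \<tau> / (2 * pi)\<bar> = \<bar>real_of_int n\<bar> / (2 * pi) * \<bar>\<tau>\<bar>" by (simp add: abs_mult)
    moreover have "y = hi * (b * \<bar>\<tau>\<bar>) + \<bar>real_of_int n\<bar> / (2 * pi) * \<bar>\<tau>\<bar>" by (simp add: y_def B_def algebra_simps)
    moreover have "lo - y + K * \<tau>\<^sup>2 > 0"
    proof -
      have "K * \<tau>\<^sup>2 = y\<^sup>2 / lo" by (simp add: K_def y_def power_mult_distrib)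
      then have "lo * (lo - y + K * \<tau>\<^sup>2) = (y - lo / 2)\<^sup>2 + 3 / 4 * lo\<^sup>2"
        using lohi(1) by (simp add: power2_eq_square field_simps)
      also have "\<dots> > 0" using lohi(1) by (intro add_nonneg_pos) auto
      finally show ?thesis using lohi(1) by (simp add: zero_less_mult_iff)
    qed
    ultimately have *: "lo - \<bar>half_norm_sq t * (b * \<tau>)\<bar> - \<bar>n * \<tau> / (2 * pi)\<bar> + K * \<tau>\<^sup>2 > 0" by linarith
    have "rad \<tau> t = half_norm_sq t + half_norm_sq t * (b * \<tau>) + K * \<tau>\<^sup>2" by (simp add: rad_def algebra_simps)
    then show "p1 \<tau> t > 0" "p2 \<tau> t > 0" using * lohi(2)[of t] unfolding p1_def p2_def by linarith+
  qed
  define \<Psi> where "\<Psi> \<tau> t s = (of_real (sqrt (p1 \<tau> t)) * cis (angle t + 2 * pi * s),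
    of_real (sqrt (p2 \<tau> t)) * cis (angle t + - 2 * pi * s))" for \<tau> t s :: real
  let ?V = "\<lambda>\<tau> t s p' q' a' b'. (of_real (sqrt (p1 \<tau> t)) * cis (angle t + 2 * pi * s) * Complex (p' / (2 * p1 \<tau> t)) a',
    of_real (sqrt (p2 \<tau> t)) * cis (angle t + - 2 * pi * s) * Complex (q' / (2 * p2 \<tau> t)) b')"
  have d\<tau>: "vector_derivative (\<lambda>x. \<Psi> x t s) (at \<tau>) =
      ?V \<tau> t s (half_norm_sq t * b + 2 * K * \<tau> - n / (2 * pi)) (half_norm_sq t * b + 2 * K * \<tau> + n / (2 * pi)) 0 0" for \<tau> t s
    unfolding \<Psi>_def
    by (intro vector_derivative_at has_vector_derivative_Pair has_vector_derivative_polar pos DERIV_const)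
      (auto intro!: derivative_eq_intros simp: p1_def p2_def rad_def)
  have dt: "vector_derivative (\<lambda>x. \<Psi> \<tau> x s) (at t) =
      ?V \<tau> t s (half_norm_sq' t * (1 + b * \<tau>)) (half_norm_sq' t * (1 + b * \<tau>)) (angle' t) (angle' t)" for \<tau> t s
    unfolding \<Psi>_def
    by (intro vector_derivative_at has_vector_derivative_Pair has_vector_derivative_polar pos)
      (auto intro!: derivative_eq_intros has_real_derivative_angle has_real_derivative_half_norm_sq simp: p1_def p2_def rad_def)
  have ds: "vector_derivative (\<lambda>x. \<Psi> \<tau> t x) (at s) = ?V \<tau> t s 0 0 (2 * pi) (- 2 * pi)" for \<tau> t s
    unfolding \<Psi>_def
    by (intro vector_derivative_at has_vector_derivative_Pair has_vector_derivative_polar pos DERIV_const)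
      (auto intro!: derivative_eq_intros)

  have smooth\<Psi>: "smooth (\<lambda>(\<tau>, t, s). \<Psi> \<tau> t s)"
  proof -
    have r: "smooth_on UNIV (\<lambda>x :: real \<times> real \<times> real. rad (fst x) (fst (snd x)))"
      unfolding rad_def
      by (intro smooth_on_add smooth_on_mult smooth_on_power smooth_on_const smooth_on_fst smooth_on_snd smooth_on_id
          smooth_on_compose[OF smooth_on_half_norm_sq]) auto
    have "smooth_on UNIV (\<lambda>x :: real \<times> real \<times> real. p1 (fst x) (fst (snd x)))" "smooth_on UNIV (\<lambda>x :: real \<times> real \<times> real. p2 (fst x) (fst (snd x)))"
      unfolding p1_def p2_def
      by (intro smooth_on_add smooth_on_diff smooth_on_divide_real smooth_on_mult r smooth_on_const smooth_on_fst smooth_on_id; simp)+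
    moreover have "smooth_on UNIV (\<lambda>x :: real \<times> real \<times> real. angle (fst (snd x)))"
      by (intro smooth_on_compose[OF smooth_on_angle] smooth_on_fst smooth_on_snd smooth_on_id) auto
    ultimately have "smooth_on UNIV (\<lambda>x. \<Psi> (fst x) (fst (snd x)) (snd (snd x)))"
      unfolding \<Psi>_def
      by (intro smooth_on_Pair smooth_on_mult smooth_on_of_real smooth_on_sqrt smooth_on_cis smooth_on_add
          smooth_on_const smooth_on_snd smooth_on_id pos) auto
    then show ?thesis by (simp add: smooth_iff_smooth_on_UNIV case_prod_beta')
  qed
  have initial: "\<Psi> 0 t s = chek \<eta> t s" for t s
  proof -
    have h: "sqrt (half_norm_sq t) = cmod (\<eta> t) / sqrt 2" by (simp add: half_norm_sq_def real_sqrt_divide)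
    have "complex_of_real (sqrt (half_norm_sq t)) * cis (angle t + x) = cis x * \<eta> t / complex_of_real (sqrt 2)" for x
    proof -
      have "cis x * \<eta> t / complex_of_real (sqrt 2) = cis x * (of_real (cmod (\<eta> t)) * cis (angle t)) / complex_of_real (sqrt 2)"
        by (simp only: \<eta>_polar[symmetric])
      then show ?thesis by (simp add: h mult_ac flip: cis_mult)
    qed
    from this[of "2 * pi * s"] this[of "- 2 * pi * s"] show ?thesis by (simp add: \<Psi>_def chek_def p1_def p2_def rad_def)
  qed
  have cis1: "cis (x + 2 * pi * (s + 1)) = cis (x + 2 * pi * s)" "cis (x + - 2 * pi * (s + 1)) = cis (x + - 2 * pi * s)" for x s
  proof -
    have "cis (x + 2 * pi * (s + 1)) = cis (x + 2 * pi * s) * cis (2 * pi)" unfolding cis_mult by (simp add: algebra_simps)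
    then show "cis (x + 2 * pi * (s + 1)) = cis (x + 2 * pi * s)" by simp
    have "cis (x + - 2 * pi * (s + 1)) = cis (x + - 2 * pi * s) * cis (- (2 * pi))" unfolding cis_mult by (simp add: algebra_simps)
    then show "cis (x + - 2 * pi * (s + 1)) = cis (x + - 2 * pi * s)" by (simp flip: cis_inverse)
  qed
  have per: "\<Psi> \<tau> (t + 1) s = \<Psi> \<tau> t s" "\<Psi> \<tau> t (s + 1) = \<Psi> \<tau> t s" for \<tau> t s
    unfolding \<Psi>_def p1_def p2_def rad_def half_norm_sq_def angle_periodic periodic cis1 by simp_all
  have inj: "t - t' \<in> \<int> \<and> s - s' \<in> \<int>" if "\<tau> \<ge> 0" and eq: "\<Psi> \<tau> t s = \<Psi> \<tau> t' s'" for \<tau> t s t' s'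
  proof -
    have e1: "of_real (sqrt (p1 \<tau> t)) * cis (angle t + 2 * pi * s) = of_real (sqrt (p1 \<tau> t')) * cis (angle t' + 2 * pi * s')"
      and e2: "of_real (sqrt (p2 \<tau> t)) * cis (angle t + - 2 * pi * s) = of_real (sqrt (p2 \<tau> t')) * cis (angle t' + - 2 * pi * s')"
      using eq by (simp_all add: \<Psi>_def)
    have n1: "sqrt (p1 \<tau> t) = sqrt (p1 \<tau> t')"
      using arg_cong[OF e1, of cmod] pos(1)[of \<tau> t] pos(1)[of \<tau> t'] by (simp add: norm_mult)
    have n2: "sqrt (p2 \<tau> t) = sqrt (p2 \<tau> t')"
      using arg_cong[OF e2, of cmod] pos(2)[of \<tau> t] pos(2)[of \<tau> t'] by (simp add: norm_mult)
    have c1: "cis (angle t + 2 * pi * s) = cis (angle t' + 2 * pi * s')" using e1 n1 pos(1)[of \<tau> t'] by simp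
    have c2: "cis (angle t + - 2 * pi * s) = cis (angle t' + - 2 * pi * s')" using e2 n2 pos(2)[of \<tau> t'] by simp
    have "half_norm_sq t * (1 + b * \<tau>) = half_norm_sq t' * (1 + b * \<tau>)" using n1 by (simp add: p1_def rad_def)
    moreover have "1 + b * \<tau> > 0" using b \<open>\<tau> \<ge> 0\<close> by (simp add: add_pos_nonneg)
    ultimately have "half_norm_sq t = half_norm_sq t'" by simp
    then have nm: "cmod (\<eta> t) = cmod (\<eta> t')" by (simp add: half_norm_sq_def)
    \<comment> \<open>Multiplying the two phases removes \<open>s\<close> and leaves twice the
      angle, which lies in \<open>(0, pi)\<close>, where \<open>cis\<close> is injective.\<close>
    have "cis (angle t + 2 * pi * s) * cis (angle t + - 2 * pi * s) = cis (angle t' + 2 * pi * s') * cis (angle t' + - 2 * pi * s')"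
      unfolding c1 c2 ..
    then have "cis (2 * angle t) = cis (2 * angle t')" unfolding cis_mult by simp
    then have "2 * angle t = 2 * angle t'"
      using cis_Arg_unique[of "cis (2 * angle t)" "2 * angle t"] cis_Arg_unique[of "cis (2 * angle t)" "2 * angle t'"]
        angle_bounds[of t] angle_bounds[of t'] by (simp add: sgn_div_norm)
    then have an: "angle t = angle t'" by simp
    have "\<eta> t = \<eta> t'" using \<eta>_polar[of t] \<eta>_polar[of t'] nm an by metis
    then have "t - t' \<in> \<int>" by (rule inj_mod_1)
    moreover have "s - s' \<in> \<int>"
    proof -
      have "sin (angle t + 2 * pi * s) = sin (angle t + 2 * pi * s')" "cos (angle t + 2 * pi * s) = cos (angle t + 2 * pi * s')"
        using c1 an by (metis cis.sel(2), metis cis.sel(1))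
      then obtain j :: int where "angle t + 2 * pi * s = angle t + 2 * pi * s' + 2 * pi * j"
        using sin_cos_eq_iff by blast
      then have "2 * pi * (s - s') = 2 * pi * j" by (simp add: algebra_simps)
      then have "s - s' = j" by simp
      then show ?thesis by simp
    qed
    ultimately show ?thesis by simp
  qed
  have immersion: "c = 0 \<and> d = 0"
    if "\<tau> \<ge> 0" and eq: "c *\<^sub>R vector_derivative (\<lambda>u. \<Psi> \<tau> u s) (at t) + d *\<^sub>R vector_derivative (\<lambda>u. \<Psi> \<tau> t u) (at s) = 0" for c d :: real and \<tau> t s
  proof -
    have split: "c * x1 + d * y1 = 0 \<and> c * x2 + d * y2 = 0"
      if "c *\<^sub>R (w * Complex x1 x2) + d *\<^sub>R (w * Complex y1 y2) = 0" "w \<noteq> 0" for w x1 x2 y1 y2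
    proof -
      have "w * (c *\<^sub>R Complex x1 x2 + d *\<^sub>R Complex y1 y2) = 0" using that(1) by (simp add: algebra_simps)
      then have "c *\<^sub>R Complex x1 x2 + d *\<^sub>R Complex y1 y2 = 0" using that(2) by simp
      then show ?thesis by (simp add: complex_eq_iff)
    qed
    have nz: "of_real (sqrt (p1 \<tau> t)) * cis x \<noteq> 0" "of_real (sqrt (p2 \<tau> t)) * cis x \<noteq> 0" for x
      using pos[of \<tau> t] by auto
    have e: "c * (half_norm_sq' t * (1 + b * \<tau>) / (2 * p1 \<tau> t)) + d * (0 / (2 * p1 \<tau> t)) = 0" "c * angle' t + d * (2 * pi) = 0"
      "c * angle' t + d * (- 2 * pi) = 0"
      using split[OF _ nz(1)] split[OF _ nz(2)] eq unfolding dt ds zero_prod_def scaleR_Pair add_Pair prod.inject by blast+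
    \<comment> \<open>Moving \<open>s\<close> turns the two coordinates in opposite directions while
      moving \<open>t\<close> turns them equally, so the angular parts separate \<open>d\<close>
      from \<open>c\<close>.\<close>
    have "4 * pi * d = 0" using e(2,3) by (simp add: algebra_simps)
    then have d: "d = 0" by simp
    have "c = 0"
    proof (rule ccontr)
      assume "c \<noteq> 0"
      moreover have "1 + b * \<tau> > 0" using b \<open>\<tau> \<ge> 0\<close> by (simp add: add_pos_nonneg)
      ultimately have "angle' t = 0" "half_norm_sq' t = 0" using e d pos(1)[of \<tau> t] by auto
      then have "cnj (\<eta> t) * vector_derivative \<eta> (at t) = 0"
        using half_norm_sq_angle'[of t] by (simp add: complex_eq_iff half_norm_sq'_def)
      then show False using \<eta>_nonzero[of t] regular[of t] by simp
    qed
    with d show ?thesis by simp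
  qed
  have lagrangian: "omega (vector_derivative (\<lambda>u. \<Psi> \<tau> u s) (at t)) (vector_derivative (\<lambda>u. \<Psi> \<tau> t u) (at s)) = 0" for \<tau> t s
    unfolding dt ds omega_polar[OF pos] by simp
  have isotopy: "lag_isotopy \<eta> \<Psi> T" for T
    unfolding lag_isotopy_def using smooth\<Psi> initial per inj immersion lagrangian by auto

  \<comment> \<open>The leaf does not wind around the origin, so its angle is periodic. Hence the
    radial translation by \<open>K * \<tau>\<^sup>2\<close> sweeps out no area along the
    leaf.\<close>
  have int_angle': "integral {0..1} angle' = 0" "angle' integrable_on {0..1}"
  proof -
    have "(angle' has_integral angle 1 - angle 0) {0..1}"
      by (rule fundamental_theorem_of_calculus)
        (auto intro: has_vector_derivative_at_within[OF has_real_derivative_angle[unfolded has_real_derivative_iff_has_vector_derivative]])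
    then show "integral {0..1} angle' = 0" "angle' integrable_on {0..1}"
      using angle_periodic[of 0] by (auto simp: has_integral_iff)
  qed
  have swept_\<Gamma>: "swept_area \<Psi> (\<lambda>u. (u, 0)) \<tau> = - \<tau> * m" if "\<tau> \<ge> 0" for \<tau>
  proof -
    have ci: "continuous_on {0..1} (\<lambda>u. Im (cnj (\<eta> u) * vector_derivative \<eta> (at u)) / 2)"
      by (intro continuous_intros cont_\<eta> continuous_on_subset[OF smooth_on_imp_continuous_on[OF smooth_on_vector_derivative[OF smooth_\<eta>]]]) auto
    have "integral {0..1} (\<lambda>u. omega (vector_derivative (\<lambda>r'. \<Psi> r' (fst (u, 0::real)) (snd (u, 0))) (at r))
            (vector_derivative (\<lambda>u'. \<Psi> r (fst (u', 0::real)) (snd (u', 0))) (at u))) = b * I" for r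
    proof -
      have "omega (vector_derivative (\<lambda>r'. \<Psi> r' (fst (u, 0::real)) (snd (u, 0))) (at r))
            (vector_derivative (\<lambda>u'. \<Psi> r (fst (u', 0::real)) (snd (u', 0))) (at u))
          = b * (Im (cnj (\<eta> u) * vector_derivative \<eta> (at u)) / 2) + 2 * K * r * angle' u" for u
        unfolding half_norm_sq_angle'[symmetric] fst_conv snd_conv d\<tau> dt omega_polar[OF pos] by (simp add: field_simps)
      then have "integral {0..1} (\<lambda>u. omega (vector_derivative (\<lambda>r'. \<Psi> r' (fst (u, 0::real)) (snd (u, 0))) (at r))
            (vector_derivative (\<lambda>u'. \<Psi> r (fst (u', 0::real)) (snd (u', 0))) (at u)))
        = integral {0..1} (\<lambda>u. b * (Im (cnj (\<eta> u) * vector_derivative \<eta> (at u)) / 2) + 2 * K * r * angle' u)"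
        by (simp only:)
      also have "\<dots> = integral {0..1} (\<lambda>u. b * (Im (cnj (\<eta> u) * vector_derivative \<eta> (at u)) / 2)) + integral {0..1} (\<lambda>u. 2 * K * r * angle' u)"
        by (intro Henstock_Kurzweil_Integration.integral_add integrable_on_mult_right int_angle'(2) integrable_continuous_interval ci)
      also have "\<dots> = b * I" by (simp add: int_angle'(1) I_def)
      finally show ?thesis .
    qed
    then have "swept_area \<Psi> (\<lambda>u. (u, 0)) \<tau> = integral {0..\<tau>} (\<lambda>r. b * I)"
      unfolding swept_area_def by (simp only:)
    also have "\<dots> = - \<tau> * m" using that I by (simp add: b_def)
    finally show ?thesis .
  qed
  have swept_\<gamma>: "swept_area \<Psi> (\<lambda>u. (0, u)) \<tau> = - \<tau> * n" if "\<tau> \<ge> 0" for \<tau>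
  proof -
    have "omega (vector_derivative (\<lambda>r'. \<Psi> r' (fst (0::real, u)) (snd (0::real, u))) (at r))
            (vector_derivative (\<lambda>u'. \<Psi> r (fst (0::real, u')) (snd (0::real, u'))) (at u)) = - real_of_int n" for r u
      unfolding fst_conv snd_conv d\<tau> ds omega_polar[OF pos] by (simp add: field_simps)
    then have "swept_area \<Psi> (\<lambda>u. (0, u)) \<tau> = integral {0..\<tau>} (\<lambda>r. integral {0..1} (\<lambda>u::real. - real_of_int n))"
      unfolding swept_area_def by (simp only:)
    also have "\<dots> = - \<tau> * n" using that by simp
    finally show ?thesis .
  qed
  have "ereal T \<le> def_chek \<eta> m n" if "T \<ge> 0" for T
    unfolding def_chek_def
    by (rule Sup_upper, rule imageI, rule CollectI) (use that isotopy[of T] swept_\<Gamma> swept_\<gamma> in \<open>auto intro!: exI[of _ \<Psi>]\<close>)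
  then show ?thesis by (intro ereal_top) (meson dual_order.trans ereal_less_eq(3) linear)
qed

section \<open>Conclusion for the invariant of the fibration\<close>

lemma pb4plus_fib_nonneg:
  "0 \<le> pb4plus (fib_set \<eta> m n 0 (1/4)) (fib_set \<eta> m n (1/2) (3/4)) (fib_set \<eta> m n (3/4) 1) (fib_set \<eta> m n (1/4) (1/2))"
  using pb4_pair_exists[OF zero_less_one, of m n] by (intro pb4plus_nonneg) blast

text \<open>The bounds for the pairs are let tend to their limit as \<open>\<epsilon>\<close> goes
  to \<open>0\<close>. For \<open>m < 0\<close> the limit is \<open>0\<close>, which together with
  nonnegativity makes \<open>pb4plus\<close> vanish exactly, as the value \<open>\<infinity>\<close>
  requires.\<close>

lemma pb4plus_fib_le:
  fixes m n :: int
  shows "pb4plus (fib_set \<eta> m n 0 (1/4)) (fib_set \<eta> m n (1/2) (3/4)) (fib_set \<eta> m n (3/4) 1) (fib_set \<eta> m n (1/4) (1/2)) \<le> real_of_int (max 0 m) / a"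
  (is "?p \<le> _")
proof (rule tendsto_lowerbound)
  let ?b = "\<lambda>\<epsilon> :: real. (1 + \<epsilon>) * (real_of_int (max 0 m) * ((1 + \<epsilon>) / a) + 2 * (\<bar>m\<bar> + \<bar>n\<bar>) * \<epsilon>)"
  have "(?b \<longlongrightarrow> (1 + 0) * (real_of_int (max 0 m) * ((1 + 0) / a) + 2 * (\<bar>m\<bar> + \<bar>n\<bar>) * (0::real))) (at_right 0)"
    using a_pos by (intro tendsto_mult tendsto_add tendsto_divide tendsto_const tendsto_ident_at) auto
  then show "(?b \<longlongrightarrow> real_of_int (max 0 m) / a) (at_right 0)" by simp
  show "\<forall>\<^sub>F \<epsilon> in at_right 0. ?p \<le> ?b \<epsilon>"
  proof (rule eventually_mono[OF eventually_at_right_less])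
    fix \<epsilon> :: real assume "0 < \<epsilon>"
    then obtain F G where "(F, G) \<in> pb4_pairs (fib_set \<eta> m n 0 (1/4)) (fib_set \<eta> m n (1/2) (3/4))
        (fib_set \<eta> m n (3/4) 1) (fib_set \<eta> m n (1/4) (1/2))" "\<And>z. poisson F G z \<le> ?b \<epsilon>"
      using pb4_pair_exists[of \<epsilon> m n] by auto
    then show "?p \<le> ?b \<epsilon>" by (rule pb4plus_le)
  qed
qed simp

end

theorem mainTheorem10:
  fixes \<eta> :: "real \<Rightarrow> complex" and a :: real and m n :: int
  assumes "a > 0" and "leaf \<eta> a"
  shows "(m > 0 \<longrightarrow> bp_chek \<eta> m n \<ge> ereal (a / of_int m)) \<and>
         (m < 0 \<longrightarrow> bp_chek \<eta> m n = \<infinity> \<and> def_chek \<eta> m n = \<infinity>)"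
proof -
  interpret leaf_curve \<eta> a using assms by unfold_locales auto
  define p where "p = pb4plus (fib_set \<eta> m n 0 (1/4)) (fib_set \<eta> m n (1/2) (3/4))
      (fib_set \<eta> m n (3/4) 1) (fib_set \<eta> m n (1/4) (1/2))"
  have p: "0 \<le> p" "p \<le> real_of_int (max 0 m) / a"
    unfolding p_def by (rule pb4plus_fib_nonneg, rule pb4plus_fib_le)
  have bp: "bp_chek \<eta> m n = inv_or_infty p" if "m \<noteq> 0"
    using that by (simp add: bp_chek_def p_def)
  have "ereal (a / of_int m) \<le> inv_or_infty p" if "m > 0"
  proof (cases "p = 0")
    case False
    then have "a / of_int m \<le> 1 / p" using p that \<open>a > 0\<close> by (simp add: field_simps max_def)
    then show ?thesis using False by (simp add: inv_or_infty_def)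
  qed (simp add: inv_or_infty_def)
  moreover have "inv_or_infty p = \<infinity>" if "m < 0"
    using p that by (simp add: inv_or_infty_def max_def)
  ultimately show ?thesis using bp def_chek_infinite by auto
qed

end
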